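(* Let $\mathcal{O}_K$ be a Dedekind domain with fraction field $K$, let $L$ be a finite separable extension of $K$ of degree $d$, and let $\mathcal{O}_L$ be the integral closure of $\mathcal{O}_K$ in $L$. Let $\mathfrak{n}$ be a nonzero square-free ideal of $\mathcal{O}_K$ with $N_K(\mathfrak{n})$ finite. Then $\mathfrak{n}\mathcal{O}_L$ is a Carmichael ideal of $\mathcal{O}_L$ if and only if: (1) $\mathfrak{n}\mathcal{O}_L$ is a composite ideal; (2) $\mathfrak{n}$ is relatively prime to the discriminant $\mathrm{Disc}(L/K)$; (3) for each prime ideal $\mathfrak{p}\mid\mathfrak{n}$ and every prime ideal $\mathfrak{P}$ of $\mathcal{O}_L$ lying above $\mathfrak{p}$, $N_K(\mathfrak{p})^{f(\mathfrak{P})}-1$ divides $N_K(\mathfrak{n})^d-1$, where $f(\mathfrak{P})$ is the residue class degree of $\mathfrak{P}$ in $L/K$.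
   Context: For an ideal $\mathfrak{n}$ of a Dedekind domain $\mathcal{O}_K$, $N_K(\mathfrak{n})=|\mathcal{O}_K/\mathfrak{n}|$. A composite ideal means a nonzero proper ideal that is not a prime ideal. Square-free means every exponent in the prime ideal factorization is $1$. A finite ring $S$ is a Carmichael ring if $S$ is not a field and $a^{|S|}=a$ for every $a\in S$; an ideal $I$ of a ring $R$ is a Carmichael ideal if $R/I$ is a Carmichael ring. $\mathrm{Disc}(L/K)$ is the relative discriminant ideal of $\mathcal{O}_L$ over $\mathcal{O}_K$.
   Formalization: A Carmichael ring is additionally required to be nonzero (1 ≠ 0); otherwise for the unit ideal n = O_K the quotient O_L/nO_L is the zero ring, which would count as Carmichael although nO_L is not composite. *)

theory Defs
  imports "HOL-Algebra.Ideal_Product" "HOL-Algebra.QuotRing" "HOL-Algebra.Ring_Divisibility"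
    "HOL-Algebra.Subrings" "HOL-Computational_Algebra.Polynomial" "HOL-Combinatorics.Permutations"
begin

text \<open>All rings live inside an ambient field of type 'a (the field L and its subfields,
  subrings).  A subset S is turned into an HOL-Algebra ring structure with the
  ambient operations.\<close>

definition ring_of :: "'a::field set \<Rightarrow> 'a ring" where
  "ring_of S = \<lparr>carrier = S, monoid.mult = (*), one = 1, zero = 0, add = (+)\<rparr>"

definition fraction_field_of :: "'a::field set \<Rightarrow> 'a set \<Rightarrow> bool" where
  "fraction_field_of OK K \<longleftrightarrow> OK \<subseteq> K \<and>
     K = {a / b | a b. a \<in> OK \<and> b \<in> OK \<and> b \<noteq> 0}"

definition integral_over :: "'a::field set \<Rightarrow> 'a \<Rightarrow> bool" where
  "integral_over R x \<longleftrightarrow> (\<exists>p. (\<forall>i. coeff p i \<in> R) \<and> lead_coeff p = 1 \<and> poly p x = 0)"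

definition integral_closure_in :: "'a::field set \<Rightarrow> 'a set \<Rightarrow> 'a set" where
  "integral_closure_in R L = {x \<in> L. integral_over R x}"

definition dedekind_domain :: "'a::field set \<Rightarrow> 'a set \<Rightarrow> bool" where
  "dedekind_domain OK K \<longleftrightarrow> noetherian_domain (ring_of OK) \<and> fraction_field_of OK K \<and>
     integral_closure_in OK K = OK \<and>
     (\<forall>P. primeideal P (ring_of OK) \<and> P \<noteq> {0} \<longrightarrow> maximalideal P (ring_of OK))"

definition lin_indep_over :: "'a::field set \<Rightarrow> (nat \<Rightarrow> 'a) \<Rightarrow> nat \<Rightarrow> bool" where
  "lin_indep_over K b d \<longleftrightarrow>
     (\<forall>c. (\<forall>i<d. c i \<in> K) \<and> (\<Sum>i<d. c i * b i) = 0 \<longrightarrow> (\<forall>i<d. c i = 0))"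

definition is_basis_over :: "'a::field set \<Rightarrow> 'a set \<Rightarrow> (nat \<Rightarrow> 'a) \<Rightarrow> nat \<Rightarrow> bool" where
  "is_basis_over K L b d \<longleftrightarrow> (\<forall>i<d. b i \<in> L) \<and> lin_indep_over K b d \<and>
     (\<forall>y\<in>L. \<exists>c. (\<forall>i<d. c i \<in> K) \<and> y = (\<Sum>i<d. c i * b i))"

definition ext_degree :: "'a::field set \<Rightarrow> 'a set \<Rightarrow> nat \<Rightarrow> bool" where
  "ext_degree K L d \<longleftrightarrow> (\<exists>b. is_basis_over K L b d)"

definition separable_ext :: "'a::field set \<Rightarrow> 'a set \<Rightarrow> bool" where
  "separable_ext K L \<longleftrightarrow> (\<forall>x\<in>L. \<exists>p. p \<noteq> 0 \<and> (\<forall>i. coeff p i \<in> K) \<and> poly p x = 0 \<and>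
       coprime p (pderiv p))"

definition subfield_of :: "'a::field set \<Rightarrow> bool" where
  "subfield_of K \<longleftrightarrow> subfield K (ring_of (UNIV :: 'a set))"

definition coords :: "'a::field set \<Rightarrow> (nat \<Rightarrow> 'a) \<Rightarrow> nat \<Rightarrow> 'a \<Rightarrow> nat \<Rightarrow> 'a" where
  "coords K b d y = (SOME c. (\<forall>i<d. c i \<in> K) \<and> y = (\<Sum>i<d. c i * b i))"

definition trace_ext :: "'a::field set \<Rightarrow> 'a set \<Rightarrow> nat \<Rightarrow> 'a \<Rightarrow> 'a" where
  "trace_ext K L d x = (let b = (SOME b. is_basis_over K L b d) in
      \<Sum>i<d. coords K b d (x * b i) i)"

text \<open>Discriminant of a d-tuple: det (Tr(x_i x_j)) (Leibniz formula).\<close>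
definition disc_tuple :: "'a::field set \<Rightarrow> 'a set \<Rightarrow> nat \<Rightarrow> (nat \<Rightarrow> 'a) \<Rightarrow> 'a" where
  "disc_tuple K L d x = (\<Sum>p | p permutes {..<d}.
      of_int (sign p) * (\<Prod>i<d. trace_ext K L d (x i * x (p i))))"

definition disc_ideal :: "'a::field set \<Rightarrow> 'a set \<Rightarrow> 'a set \<Rightarrow> 'a set \<Rightarrow> nat \<Rightarrow> 'a set" where
  "disc_ideal OK OL K L d =
     genideal (ring_of OK) {disc_tuple K L d x | x. \<forall>i<d. x i \<in> OL}"

definition ideal_dvd :: "('a, 'b) ring_scheme \<Rightarrow> 'a set \<Rightarrow> 'a set \<Rightarrow> bool" where
  "ideal_dvd R I J \<longleftrightarrow> (\<exists>J'. ideal J' R \<and> J = ideal_prod R I J')"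

definition squarefree_ideal :: "('a, 'b) ring_scheme \<Rightarrow> 'a set \<Rightarrow> bool" where
  "squarefree_ideal R I \<longleftrightarrow>
     (\<forall>P. primeideal P R \<and> P \<noteq> {\<zero>\<^bsub>R\<^esub>} \<longrightarrow> \<not> ideal_dvd R (ideal_prod R P P) I)"

definition composite_ideal :: "('a, 'b) ring_scheme \<Rightarrow> 'a set \<Rightarrow> bool" where
  "composite_ideal R I \<longleftrightarrow> ideal I R \<and> I \<noteq> {\<zero>\<^bsub>R\<^esub>} \<and> I \<noteq> carrier R \<and> \<not> primeideal I R"

definition ideal_norm :: "('a, 'b) ring_scheme \<Rightarrow> 'a set \<Rightarrow> nat" where
  "ideal_norm R I = card (carrier (R Quot I))"

definition carmichael_ring :: "('a, 'b) ring_scheme \<Rightarrow> bool" where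
  "carmichael_ring S \<longleftrightarrow> finite (carrier S) \<and> \<one>\<^bsub>S\<^esub> \<noteq> \<zero>\<^bsub>S\<^esub> \<and> \<not> field S \<and>
     (\<forall>a\<in>carrier S. a [^]\<^bsub>S\<^esub> card (carrier S) = a)"

definition carmichael_ideal :: "('a, 'b) ring_scheme \<Rightarrow> 'a set \<Rightarrow> bool" where
  "carmichael_ideal R I \<longleftrightarrow> carmichael_ring (R Quot I)"

text \<open>Residue degree f(P|p) = dim over OK/p of OL/P, expressed via lifts of a basis:
  y_1..y_f in OL whose classes span OL/P over OK/p and are independent over OK/p.\<close>
definition residue_basis :: "'a::field set \<Rightarrow> 'a set \<Rightarrow> 'a set \<Rightarrow> 'a set \<Rightarrow> (nat \<Rightarrow> 'a) \<Rightarrow> nat \<Rightarrow> bool" where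
  "residue_basis OK OL p P y f \<longleftrightarrow> (\<forall>i<f. y i \<in> OL) \<and>
     (\<forall>x\<in>OL. \<exists>c. (\<forall>i<f. c i \<in> OK) \<and> x - (\<Sum>i<f. c i * y i) \<in> P) \<and>
     (\<forall>c. (\<forall>i<f. c i \<in> OK) \<and> (\<Sum>i<f. c i * y i) \<in> P \<longrightarrow> (\<forall>i<f. c i \<in> p))"

definition residue_degree :: "'a::field set \<Rightarrow> 'a set \<Rightarrow> 'a set \<Rightarrow> 'a set \<Rightarrow> nat" where
  "residue_degree OK OL p P = (THE f. \<exists>y. residue_basis OK OL p P y f)"

end

theory Submission
  imports Defs "Jordan_Normal_Form.Char_Poly"
begin

text \<open>Write \<open>A\<close> for \<open>OK\<close> and \<open>B\<close> for its integral closure in \<open>L\<close>. For a prime \<open>p\<close> dividing \<open>n\<close>, the ring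
  \<open>B / p B\<close> has dimension \<open>d\<close> over the finite field \<open>A / p\<close>, and its trace form is the reduction of the one of
  \<open>L / K\<close>. Elements of square zero lie in the radical of the trace form; conversely, a minimal ideal of a reduced
  \<open>B / p B\<close> is a finite field, on which the trace does not vanish. Hence \<open>B / p B\<close> is reduced if and only if \<open>p\<close>
  does not contain the discriminant. As \<open>n\<close> is squarefree, \<open>B / n B\<close> is the product of the \<open>B / p B\<close> and has
  \<open>N = (card (A / n)) ^ d\<close> elements. So \<open>a ^ N = a\<close> holds in \<open>B / n B\<close> if and only if all \<open>B / p B\<close> are reduced and
  the identity holds in every residue field \<open>B / P\<close>, which by cyclicity of the unit group means that
  \<open>card (B / P) - 1\<close> divides \<open>N - 1\<close>.

  No localization is needed: the inverse of \<open>p\<close> is \<open>A + t A\<close> for some \<open>t\<close>, whence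
  \<open>p M = {x \<in> M. t x \<in> M}\<close> for every lattice \<open>M\<close>.\<close>

section \<open>Linear algebra modulo a maximal ideal\<close>

text \<open>\<open>B\<close> need not be free over \<open>A\<close>, and at the outset it is not
  even known to lie in a finitely generated \<open>A\<close>-module, so there is no global basis in
  which to reduce the trace. Dimensions are therefore counted in quotients \<open>M / Z\<close>,
  written as congruences between elements of one ambient field. The bound on \<open>B\<close> comes
  from a dual basis for the trace form of \<open>L / K\<close>, and this requires the traces of
  elements of \<open>B\<close> to lie in \<open>A\<close>. To avoid a circle, integrality of the
  trace is obtained earlier, from auxiliary lattices stable under the given element. The trace has
  to be shown nonzero in two settings: for \<open>L / K\<close>, where separability enters, and for
  a minimal ideal of \<open>B / p B\<close>, where finiteness of \<open>A / p\<close> enters. In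
  characteristic \<open>l\<close> both reduce to one criterion: the \<open>l\<close>-th powers of a
  basis stay independent. This replaces embeddings into an algebraic closure and primitive
  elements.\<close>

definition subring_set :: "'a::field set \<Rightarrow> bool" where
  "subring_set A \<longleftrightarrow> 1 \<in> A \<and> (\<forall>x\<in>A. \<forall>y\<in>A. x - y \<in> A \<and> x * y \<in> A)"

definition submod :: "'a::field set \<Rightarrow> 'a set \<Rightarrow> bool" where
  "submod A M \<longleftrightarrow> 0 \<in> M \<and> (\<forall>x\<in>M. \<forall>y\<in>M. x + y \<in> M) \<and> (\<forall>a\<in>A. \<forall>x\<in>M. a * x \<in> M)"

text \<open>Maximality of \<open>p\<close> is phrased by inverses modulo \<open>p\<close>, so that a
  maximal ideal of \<open>A\<close> and the zero ideal of a field are treated alike. The linear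
  algebra below is used both for lattices over \<open>A / p\<close> and for \<open>L\<close> over
  \<open>K\<close>.\<close>

definition field_mod :: "'a::field set \<Rightarrow> 'a set \<Rightarrow> bool" where
  "field_mod A p \<longleftrightarrow> submod A p \<and> p \<subseteq> A \<and> 1 \<notin> p \<and> (\<forall>a\<in>A - p. \<exists>a'\<in>A. a * a' - 1 \<in> p)"

lemma subring_set_0: "subring_set A \<Longrightarrow> 0 \<in> A"
  unfolding subring_set_def by (metis diff_self)

lemma subring_set_1: "subring_set A \<Longrightarrow> 1 \<in> A"
  unfolding subring_set_def by blast

lemma subring_set_uminus: "subring_set A \<Longrightarrow> x \<in> A \<Longrightarrow> - x \<in> A"
  unfolding subring_set_def by (metis diff_0 diff_self)

lemma subring_set_add: "subring_set A \<Longrightarrow> x \<in> A \<Longrightarrow> y \<in> A \<Longrightarrow> x + y \<in> A"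
  using subring_set_uminus[of A y] unfolding subring_set_def by (metis diff_minus_eq_add)

lemma subring_set_diff: "subring_set A \<Longrightarrow> x \<in> A \<Longrightarrow> y \<in> A \<Longrightarrow> x - y \<in> A"
  unfolding subring_set_def by blast

lemma subring_set_mult: "subring_set A \<Longrightarrow> x \<in> A \<Longrightarrow> y \<in> A \<Longrightarrow> x * y \<in> A"
  unfolding subring_set_def by blast

lemma subring_set_sum: "subring_set A \<Longrightarrow> (\<And>i. i \<in> I \<Longrightarrow> f i \<in> A) \<Longrightarrow> sum f I \<in> A"
  by (induction I rule: infinite_finite_induct) (auto simp: subring_set_0 subring_set_add)

lemma subring_set_prod: "subring_set A \<Longrightarrow> (\<And>i. i \<in> I \<Longrightarrow> f i \<in> A) \<Longrightarrow> prod f I \<in> A"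
  by (induction I rule: infinite_finite_induct) (auto simp: subring_set_1 subring_set_mult)

lemma subring_set_power: "subring_set A \<Longrightarrow> x \<in> A \<Longrightarrow> x ^ n \<in> A"
  by (induction n) (auto simp: subring_set_1 subring_set_mult)

lemma subring_set_of_nat: "subring_set A \<Longrightarrow> of_nat n \<in> A"
  by (induction n) (auto simp: subring_set_0 subring_set_1 subring_set_add)

lemmas subring_set_intros = subring_set_0 subring_set_1 subring_set_uminus subring_set_add
  subring_set_diff subring_set_mult subring_set_sum subring_set_power subring_set_of_nat

lemma submod_0: "submod A M \<Longrightarrow> 0 \<in> M"
  unfolding submod_def by blast

lemma submod_add: "submod A M \<Longrightarrow> x \<in> M \<Longrightarrow> y \<in> M \<Longrightarrow> x + y \<in> M"
  unfolding submod_def by blast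

lemma submod_smult: "submod A M \<Longrightarrow> a \<in> A \<Longrightarrow> x \<in> M \<Longrightarrow> a * x \<in> M"
  unfolding submod_def by blast

lemma submod_smult_right: "submod A M \<Longrightarrow> a \<in> A \<Longrightarrow> x \<in> M \<Longrightarrow> x * a \<in> M"
  unfolding submod_def by (metis mult.commute)

lemma submod_uminus: "subring_set A \<Longrightarrow> submod A M \<Longrightarrow> x \<in> M \<Longrightarrow> - x \<in> M"
  using submod_smult[of A M "- 1" x] by (simp add: subring_set_uminus subring_set_1)

lemma submod_diff: "subring_set A \<Longrightarrow> submod A M \<Longrightarrow> x \<in> M \<Longrightarrow> y \<in> M \<Longrightarrow> x - y \<in> M"
  using submod_add[of A M x "- y"] by (simp add: submod_uminus)

lemma submod_sum: "submod A M \<Longrightarrow> (\<And>i. i \<in> I \<Longrightarrow> f i \<in> M) \<Longrightarrow> sum f I \<in> M"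
  by (induction I rule: infinite_finite_induct) (auto simp: submod_0 submod_add)

lemma submod_lincomb:
  "submod A M \<Longrightarrow> (\<And>i. i \<in> I \<Longrightarrow> c i \<in> A) \<Longrightarrow> (\<And>i. i \<in> I \<Longrightarrow> y i \<in> M) \<Longrightarrow> (\<Sum>i\<in>I. c i * y i) \<in> M"
  by (intro submod_sum submod_smult)

lemma submod_lincombs:
  assumes A: "subring_set A"
  shows "submod A {\<Sum>i\<in>I. c i * g i | c. \<forall>i\<in>I. c i \<in> A}" (is "submod A ?S")
proof -
  have SI: "(\<Sum>i\<in>I. c i * g i) \<in> ?S" if "\<forall>i\<in>I. c i \<in> A" for c using that by blast
  show ?thesis
    unfolding submod_def
  proof (intro conjI ballI)
    show "0 \<in> ?S" using SI[of "\<lambda>_. 0"] subring_set_0[OF A] by simp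
  next
    fix s t assume "s \<in> ?S" "t \<in> ?S"
    then obtain c c' where c: "\<forall>i\<in>I. c i \<in> A" "s = (\<Sum>i\<in>I. c i * g i)"
      "\<forall>i\<in>I. c' i \<in> A" "t = (\<Sum>i\<in>I. c' i * g i)" by blast
    have "s + t = (\<Sum>i\<in>I. (c i + c' i) * g i)" using c by (simp add: distrib_right sum.distrib)
    then show "s + t \<in> ?S" using SI[of "\<lambda>i. c i + c' i"] c subring_set_add[OF A] by simp
  next
    fix a s assume a: "a \<in> A" and "s \<in> ?S"
    then obtain c where c: "\<forall>i\<in>I. c i \<in> A" "s = (\<Sum>i\<in>I. c i * g i)" by blast
    have "a * s = (\<Sum>i\<in>I. (a * c i) * g i)" using c by (simp add: mult.assoc sum_distrib_left)
    then show "a * s \<in> ?S" using SI[of "\<lambda>i. a * c i"] c a subring_set_mult[OF A] by simp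
  qed
qed

lemma submod_diff_swap: "subring_set A \<Longrightarrow> submod A M \<Longrightarrow> x - y \<in> M \<Longrightarrow> y - x \<in> M"
  using submod_uminus[of A M "x - y"] by simp

lemma submod_self: "subring_set A \<Longrightarrow> submod A A"
  by (simp add: submod_def subring_set_0 subring_set_add subring_set_mult)

lemma submod_singleton_0: "submod A {0}"
  by (simp add: submod_def)

lemma field_mod_prime:
  assumes "subring_set A" "field_mod A p" "a \<in> A" "b \<in> A" "a * b \<in> p" "a \<notin> p"
  shows "b \<in> p"
proof -
  obtain a' where a': "a' \<in> A" "a * a' - 1 \<in> p"
    using assms unfolding field_mod_def by blast
  have p: "submod A p" using assms(2) unfolding field_mod_def by blast
  have "a' * (a * b) - b * (a * a' - 1) \<in> p"
    by (rule submod_diff[OF assms(1) p submod_smult[OF p a'(1) assms(5)]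
          submod_smult[OF p assms(4) a'(2)]])
  then show ?thesis by (simp add: algebra_simps)
qed

text \<open>The vector space \<open>M/Z\<close> over the field \<open>A/p\<close>, where all sets live in one ambient field.\<close>

locale linmod =
  fixes A p M Z :: "'a::field set"
  assumes A: "subring_set A" and p: "field_mod A p"
    and M: "submod A M" and Z: "submod A Z" and ZM: "Z \<subseteq> M"
    and pM: "\<And>a x. a \<in> p \<Longrightarrow> x \<in> M \<Longrightarrow> a * x \<in> Z"
begin

definition indep :: "nat \<Rightarrow> (nat \<Rightarrow> 'a) \<Rightarrow> bool" where
  "indep f y \<longleftrightarrow> (\<forall>c. (\<forall>i<f. c i \<in> A) \<and> (\<Sum>i<f. c i * y i) \<in> Z \<longrightarrow> (\<forall>i<f. c i \<in> p))"

definition spans :: "nat \<Rightarrow> (nat \<Rightarrow> 'a) \<Rightarrow> bool" where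
  "spans f y \<longleftrightarrow> (\<forall>x\<in>M. \<exists>c. (\<forall>i<f. c i \<in> A) \<and> x - (\<Sum>i<f. c i * y i) \<in> Z)"

lemma residue_basis_iff:
  "residue_basis A M p Z y f \<longleftrightarrow> (\<forall>i<f. y i \<in> M) \<and> spans f y \<and> indep f y"
  unfolding residue_basis_def indep_def spans_def by blast

lemma p_sub: "submod A p" and p_A: "p \<subseteq> A" and one_notin: "1 \<notin> p"
  using p unfolding field_mod_def by blast+

lemma inv_mod: "a \<in> A \<Longrightarrow> a \<notin> p \<Longrightarrow> \<exists>a'\<in>A. a * a' - 1 \<in> p"
  using p unfolding field_mod_def by blast

lemma p_prime: "a \<in> A \<Longrightarrow> b \<in> A \<Longrightarrow> a * b \<in> p \<Longrightarrow> a \<notin> p \<Longrightarrow> b \<in> p"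
  using field_mod_prime[OF A p] .

lemma indepD: "indep f y \<Longrightarrow> (\<And>i. i < f \<Longrightarrow> c i \<in> A) \<Longrightarrow> (\<Sum>i<f. c i * y i) \<in> Z \<Longrightarrow> i < f \<Longrightarrow> c i \<in> p"
  unfolding indep_def by blast

lemma spansE:
  assumes "spans f y" "x \<in> M"
  obtains c where "\<And>i. i < f \<Longrightarrow> c i \<in> A" "x - (\<Sum>i<f. c i * y i) \<in> Z"
  using assms unfolding spans_def by blast

lemma indep_coords_unique:
  assumes "indep f y" "\<And>i. i < f \<Longrightarrow> c i \<in> A" "\<And>i. i < f \<Longrightarrow> c' i \<in> A"
    and "x - (\<Sum>i<f. c i * y i) \<in> Z" "x' - (\<Sum>i<f. c' i * y i) \<in> Z" "x - x' \<in> Z" "i < f"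
  shows "c i - c' i \<in> p"
proof -
  have "(x - x') - ((x - (\<Sum>i<f. c i * y i)) - (x' - (\<Sum>i<f. c' i * y i))) \<in> Z"
    by (rule submod_diff[OF A Z assms(6) submod_diff[OF A Z assms(4,5)]])
  then have "(\<Sum>i<f. (c i - c' i) * y i) \<in> Z"
    by (simp add: algebra_simps sum_subtractf)
  from indepD[OF assms(1) _ this, of i] show ?thesis
    using assms A by (auto intro: subring_set_diff)
qed

text \<open>Division-free Gaussian elimination over the field \<open>A / p\<close>: more than
  \<open>m\<close> vectors with \<open>m\<close> entries are dependent. The index set is an
  arbitrary finite set, so that the pivot row can be removed in the induction on the number of
  columns.\<close>

lemma kernel_exists:
  assumes "finite I" "m < card I" "\<And>i j. i \<in> I \<Longrightarrow> j < m \<Longrightarrow> a i j \<in> A"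
  shows "\<exists>c. (\<forall>i\<in>I. c i \<in> A) \<and> (\<exists>i\<in>I. c i \<notin> p) \<and> (\<forall>j<m. (\<Sum>i\<in>I. c i * a i j) \<in> p)"
  using assms
proof (induction m arbitrary: I a)
  case 0
  then have "I \<noteq> {}" by auto
  then show ?case
    using one_notin subring_set_1[OF A] by (intro exI[of _ "\<lambda>_. 1"]) auto
next
  case (Suc m)
  show ?case
  proof (cases "\<forall>i\<in>I. a i m \<in> p")
    case True
    have "\<exists>c. (\<forall>i\<in>I. c i \<in> A) \<and> (\<exists>i\<in>I. c i \<notin> p) \<and> (\<forall>j<m. (\<Sum>i\<in>I. c i * a i j) \<in> p)"
      using Suc.prems by (intro Suc.IH) auto
    then obtain c where c: "\<And>i. i\<in>I \<Longrightarrow> c i \<in> A" "\<exists>i\<in>I. c i \<notin> p" "\<And>j. j<m \<Longrightarrow> (\<Sum>i\<in>I. c i * a i j) \<in> p"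
      by blast
    have "(\<Sum>i\<in>I. c i * a i m) \<in> p"
      using c True by (intro submod_lincomb[OF p_sub]) auto
    then show ?thesis
      using c by (intro exI[of _ c]) (auto simp: less_Suc_eq)
  next
    case False
    then obtain k where k: "k \<in> I" "a k m \<notin> p" by blast
    define I' where "I' = I - {k}"
    have I: "I = insert k I'" "k \<notin> I'" "finite I'" using k Suc.prems(1) by (auto simp: I'_def)
    define a' where "a' i j = a k m * a i j - a i m * a k j" for i j
    have "\<exists>c. (\<forall>i\<in>I'. c i \<in> A) \<and> (\<exists>i\<in>I'. c i \<notin> p) \<and> (\<forall>j<m. (\<Sum>i\<in>I'. c i * a' i j) \<in> p)"
      using Suc.prems I by (intro Suc.IH) (auto simp: a'_def intro!: subring_set_diff[OF A] subring_set_mult[OF A])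
    then obtain c where c: "\<And>i. i\<in>I' \<Longrightarrow> c i \<in> A" "\<exists>i\<in>I'. c i \<notin> p"
        "\<And>j. j<m \<Longrightarrow> (\<Sum>i\<in>I'. c i * a' i j) \<in> p"
      by blast
    \<comment> \<open>The coefficient of the pivot row is chosen so that the combination of the rows
      \<open>a i\<close> equals that of the reduced rows \<open>a' i\<close> exactly. Column
      \<open>m\<close> then vanishes outright, and the other columns are covered by the induction
      hypothesis.\<close>
    define e where "e = (\<lambda>i. if i = k then - (\<Sum>i\<in>I'. c i * a i m) else c i * a k m)"
    have akm: "a k m \<in> A" using Suc.prems k by auto
    have eA: "\<forall>i\<in>I. e i \<in> A"
      using c Suc.prems I akm unfolding e_def
      by (auto intro!: subring_set_uminus[OF A] subring_set_sum[OF A] subring_set_mult[OF A])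
    obtain l where l: "l \<in> I'" "c l \<notin> p" using c by blast
    have "e l \<notin> p"
    proof
      assume "e l \<in> p"
      moreover have "l \<noteq> k" using l I by blast
      ultimately have "a k m * c l \<in> p" by (simp add: e_def mult.commute)
      then show False using p_prime[OF akm c(1)[OF l(1)]] k l by blast
    qed
    moreover have "(\<Sum>i\<in>I. e i * a i j) \<in> p" if j: "j < Suc m" for j
    proof -
      have "(\<Sum>i\<in>I. e i * a i j) = e k * a k j + (\<Sum>i\<in>I'. e i * a i j)"
        using I by simp
      also have "(\<Sum>i\<in>I'. e i * a i j) = (\<Sum>i\<in>I'. c i * a k m * a i j)"
        using I by (intro sum.cong) (auto simp: e_def)
      also have "e k * a k j + \<dots> = (\<Sum>i\<in>I'. c i * a' i j)"
        by (simp add: e_def a'_def sum_distrib_left sum_distrib_right sum_subtractf algebra_simps)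
      finally have eq: "(\<Sum>i\<in>I. e i * a i j) = (\<Sum>i\<in>I'. c i * a' i j)" .
      show ?thesis
      proof (cases "j = m")
        case True
        then have "(\<Sum>i\<in>I'. c i * a' i j) = 0" by (intro sum.neutral) (auto simp: a'_def)
        then show ?thesis using eq p_sub by (simp add: submod_0)
      next
        case False
        then show ?thesis using eq c(3)[of j] j by auto
      qed
    qed
    ultimately show ?thesis using eA l I by (intro exI[of _ e]) blast
  qed
qed

lemma kernel_exists_lessThan:
  fixes r :: nat
  assumes "m < r" "\<And>i j. i < r \<Longrightarrow> j < m \<Longrightarrow> a i j \<in> A"
  obtains c where "\<And>i. i < r \<Longrightarrow> c i \<in> A" "\<exists>i<r. c i \<notin> p" "\<And>j. j < m \<Longrightarrow> (\<Sum>i<r. c i * a i j) \<in> p"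
proof -
  have "\<exists>c. (\<forall>i\<in>{..<r}. c i \<in> A) \<and> (\<exists>i\<in>{..<r}. c i \<notin> p) \<and> (\<forall>j<m. (\<Sum>i\<in>{..<r}. c i * a i j) \<in> p)"
    by (rule kernel_exists) (use assms in auto)
  then show ?thesis using that by (metis lessThan_iff)
qed

text \<open>Steinitz bound: with more \<open>z\<close> than \<open>y\<close>, the matrix expressing
  the \<open>z i\<close> by the \<open>y j\<close> has a kernel vector modulo \<open>p\<close>, and
  this is a forbidden relation among the \<open>z i\<close>.\<close>

lemma indep_le_spans:
  assumes "spans m y" "\<And>i. i < m \<Longrightarrow> y i \<in> M" "\<And>i. i < r \<Longrightarrow> z i \<in> M" "indep r z"
  shows "r \<le> m"
proof (rule ccontr)
  assume "\<not> r \<le> m"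
  have "\<forall>i. \<exists>c. i < r \<longrightarrow> (\<forall>j<m. c j \<in> A) \<and> z i - (\<Sum>j<m. c j * y j) \<in> Z"
    using assms(1,3) unfolding spans_def by blast
  then obtain a where a: "\<And>i j. i < r \<Longrightarrow> j < m \<Longrightarrow> a i j \<in> A"
    "\<And>i. i < r \<Longrightarrow> z i - (\<Sum>j<m. a i j * y j) \<in> Z"
    by metis
  obtain c where c: "\<And>i. i < r \<Longrightarrow> c i \<in> A" "\<exists>i<r. c i \<notin> p"
    "\<And>j. j < m \<Longrightarrow> (\<Sum>i<r. c i * a i j) \<in> p"
    using kernel_exists_lessThan[of m r a] a \<open>\<not> r \<le> m\<close> by auto
  have "(\<Sum>j<m. (\<Sum>i<r. c i * a i j) * y j) + (\<Sum>i<r. c i * (z i - (\<Sum>j<m. a i j * y j))) \<in> Z"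
  proof (rule submod_add[OF Z])
    show "(\<Sum>j<m. (\<Sum>i<r. c i * a i j) * y j) \<in> Z"
      by (rule submod_sum[OF Z]) (use c(3) assms(2) in \<open>auto intro: pM\<close>)
    show "(\<Sum>i<r. c i * (z i - (\<Sum>j<m. a i j * y j))) \<in> Z"
      by (rule submod_lincomb[OF Z]) (use c(1) a(2) in auto)
  qed
  also have "(\<Sum>j<m. (\<Sum>i<r. c i * a i j) * y j) = (\<Sum>i<r. c i * (\<Sum>j<m. a i j * y j))"
    by (simp add: sum_distrib_right sum_distrib_left mult.assoc sum.swap[of _ "{..<m}"])
  finally have "(\<Sum>i<r. c i * z i) \<in> Z"
    by (simp add: sum_subtractf algebra_simps)
  then have "\<forall>i<r. c i \<in> p" using assms(4) c(1) unfolding indep_def by simp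
  then show False using c(2) by blast
qed

text \<open>Appending the unit vector \<open>i\<close> as an extra row to \<open>G\<close> gives
  \<open>d + 1\<close> rows in \<open>d\<close> columns, hence a relation. Its coefficient at the
  extra row is a unit modulo \<open>p\<close>, since otherwise \<open>G\<close> itself would have a
  kernel. Dividing by it yields row \<open>i\<close> of the left inverse.\<close>

lemma inverse_matrix:
  fixes d :: nat
  assumes G: "\<And>i j. i < d \<Longrightarrow> j < d \<Longrightarrow> G i j \<in> A"
    and ker: "\<And>c. (\<And>i. i < d \<Longrightarrow> c i \<in> A) \<Longrightarrow> (\<And>j. j < d \<Longrightarrow> (\<Sum>i<d. c i * G i j) \<in> p) \<Longrightarrow> (\<forall>i<d. c i \<in> p)"
  shows "\<exists>N. (\<forall>i<d. \<forall>j<d. N i j \<in> A) \<and>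
     (\<forall>i<d. \<forall>j<d. (\<Sum>k<d. N i k * G k j) - (if i = j then 1 else 0) \<in> p)"
proof -
  have "\<exists>n. (\<forall>k<d. n k \<in> A) \<and> (\<forall>j<d. (\<Sum>k<d. n k * G k j) - (if i = j then 1 else 0) \<in> p)" 
    if i: "i < d" for i
  proof -
    define a where "a k j = (if k < d then G k j else if i = j then 1 else 0)" for k j
    have aA: "a k j \<in> A" if "j < d" for k j
      using that G A by (auto simp: a_def subring_set_0 subring_set_1)
    obtain c where c: "\<And>k. k < Suc d \<Longrightarrow> c k \<in> A" "\<exists>k<Suc d. c k \<notin> p"
      "\<And>j. j < d \<Longrightarrow> (\<Sum>k<Suc d. c k * a k j) \<in> p"
      using kernel_exists_lessThan[of d "Suc d" a] aA by auto
    have ceq: "(\<Sum>k<Suc d. c k * a k j) = (\<Sum>k<d. c k * G k j) + c d * (if i = j then 1 else 0)" for j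
      by (simp add: a_def)
    have cd: "c d \<notin> p"
    proof
      assume cdp: "c d \<in> p"
      have "(\<Sum>k<d. c k * G k j) \<in> p" if "j < d" for j
      proof -
        have "(\<Sum>k<Suc d. c k * a k j) - c d * (if i = j then 1 else 0) \<in> p"
          using cdp A by (intro submod_diff[OF A p_sub c(3)[OF that]] submod_smult_right[OF p_sub])
            (auto simp: subring_set_0 subring_set_1)
        then show ?thesis using ceq by simp
      qed
      then have "\<forall>k<d. c k \<in> p" using ker[of c] c(1) by auto
      then show False using cdp c(2) by (auto simp: less_Suc_eq)
    qed
    then obtain e where e: "e \<in> A" "c d * e - 1 \<in> p" using inv_mod[of "c d"] c(1)[of d] by auto
    show ?thesis
    proof (intro exI[of _ "\<lambda>k. - e * c k"] conjI allI impI)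
      fix k assume "k < d" then show "- e * c k \<in> A"
        using e c(1) A by (auto intro!: subring_set_mult[OF A] subring_set_uminus[OF A])
    next
      fix j assume "j < d"
      have "(c d * e - 1) * (if i = j then 1 else 0) - e * (\<Sum>k<Suc d. c k * a k j) \<in> p"
        using A
        by (intro submod_diff[OF A p_sub submod_smult_right[OF p_sub _ e(2)]
              submod_smult[OF p_sub e(1) c(3)[OF \<open>j < d\<close>]]])
            (auto simp: subring_set_0 subring_set_1)
      also have "(c d * e - 1) * (if i = j then 1 else 0) - e * (\<Sum>k<Suc d. c k * a k j)
         = (\<Sum>k<d. - e * c k * G k j) - (if i = j then 1 else 0)"
        unfolding ceq by (simp add: sum_distrib_left algebra_simps sum_negf)
      finally show "(\<Sum>k<d. - e * c k * G k j) - (if i = j then 1 else 0) \<in> p" .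
    qed
  qed
  then show ?thesis by metis
qed

lemma extend_to_basis:
  assumes "\<And>i. i < r \<Longrightarrow> y i \<in> M" "indep r y"
    and bound: "\<And>m z. (\<forall>i<m. z i \<in> M) \<Longrightarrow> indep m z \<Longrightarrow> m \<le> D"
  shows "\<exists>z m. r \<le> m \<and> (\<forall>i<r. z i = y i) \<and> residue_basis A M p Z z m"
proof -
  define Q where "Q m \<longleftrightarrow> r \<le> m \<and> (\<exists>z. (\<forall>i<r. z i = y i) \<and> (\<forall>i<m. z i \<in> M) \<and> indep m z)" for m
  have "Q r" using assms unfolding Q_def by blast
  moreover have "\<forall>m. Q m \<longrightarrow> m \<le> D" using bound unfolding Q_def by blast
  ultimately have "Q (Greatest Q)" "\<And>m'. Q m' \<Longrightarrow> m' \<le> Greatest Q"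
    using GreatestI_nat[of Q r D] Greatest_le_nat[of Q _ D] by simp_all
  then obtain m where m: "Q m" "\<And>m'. Q m' \<Longrightarrow> m' \<le> m" by blast
  then obtain z where z: "r \<le> m" "\<forall>i<r. z i = y i" "\<forall>i<m. z i \<in> M" "indep m z"
    unfolding Q_def by blast
  have "spans m z"
    unfolding spans_def
  proof (rule ccontr, simp only: not_all Set.ball_simps, elim bexE)
    fix x assume x: "x \<in> M" and nx: "\<nexists>c. (\<forall>i<m. c i \<in> A) \<and> x - (\<Sum>i<m. c i * z i) \<in> Z"
    define z' where "z' = z(m := x)"
    have "indep (Suc m) z'"
      unfolding indep_def
    proof (intro allI impI, elim conjE)
      fix c i assume c: "\<forall>i<Suc m. c i \<in> A" and s: "(\<Sum>i<Suc m. c i * z' i) \<in> Z" and i: "i < Suc m"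
      have eq: "(\<Sum>i<Suc m. c i * z' i) = (\<Sum>i<m. c i * z i) + c m * x"
        by (simp add: z'_def)
      have "c m \<in> p"
      proof (rule ccontr)
        assume "c m \<notin> p"
        then obtain e where e: "e \<in> A" "c m * e - 1 \<in> p" using inv_mod[of "c m"] c by auto
        have "e * (\<Sum>i<Suc m. c i * z' i) - (c m * e - 1) * x \<in> Z"
          by (rule submod_diff[OF A Z submod_smult[OF Z e(1) s] pM[OF e(2) x]])
        also have "e * (\<Sum>i<Suc m. c i * z' i) - (c m * e - 1) * x = x - (\<Sum>i<m. (- e * c i) * z i)"
          unfolding eq by (simp add: algebra_simps sum_distrib_left sum_negf)
        finally have "x - (\<Sum>i<m. (- e * c i) * z i) \<in> Z" .
        moreover have "\<forall>i<m. - e * c i \<in> A"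
          using e c by (auto intro!: subring_set_mult[OF A] subring_set_uminus[OF A])
        ultimately show False using nx[THEN notE, OF exI, of "\<lambda>i. - e * c i"] by simp
      qed
      moreover from this have "(\<Sum>i<Suc m. c i * z' i) - c m * x \<in> Z"
        by (rule submod_diff[OF A Z s pM[OF _ x]])
      then have "(\<Sum>i<m. c i * z i) \<in> Z" using eq by simp
      then have "\<forall>i<m. c i \<in> p" using z(4) c unfolding indep_def by auto
      ultimately show "c i \<in> p" using i by (auto simp: less_Suc_eq)
    qed
    then have "Q (Suc m)"
      using z x unfolding Q_def by (intro conjI exI[of _ z']) (auto simp: z'_def less_Suc_eq)
    then show False using m(2) by fastforce
  qed
  then show ?thesis using z unfolding residue_basis_iff by blast
qed

lemma basis_size_unique:
  assumes "residue_basis A M p Z y m" "residue_basis A M p Z z n"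
  shows "m = n"
proof (rule antisym)
  show "m \<le> n"
    by (rule indep_le_spans[of n z m y]) (use assms in \<open>auto simp: residue_basis_iff\<close>)
  show "n \<le> m"
    by (rule indep_le_spans[of m y n z]) (use assms in \<open>auto simp: residue_basis_iff\<close>)
qed

lemma indep_card_basis:
  assumes b: "residue_basis A M p Z b d" and "\<And>i. i < d \<Longrightarrow> y i \<in> M" "indep d y"
  shows "residue_basis A M p Z y d"
proof -
  obtain z m where z: "d \<le> m" "\<forall>i<d. z i = y i" "residue_basis A M p Z z m"
  proof -
    have bound: "m \<le> d" if "\<forall>i<m. z i \<in> M" "indep m z" for m z
      by (rule indep_le_spans[of d b m z]) (use that b in \<open>auto simp: residue_basis_iff\<close>)
    have "\<exists>z m. d \<le> m \<and> (\<forall>i<d. z i = y i) \<and> residue_basis A M p Z z m"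
      by (rule extend_to_basis[where D = d]) (use assms(2,3) bound in auto)
    then show ?thesis by (elim exE conjE) (rule that)
  qed
  have "m = d" using basis_size_unique[OF z(3) b] .
  then show ?thesis using z unfolding residue_basis_def by auto
qed

text \<open>A relation \<open>c\<close> among the \<open>y i\<close> is appended as row
  \<open>d\<close> to the matrix of the basis \<open>b\<close> in terms of \<open>y\<close>. The
  \<open>d + 1\<close> rows are dependent via some \<open>e\<close>; since row \<open>d\<close>
  represents zero, \<open>e\<close> gives a relation among the \<open>b i\<close> alone, so
  \<open>e d\<close> is the unit, and column \<open>k\<close> of the dependency then puts
  \<open>c k\<close> into \<open>p\<close>.\<close>

lemma spans_card_basis:
  assumes b: "residue_basis A M p Z b d" and y: "\<And>i. i < d \<Longrightarrow> y i \<in> M" "spans d y"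
  shows "residue_basis A M p Z y d"
proof -
  have "\<forall>i<d. b i \<in> M" using b by (simp add: residue_basis_def)
  then have "\<forall>i. \<exists>c. i < d \<longrightarrow> (\<forall>j<d. c j \<in> A) \<and> b i - (\<Sum>j<d. c j * y j) \<in> Z"
    using y(2) unfolding spans_def by blast
  then obtain a where a: "\<And>i j. i < d \<Longrightarrow> j < d \<Longrightarrow> a i j \<in> A"
    "\<And>i. i < d \<Longrightarrow> b i - (\<Sum>j<d. a i j * y j) \<in> Z"
    by metis
  have "indep d y"
    unfolding indep_def
  proof (intro allI impI, elim conjE)
    fix c k assume c: "\<forall>i<d. c i \<in> A" and s: "(\<Sum>i<d. c i * y i) \<in> Z" and k: "k < d"
    define a' where "a' i j = (if i < d then a i j else c j)" for i j
    obtain e where e: "\<And>i. i < Suc d \<Longrightarrow> e i \<in> A" "\<exists>i<Suc d. e i \<notin> p"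
      "\<And>j. j < d \<Longrightarrow> (\<Sum>i<Suc d. e i * a' i j) \<in> p"
    proof (rule kernel_exists_lessThan[of d "Suc d" a'])
      show "a' i j \<in> A" if "i < Suc d" "j < d" for i j
        using that a c by (simp add: a'_def)
    qed auto
    have eq: "(\<Sum>i<Suc d. e i * a' i j) = (\<Sum>i<d. e i * a i j) + e d * c j" for j
      by (simp add: a'_def)
    have "(\<Sum>j<d. (\<Sum>i<Suc d. e i * a' i j) * y j) - e d * (\<Sum>i<d. c i * y i)
        + (\<Sum>i<d. e i * (b i - (\<Sum>j<d. a i j * y j))) \<in> Z"
    proof (rule submod_add[OF Z submod_diff[OF A Z _ submod_smult[OF Z _ s]]])
      show "(\<Sum>j<d. (\<Sum>i<Suc d. e i * a' i j) * y j) \<in> Z"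
        by (rule submod_sum[OF Z]) (use e(3) y(1) in \<open>auto intro: pM\<close>)
      show "e d \<in> A" using e(1) by simp
      show "(\<Sum>i<d. e i * (b i - (\<Sum>j<d. a i j * y j))) \<in> Z"
        by (rule submod_lincomb[OF Z]) (use e(1) a(2) in auto)
    qed
    also have "(\<Sum>j<d. (\<Sum>i<Suc d. e i * a' i j) * y j) - e d * (\<Sum>i<d. c i * y i)
        + (\<Sum>i<d. e i * (b i - (\<Sum>j<d. a i j * y j))) = (\<Sum>i<d. e i * b i)"
    proof -
      have "(\<Sum>j<d. (\<Sum>i<Suc d. e i * a' i j) * y j)
        = (\<Sum>j<d. (\<Sum>i<d. e i * a i j) * y j) + e d * (\<Sum>j<d. c j * y j)"
        unfolding eq by (simp add: algebra_simps sum.distrib sum_distrib_left)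
      also have "(\<Sum>j<d. (\<Sum>i<d. e i * a i j) * y j) = (\<Sum>i<d. e i * (\<Sum>j<d. a i j * y j))"
        by (simp add: sum_distrib_right sum_distrib_left mult.assoc) (rule sum.swap)
      finally show ?thesis by (simp add: algebra_simps sum_subtractf)
    qed
    finally have "\<forall>i<d. e i \<in> p" using b e unfolding residue_basis_iff indep_def by auto
    then have "e d \<notin> p" using e(2) by (auto simp: less_Suc_eq)
    have "(\<Sum>i<Suc d. e i * a' i k) - (\<Sum>i<d. e i * a i k) \<in> p"
    proof (intro submod_diff[OF A p_sub] e(3)[OF k] submod_sum[OF p_sub])
      fix i assume "i \<in> {..<d}" then show "e i * a i k \<in> p"
        using \<open>\<forall>i<d. e i \<in> p\<close> a k by (intro submod_smult_right[OF p_sub]) auto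
    qed
    then have "e d * c k \<in> p" unfolding eq by simp
    then show "c k \<in> p" using p_prime[of "e d" "c k"] \<open>e d \<notin> p\<close> e(1)[of d] c k by auto
  qed
  then show ?thesis using y unfolding residue_basis_iff by auto
qed

end

section \<open>Non-vanishing of the trace\<close>

lemma submod_trans: "submod A S \<Longrightarrow> x - y \<in> S \<Longrightarrow> y - z \<in> S \<Longrightarrow> x - z \<in> S"
  using submod_add[of A S "x - y" "y - z"] by simp

lemma submod_diff_sum:
  "submod A S \<Longrightarrow> (\<And>i. i \<in> I \<Longrightarrow> f i - g i \<in> S) \<Longrightarrow> sum f I - sum g I \<in> S"
  by (simp add: sum_subtractf[symmetric] submod_sum)

lemma submod_mem_cong: "subring_set A \<Longrightarrow> submod A S \<Longrightarrow> x - y \<in> S \<Longrightarrow> x \<in> S \<Longrightarrow> y \<in> S"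
  using submod_diff[of A S x "x - y"] by simp

lemma submod_mem_cong': "submod A S \<Longrightarrow> x - y \<in> S \<Longrightarrow> y \<in> S \<Longrightarrow> x \<in> S"
  using submod_add[of A S "x - y" y] by simp

text \<open>Up to the application of \<open>\<lambda>\<close> to the second tensor factor, \<open>power_sum\<close> is
  \<open>(u \<otimes> w) (\<Sum>i<n. b i \<otimes> b' i)\<^sup>m\<close>, written without a tensor product.\<close>

primrec power_sum :: "('a::field \<Rightarrow> 'a) \<Rightarrow> (nat \<Rightarrow> 'a) \<Rightarrow> (nat \<Rightarrow> 'a) \<Rightarrow> nat \<Rightarrow> nat \<Rightarrow> 'a \<Rightarrow> 'a \<Rightarrow> 'a" where
  "power_sum lam b b' 0 m u w = (if m = 0 then lam w * u else 0)"
| "power_sum lam b b' (Suc i) m u w =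
     (\<Sum>j\<le>m. of_nat (m choose j) * power_sum lam b b' i (m - j) (u * b i ^ j) (w * b' i ^ j))"

lemma power_sum_0: "power_sum lam b b' n 0 u w = lam w * u"
  by (induction n arbitrary: u w) auto

text \<open>The defining recursion splits off the last summand by the binomial theorem; this one
  splits off one factor of the power. The passage between the two is Pascal's rule.\<close>

lemma power_sum_Suc:
  "power_sum lam b b' n (Suc m) u w = (\<Sum>i<n. power_sum lam b b' n m (u * b i) (w * b' i))"
proof (induction n arbitrary: m u w)
  case 0
  then show ?case by simp
next
  case (Suc n)
  define H where "H j k = power_sum lam b b' n k (u * b n ^ j) (w * b' n ^ j)" for j k
  have "power_sum lam b b' (Suc n) (Suc m) u w = (\<Sum>j\<le>Suc m. of_nat (Suc m choose j) * H j (Suc m - j))"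
    by (simp add: H_def)
  also have "\<dots> = H 0 (Suc m) + (\<Sum>j\<le>m. of_nat (Suc m choose Suc j) * H (Suc j) (m - j))"
    by (subst sum.atMost_Suc_shift) simp
  also have "(\<Sum>j\<le>m. of_nat (Suc m choose Suc j) * H (Suc j) (m - j)) =
     (\<Sum>j\<le>m. of_nat (m choose j) * H (Suc j) (m - j)) + (\<Sum>j\<le>m. of_nat (m choose Suc j) * H (Suc j) (m - j))"
    by (simp add: algebra_simps sum.distrib)
  also have "H 0 (Suc m) + (\<dots>) = (\<Sum>j\<le>m. of_nat (m choose j) * H (Suc j) (m - j))
      + (\<Sum>j\<le>Suc m. of_nat (m choose j) * H j (Suc m - j))"
    by (subst sum.atMost_Suc_shift) simp
  also have "(\<Sum>j\<le>m. of_nat (m choose j) * H (Suc j) (m - j)) = power_sum lam b b' (Suc n) m (u * b n) (w * b' n)"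
    by (simp add: H_def algebra_simps)
  also have "(\<Sum>j\<le>Suc m. of_nat (m choose j) * H j (Suc m - j)) = (\<Sum>j\<le>m. of_nat (m choose j) * H j (Suc (m - j)))"
    by (simp add: Suc_diff_le binomial_eq_0)
  also have "\<dots> = (\<Sum>i<n. power_sum lam b b' (Suc n) m (u * b i) (w * b' i))"
    unfolding H_def Suc.IH power_sum.simps sum_distrib_left
    by (subst sum.swap) (simp add: algebra_simps)
  finally show ?case by simp
qed

text \<open>The quotient \<open>M / Z\<close> is a field whose unit need not be the class of 1: in
  one application \<open>M\<close> is a minimal ideal of \<open>B\<close> modulo \<open>p B\<close>,
  with an idempotent as unit. Hence \<open>M_divide\<close> solves \<open>x y = w\<close> instead of
  inverting \<open>x\<close>.\<close>

locale linfield = linmod +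
  assumes M_mult: "\<And>x y. x \<in> M \<Longrightarrow> y \<in> M \<Longrightarrow> x * y \<in> M"
    and Z_mult: "\<And>x y. x \<in> Z \<Longrightarrow> y \<in> M \<Longrightarrow> x * y \<in> Z"
    and M_divide: "\<And>x w. x \<in> M \<Longrightarrow> x \<notin> Z \<Longrightarrow> w \<in> M \<Longrightarrow> \<exists>y\<in>M. x * y - w \<in> Z"
    and M_nonzero: "\<not> M \<subseteq> Z"
begin

lemma M_mult_power: "x \<in> M \<Longrightarrow> y \<in> M \<Longrightarrow> x * y ^ n \<in> M"
  by (induction n arbitrary: x) (auto simp: M_mult mult.assoc[symmetric])

lemma Z_mult_power: "x \<in> Z \<Longrightarrow> y \<in> M \<Longrightarrow> x * y ^ n \<in> Z"
  by (induction n arbitrary: x) (auto simp: Z_mult mult.assoc[symmetric])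

lemma annihilated_imp_Z:
  assumes "s \<in> M" "\<And>u. u \<in> M \<Longrightarrow> u * s \<in> Z"
  shows "s \<in> Z"
proof (rule ccontr)
  assume "s \<notin> Z"
  obtain w where w: "w \<in> M" "w \<notin> Z" using M_nonzero by blast
  then obtain y where "y \<in> M" "s * y - w \<in> Z" using M_divide assms \<open>s \<notin> Z\<close> by blast
  then show False using w assms(2)[of y] submod_mem_cong[OF A Z, of "s * y" w] by (simp add: mult.commute)
qed

text \<open>The multiplier \<open>w\<close> makes up for the missing unit: \<open>x ^ 0\<close> need
  not lie in \<open>M\<close>, while for \<open>n = 0\<close> the premise now reads
  \<open>M \<subseteq> Z\<close>, which is excluded.\<close>

lemma nilpotent_imp_Z:
  assumes "x \<in> M" "\<And>w. w \<in> M \<Longrightarrow> w * x ^ n \<in> Z"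
  shows "x \<in> Z"
  using assms(2)
proof (induction n)
  case 0
  then show ?case using M_nonzero by auto
next
  case (Suc n)
  show ?case
  proof (rule ccontr)
    assume x: "x \<notin> Z"
    have "w * x ^ n \<in> Z" if w: "w \<in> M" for w
    proof -
      obtain y where y: "y \<in> M" "x * y - w \<in> Z" using M_divide[OF assms(1) x w] by blast
      have "y * x ^ Suc n - (x * y - w) * x ^ n \<in> Z"
        using Suc.prems[OF y(1)] y Z_mult_power[OF y(2) assms(1)] by (intro submod_diff[OF A Z])
      then show ?thesis by (simp add: algebra_simps)
    qed
    then show False using Suc.IH x by blast
  qed
qed

context
  fixes lam :: "'a \<Rightarrow> 'a" and b b' :: "nat \<Rightarrow> 'a" and f :: nat
  assumes lam: "\<And>w. w \<in> M \<Longrightarrow> lam w \<in> A"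
    and b: "\<And>i. i < f \<Longrightarrow> b i \<in> M" and b': "\<And>i. i < f \<Longrightarrow> b' i \<in> M"
begin

lemma power_sum_closed: "n \<le> f \<Longrightarrow> u \<in> M \<Longrightarrow> w \<in> M \<Longrightarrow> power_sum lam b b' n m u w \<in> M"
proof (induction n arbitrary: m u w)
  case 0
  then show ?case by (auto intro: submod_smult[OF M] submod_0[OF M] lam)
next
  case (Suc n)
  then show ?case
    by (auto intro!: submod_lincomb[OF M] subring_set_of_nat[OF A] Suc.IH M_mult_power b b')
qed

text \<open>Freshman's dream for the sum of the \<open>b i \<otimes> b' i\<close>: modulo
  \<open>Z\<close> only the pure powers survive, as all inner binomial coefficients are multiples of
  \<open>l\<close>.\<close>

lemma power_sum_prime:
  assumes l: "prime l" "of_nat l \<in> p" and uw: "u \<in> M" "w \<in> M" and "n \<le> f"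
  shows "power_sum lam b b' n l u w - (\<Sum>i<n. lam (w * b' i ^ l) * (u * b i ^ l)) \<in> Z"
  using \<open>n \<le> f\<close>
proof (induction n)
  case 0
  then show ?case using prime_gt_0_nat[OF l(1)] by (simp add: submod_0[OF Z])
next
  case (Suc n)
  have l0: "0 < l" using prime_gt_0_nat[OF l(1)] .
  define H where "H j = of_nat (l choose j) * power_sum lam b b' n (l - j) (u * b n ^ j) (w * b' n ^ j)" for j
  have set: "{..l} = insert 0 (insert l {0<..<l})" by auto
  have "power_sum lam b b' (Suc n) l u w = (\<Sum>j\<le>l. H j)" by (simp add: H_def)
  also have "\<dots> = H 0 + (H l + (\<Sum>j\<in>{0<..<l}. H j))" unfolding set using l0 by simp
  also have "H 0 = power_sum lam b b' n l u w" by (simp add: H_def)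
  also have "H l = lam (w * b' n ^ l) * (u * b n ^ l)" by (simp add: H_def power_sum_0)
  finally have eq: "power_sum lam b b' (Suc n) l u w =
    power_sum lam b b' n l u w + (lam (w * b' n ^ l) * (u * b n ^ l) + (\<Sum>j\<in>{0<..<l}. H j))" .
  have "(\<Sum>j\<in>{0<..<l}. H j) \<in> Z"
  proof (rule submod_sum[OF Z])
    fix j assume j: "j \<in> {0<..<l}"
    then have "l dvd (l choose j)" using l by (intro dvd_choose_prime) auto
    then obtain k where k: "l choose j = l * k" by auto
    have "of_nat (l choose j) \<in> p"
      unfolding k using l(2) by (auto intro: submod_smult_right[OF p_sub] subring_set_of_nat[OF A])
    then show "H j \<in> Z"
      unfolding H_def using uw Suc.prems by (intro pM power_sum_closed M_mult_power b b') auto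
  qed
  then have "(power_sum lam b b' n l u w - (\<Sum>i<n. lam (w * b' i ^ l) * (u * b i ^ l))) + (\<Sum>j\<in>{0<..<l}. H j) \<in> Z"
    using Suc by (intro submod_add[OF Z]) auto
  then show ?case unfolding eq by (simp add: algebra_simps)
qed

text \<open>For \<open>m = 0\<close> this is the expansion of \<open>w\<close> in the dual bases.
  Every further factor replaces \<open>u w\<close> by the sum of the
  \<open>(u * b i) * (w * b' i)\<close>, that is, multiplies it by the sum of the
  \<open>b i * b' i\<close>.\<close>

lemma power_sum_dual:
  assumes dual: "\<And>w. w \<in> M \<Longrightarrow> (\<Sum>i<f. lam (w * b' i) * b i) - w \<in> Z"
    and "u \<in> M" "w \<in> M"
  shows "power_sum lam b b' f (Suc m) u w - u * w * (\<Sum>i<f. b i * b' i) ^ m \<in> Z"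
  using assms(2,3)
proof (induction m arbitrary: u w)
  case 0
  have "((\<Sum>i<f. lam (w * b' i) * b i) - w) * u \<in> Z"
    using dual 0 by (intro Z_mult) auto
  then show ?case
    by (simp add: power_sum_Suc power_sum_0 algebra_simps sum_distrib_left sum_distrib_right)
next
  case (Suc m)
  have "power_sum lam b b' f (Suc (Suc m)) u w - (\<Sum>i<f. (u * b i) * (w * b' i) * (\<Sum>i<f. b i * b' i) ^ m) \<in> Z"
    unfolding power_sum_Suc[of _ _ _ _ "Suc m"] using Suc b b'
    by (intro submod_diff_sum[OF Z] Suc.IH M_mult) auto
  also have "(\<Sum>i<f. (u * b i) * (w * b' i) * (\<Sum>i<f. b i * b' i) ^ m)
     = u * w * (\<Sum>i<f. b i * b' i) ^ Suc m"
    by (simp add: sum_distrib_left sum_distrib_right algebra_simps)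
  finally show ?case .
qed

end

text \<open>For a linear form \<open>\<lambda>\<close> with dual bases \<open>b, b'\<close> the trace is \<open>x \<mapsto> \<lambda>(c x)\<close> with
  \<open>c = \<Sum>i. b i * b' i\<close>. The element \<open>e = \<Sum>i. b i \<otimes> b' i\<close> satisfies \<open>e\<^sup>2 = (c \<otimes> 1) e\<close>, so that
  \<open>c = 0\<close> would force \<open>0 = e ^ l = \<Sum>i. b i ^ l \<otimes> b' i ^ l\<close>, against the independence of
  the \<open>b i ^ l\<close>.\<close>

lemma trace_nonzero:
  assumes bas: "residue_basis A M p Z b f" and f: "0 < f" and l: "prime l" "of_nat l \<in> p"
    and indl: "indep f (\<lambda>i. b i ^ l)"
  shows "\<exists>x\<in>M. \<forall>m. (\<forall>i<f. \<forall>j<f. m i j \<in> A) \<and> (\<forall>i<f. x * b i - (\<Sum>j<f. m i j * b j) \<in> Z)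
     \<longrightarrow> (\<Sum>i<f. m i i) \<notin> p"
proof -
  have bM: "b i \<in> M" if "i < f" for i using bas that unfolding residue_basis_iff by blast
  have sp: "spans f b" and ind: "indep f b" using bas unfolding residue_basis_iff by blast+
  have "\<forall>w. \<exists>c. w \<in> M \<longrightarrow> (\<forall>i<f. c i \<in> A) \<and> w - (\<Sum>i<f. c i * b i) \<in> Z"
    using sp unfolding spans_def by blast
  then obtain kap where kap: "\<And>w i. w \<in> M \<Longrightarrow> i < f \<Longrightarrow> kap w i \<in> A"
    "\<And>w. w \<in> M \<Longrightarrow> w - (\<Sum>i<f. kap w i * b i) \<in> Z" by metis
  \<comment> \<open>The coordinate at \<open>b 0\<close> serves as the linear form, normalized by
    \<open>lam (b 0) = 1\<close> modulo \<open>p\<close>. Since \<open>kap\<close> merely chooses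
    coordinates, \<open>lam\<close> is linear and well defined only modulo \<open>p\<close>.\<close>
  define lam where "lam w = kap w 0" for w
  have lamA: "lam w \<in> A" if "w \<in> M" for w using kap that f by (auto simp: lam_def)
  have lam_lin: "lam x - (\<Sum>j<n. a j * lam (y j)) \<in> p"
    if x: "x \<in> M" and y: "\<And>j. j < n \<Longrightarrow> y j \<in> M" and a: "\<And>j. j < n \<Longrightarrow> a j \<in> A"
      and xy: "x - (\<Sum>j<n. a j * y j) \<in> Z" for x y a and n :: nat
  proof -
    have 1: "(\<Sum>j<n. a j * (y j - (\<Sum>i<f. kap (y j) i * b i))) \<in> Z"
      using kap y a by (intro submod_lincomb[OF Z]) auto
    have 2: "(\<Sum>j<n. a j * (y j - (\<Sum>i<f. kap (y j) i * b i))) =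
       (\<Sum>j<n. a j * y j) - (\<Sum>i<f. (\<Sum>j<n. a j * kap (y j) i) * b i)"
      by (simp add: algebra_simps sum_subtractf sum_distrib_left sum_distrib_right) (rule sum.swap)
    have "kap x 0 - (\<Sum>j<n. a j * kap (y j) 0) \<in> p"
      by (rule indep_coords_unique[OF ind _ _ kap(2)[OF x] 1[unfolded 2] xy f])
        (use kap x y a in \<open>auto intro!: subring_set_sum[OF A] subring_set_mult[OF A]\<close>)
    then show ?thesis by (simp add: lam_def)
  qed
  have lam_b0: "lam (b 0) - 1 \<in> p"
  proof -
    have s: "(\<Sum>i<f. (if i = 0 then 1 else 0) * b i) = b 0"
      using f by (subst sum.mono_neutral_right[of _ "{0}"]) auto
    have "kap (b 0) 0 - (if (0::nat) = 0 then 1 else 0) \<in> p"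
      by (rule indep_coords_unique[OF ind, where c = "kap (b 0)" and c' = "\<lambda>i. if i = 0 then 1 else 0" and x = "b 0" and x' = "b 0"])
        (use kap bM f s A in \<open>auto simp: submod_0[OF Z] subring_set_0 subring_set_1\<close>)
    then show ?thesis by (simp add: lam_def)
  qed
  have lam_Z: "lam z \<in> p" if "z \<in> Z" for z
    using lam_lin[of z 0 "\<lambda>_. 0" "\<lambda>_. 0"] that ZM by auto
  have lam_cong: "lam x - lam y \<in> p" if "x \<in> M" "y \<in> M" "x - y \<in> Z" for x y
    using lam_lin[of x 1 "\<lambda>_. y" "\<lambda>_. 1"] that subring_set_1[OF A] by auto
  define G where "G i j = lam (b i * b j)" for i j
  have GA: "G i j \<in> A" if "i < f" "j < f" for i j
    unfolding G_def using that bM M_mult by (intro lamA) auto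
  \<comment> \<open>The form \<open>lam (x * y)\<close> is nondegenerate: if \<open>x\<close>
    outside \<open>Z\<close> were orthogonal to all \<open>b j\<close>, dividing \<open>b 0\<close>
    by \<open>x\<close> would give \<open>lam (b 0) = 0\<close>.\<close>
  have ker: "\<forall>i<f. c i \<in> p" if c: "\<And>i. i < f \<Longrightarrow> c i \<in> A" and cG: "\<And>j. j < f \<Longrightarrow> (\<Sum>i<f. c i * G i j) \<in> p" for c
  proof -
    define x where "x = (\<Sum>i<f. c i * b i)"
    have xM: "x \<in> M" unfolding x_def using c bM by (intro submod_lincomb[OF M]) auto
    have "x \<in> Z"
    proof (rule ccontr)
      assume "x \<notin> Z"
      then obtain y where y: "y \<in> M" "x * y - b 0 \<in> Z" using M_divide[OF xM] bM[OF f] by blast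
      obtain e where e: "\<And>i. i < f \<Longrightarrow> e i \<in> A" "y - (\<Sum>i<f. e i * b i) \<in> Z" using spansE[OF sp y(1)] by blast
      have xb: "lam (x * b j) \<in> p" if "j < f" for j
      proof -
        have "lam (x * b j) - (\<Sum>i<f. c i * lam (b i * b j)) \<in> p"
        proof (rule lam_lin)
          show "x * b j \<in> M" using xM bM that M_mult by blast
          have "x * b j = (\<Sum>i<f. c i * (b i * b j))" by (simp add: x_def sum_distrib_right mult.assoc)
          then show "x * b j - (\<Sum>i<f. c i * (b i * b j)) \<in> Z" by (simp add: submod_0[OF Z])
        qed (use bM M_mult c that in auto)
        then show ?thesis using cG[OF that] submod_mem_cong'[OF p_sub] unfolding G_def by blast
      qed
      have "(y - (\<Sum>i<f. e i * b i)) * x \<in> Z" using e xM by (intro Z_mult) auto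
      then have "x * y - (\<Sum>i<f. e i * (x * b i)) \<in> Z"
        by (simp add: algebra_simps sum_distrib_left)
      then have "lam (x * y) - (\<Sum>i<f. e i * lam (x * b i)) \<in> p"
        using xM y e bM by (intro lam_lin M_mult) auto
      moreover have "(\<Sum>i<f. e i * lam (x * b i)) \<in> p"
        using xb e by (intro submod_lincomb[OF p_sub]) auto
      ultimately have 1: "lam (x * y) \<in> p" using submod_mem_cong'[OF p_sub] by blast
      have "lam (x * y) - lam (b 0) \<in> p"
        using xM y bM f by (intro lam_cong M_mult) auto
      then have "lam (b 0) \<in> p" using submod_mem_cong[OF A p_sub] 1 by blast
      then have "1 \<in> p" using submod_mem_cong[OF A p_sub lam_b0] by blast
      then show False using one_notin by blast
    qed
    then show ?thesis using indepD[OF ind, of c] c by (simp add: x_def)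
  qed
  obtain N where N: "\<And>i j. i < f \<Longrightarrow> j < f \<Longrightarrow> N i j \<in> A"
    "\<And>i j. i < f \<Longrightarrow> j < f \<Longrightarrow> (\<Sum>k<f. N i k * G k j) - (if i = j then 1 else 0) \<in> p"
  proof -
    have "\<exists>N. (\<forall>i<f. \<forall>j<f. N i j \<in> A) \<and>
       (\<forall>i<f. \<forall>j<f. (\<Sum>k<f. N i k * G k j) - (if i = j then 1 else 0) \<in> p)"
      by (rule inverse_matrix) (use GA ker in auto)
    then obtain N where "\<forall>i<f. \<forall>j<f. N i j \<in> A"
        "\<forall>i<f. \<forall>j<f. (\<Sum>k<f. N i k * G k j) - (if i = j then 1 else 0) \<in> p"
      by (elim exE conjE)
    then show ?thesis using that[of N] by simp
  qed
  define b' where "b' i = (\<Sum>k<f. N i k * b k)" for i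
  have b'M: "b' i \<in> M" if "i < f" for i unfolding b'_def using N that bM by (intro submod_lincomb[OF M]) auto
  have dual: "lam (b j * b' i) - (if i = j then 1 else 0) \<in> p" if "i < f" "j < f" for i j
  proof -
    have "lam (b j * b' i) - (\<Sum>k<f. N i k * lam (b k * b j)) \<in> p"
    proof (rule lam_lin)
      show "b j * b' i \<in> M" using that bM b'M M_mult by blast
      have "b j * b' i = (\<Sum>k<f. N i k * (b k * b j))" by (simp add: b'_def sum_distrib_left algebra_simps)
      then show "b j * b' i - (\<Sum>k<f. N i k * (b k * b j)) \<in> Z" by (simp add: submod_0[OF Z])
    qed (use that bM M_mult N in auto)
    then show ?thesis using submod_trans[OF p_sub] N(2)[OF that] unfolding G_def by blast
  qed
  have pick: "lam x - a i \<in> p" if i: "i < f" and xM: "x \<in> M" and a: "\<And>j. j < f \<Longrightarrow> a j \<in> A"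
      and x: "x - (\<Sum>j<f. a j * (b j * b' i)) \<in> Z" for i x a
  proof -
    have "lam x - (\<Sum>j<f. a j * lam (b j * b' i)) \<in> p"
      using x xM a i bM b'M by (intro lam_lin M_mult) auto
    moreover have "(\<Sum>j<f. a j * lam (b j * b' i)) - (\<Sum>j<f. a j * (if i = j then 1 else 0)) \<in> p"
    proof (rule submod_diff_sum[OF p_sub])
      fix j assume "j \<in> {..<f}"
      then have "a j * (lam (b j * b' i) - (if i = j then 1 else 0)) \<in> p"
        using a dual[OF i] by (intro submod_smult[OF p_sub]) auto
      then show "a j * lam (b j * b' i) - a j * (if i = j then 1 else 0) \<in> p"
        by (simp add: algebra_simps)
    qed
    moreover have "(\<Sum>j<f. a j * (if i = j then 1 else 0)) = a i"
      using i by (simp add: if_distrib cong: if_cong)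
    ultimately show ?thesis using submod_trans[OF p_sub] by auto
  qed
  have H1: "(\<Sum>i<f. lam (w * b' i) * b i) - w \<in> Z" if w: "w \<in> M" for w
  proof -
    obtain e where e: "\<And>i. i < f \<Longrightarrow> e i \<in> A" "w - (\<Sum>i<f. e i * b i) \<in> Z" using spansE[OF sp w] by blast
    have "lam (w * b' i) - e i \<in> p" if i: "i < f" for i
    proof (rule pick[OF i, where a = e])
      have "(w - (\<Sum>i<f. e i * b i)) * b' i \<in> Z" using e b'M i by (intro Z_mult) auto
      then show "w * b' i - (\<Sum>j<f. e j * (b j * b' i)) \<in> Z"
        by (simp add: algebra_simps sum_distrib_left)
    qed (use e w b'M i M_mult in auto)
    then have "(\<Sum>i<f. (lam (w * b' i) - e i) * b i) \<in> Z"
      using bM by (intro submod_sum[OF Z] pM) auto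
    then have "(\<Sum>i<f. lam (w * b' i) * b i) - (\<Sum>i<f. e i * b i) \<in> Z"
      by (simp add: algebra_simps sum_subtractf)
    then show ?thesis using submod_trans[OF Z] submod_diff_swap[OF A Z] e(2) by blast
  qed
  define c where "c = (\<Sum>i<f. b i * b' i)"
  have cM: "c \<in> M" unfolding c_def using bM b'M by (intro submod_sum[OF M] M_mult) auto
  have b'Ml: "w * b' i ^ l \<in> M" if "w \<in> M" "i < f" for w i using that b'M M_mult_power by auto
  have bl: "b i ^ l \<in> M" if "i < f" for i
    using M_mult_power[OF bM[OF that] bM[OF that], of "l - 1"] prime_gt_0_nat[OF l(1)]
    by (simp add: power_eq_if)
  have "c \<notin> Z"
  proof
    assume cZ: "c \<in> Z"
    have small: "lam (w * b' i ^ l) \<in> p" if w: "w \<in> M" and i: "i < f" for w i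
    proof -
      let ?s = "\<Sum>i<f. lam (w * b' i ^ l) * b i ^ l"
      have sM: "?s \<in> M" using w lamA b'Ml bl by (intro submod_lincomb[OF M]) auto
      have "u * ?s \<in> Z" if u: "u \<in> M" for u
      proof -
        \<comment> \<open>The contraction of the \<open>l\<close>-th power produces
          \<open>c ^ (l - 1)\<close>, and \<open>l \<ge> 2\<close> leaves at least one factor
          \<open>c\<close>, which lies in \<open>Z\<close>.\<close>
        obtain k where k: "l = Suc (Suc k)" using prime_ge_2_nat[OF l(1)] by (metis One_nat_def Suc_1 le_Suc_ex add_Suc)
        have "c * (u * w) * c ^ k \<in> Z" using cZ u w cM M_mult by (intro Z_mult_power Z_mult) auto
        then have "u * w * c ^ Suc k \<in> Z" by (simp add: algebra_simps)
        moreover have "power_sum lam b b' f l u w - u * w * c ^ Suc k \<in> Z"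
          unfolding k c_def using power_sum_dual[OF lamA bM b'M H1 u w, where m = "Suc k"] by simp
        ultimately have "power_sum lam b b' f l u w \<in> Z" using submod_mem_cong'[OF Z] by blast
        moreover have "power_sum lam b b' f l u w - (\<Sum>i<f. lam (w * b' i ^ l) * (u * b i ^ l)) \<in> Z"
          by (rule power_sum_prime[OF lamA bM b'M l u w]) auto
        ultimately have "(\<Sum>i<f. lam (w * b' i ^ l) * (u * b i ^ l)) \<in> Z" using submod_mem_cong[OF A Z] by blast
        then show ?thesis by (simp add: sum_distrib_left algebra_simps)
      qed
      then have "?s \<in> Z" using annihilated_imp_Z[OF sM] by blast
      then show ?thesis using indepD[OF indl, of "\<lambda>i. lam (w * b' i ^ l)"] lamA b'Ml w i by auto
    qed
    \<comment> \<open>Applying \<open>small\<close> with \<open>w * b' j\<close> in place of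
      \<open>w\<close> kills every coordinate of \<open>w * b' 0 ^ l\<close>. So \<open>b' 0\<close>
      is nilpotent and hence zero, although \<open>b 0 * b' 0\<close> has \<open>lam\<close>-value
      1.\<close>
    have "b' 0 \<in> Z"
    proof (rule nilpotent_imp_Z[OF b'M[OF f], of l])
      fix w assume w: "w \<in> M"
      have "(\<Sum>j<f. lam ((w * b' 0 ^ l) * b' j) * b j) - w * b' 0 ^ l \<in> Z"
        using H1[OF b'Ml[OF w f]] .
      moreover have "(\<Sum>j<f. lam ((w * b' 0 ^ l) * b' j) * b j) \<in> Z"
      proof (intro submod_sum[OF Z] pM)
        fix j assume "j \<in> {..<f}"
        then have "lam ((w * b' j) * b' 0 ^ l) \<in> p" using w b'M M_mult f by (intro small) auto
        then show "lam ((w * b' 0 ^ l) * b' j) \<in> p" by (simp add: algebra_simps)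
      qed (use bM in auto)
      ultimately show "w * b' 0 ^ l \<in> Z" using submod_mem_cong[OF A Z] by blast
    qed
    then have "lam (b 0 * b' 0) \<in> p" using lam_Z Z_mult[of "b' 0" "b 0"] bM[OF f] by (simp add: mult.commute)
    moreover have "lam (b 0 * b' 0) - 1 \<in> p" using dual[OF f f] by simp
    ultimately show False using submod_mem_cong[OF A p_sub] one_notin by blast
  qed
  \<comment> \<open>With \<open>c x = b 0\<close> modulo \<open>Z\<close>, the trace of
    \<open>x\<close> becomes \<open>lam (c * x) = lam (b 0) = 1\<close>.\<close>
  then obtain x where x: "x \<in> M" "c * x - b 0 \<in> Z" using M_divide[OF cM] bM[OF f] by blast
  show ?thesis
  proof (rule bexI[OF _ x(1)], intro allI impI, elim conjE)
    fix m assume mA: "\<forall>i<f. \<forall>j<f. m i j \<in> A" and m: "\<forall>i<f. x * b i - (\<Sum>j<f. m i j * b j) \<in> Z"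
    have "lam (c * x) - (\<Sum>i<f. 1 * lam (x * b i * b' i)) \<in> p"
    proof (rule lam_lin[where y = "\<lambda>i. x * b i * b' i" and a = "\<lambda>_. 1"])
      show "c * x \<in> M" using cM x M_mult by blast
      have "c * x = (\<Sum>i<f. 1 * (x * b i * b' i))" by (simp add: c_def sum_distrib_left sum_distrib_right algebra_simps)
      then show "c * x - (\<Sum>i<f. 1 * (x * b i * b' i)) \<in> Z" by (simp add: submod_0[OF Z])
    qed (use x bM b'M M_mult subring_set_1[OF A] in auto)
    moreover have "(\<Sum>i<f. 1 * lam (x * b i * b' i)) - (\<Sum>i<f. m i i) \<in> p"
    proof (rule submod_diff_sum[OF p_sub])
      fix i assume "i \<in> {..<f}" then have i: "i < f" by simp
      have "lam (x * b i * b' i) - m i i \<in> p"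
      proof (rule pick[OF i, where a = "m i"])
        have "(x * b i - (\<Sum>j<f. m i j * b j)) * b' i \<in> Z" using m i b'M by (intro Z_mult) auto
        then show "x * b i * b' i - (\<Sum>j<f. m i j * (b j * b' i)) \<in> Z"
          by (simp add: algebra_simps sum_distrib_left)
      qed (use mA i x bM b'M M_mult in auto)
      then show "1 * lam (x * b i * b' i) - m i i \<in> p" by simp
    qed
    ultimately have "lam (c * x) - (\<Sum>i<f. m i i) \<in> p" using submod_trans[OF p_sub] by blast
    moreover have "lam (c * x) - 1 \<in> p"
      using submod_trans[OF p_sub lam_cong[OF M_mult[OF cM x(1)] bM[OF f] x(2)] lam_b0] .
    ultimately show "(\<Sum>i<f. m i i) \<notin> p"
      using submod_mem_cong'[OF p_sub] submod_mem_cong[OF A p_sub] one_notin by blast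
  qed
qed

end

section \<open>Field extensions and integral elements\<close>

definition subfield_set :: "'a::field set \<Rightarrow> bool" where
  "subfield_set K \<longleftrightarrow> subring_set K \<and> (\<forall>x\<in>K. inverse x \<in> K)"

lemma subfield_set_divide: "subfield_set K \<Longrightarrow> x \<in> K \<Longrightarrow> y \<in> K \<Longrightarrow> x / y \<in> K"
  by (simp add: subfield_set_def divide_inverse subring_set_mult)

lemma field_mod_subfield: "subfield_set K \<Longrightarrow> field_mod K {0}"
  unfolding field_mod_def subfield_set_def
  by (auto simp: submod_singleton_0 subring_set_0 right_inverse intro!: bexI[of _ "inverse _"])

lemma is_basis_over_iff: "is_basis_over K L b d \<longleftrightarrow> residue_basis K L {0} {0} b d"
  unfolding is_basis_over_def residue_basis_def lin_indep_over_def by auto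

locale field_ext =
  fixes K L :: "'a::field set" and d :: nat
  assumes K: "subfield_set K" and L: "subfield_set L" and KL: "K \<subseteq> L" and deg: "ext_degree K L d"
begin

lemma K_ring: "subring_set K" and L_ring: "subring_set L"
  using K L unfolding subfield_set_def by blast+

sublocale V: linmod K "{0}" L "{0}"
  using field_mod_subfield[OF K] K_ring L_ring KL
  by unfold_locales (auto simp: submod_def subring_set_0 subring_set_add intro: subring_set_mult)

lemma basis_iff: "is_basis_over K L b d \<longleftrightarrow> residue_basis K L {0} {0} b d"
  by (rule is_basis_over_iff)

lemma basis_exists: "\<exists>b. is_basis_over K L b d"
  using deg unfolding ext_degree_def .

lemma basis_in_L: "is_basis_over K L b d \<Longrightarrow> i < d \<Longrightarrow> b i \<in> L"
  unfolding is_basis_over_def by blast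

lemma coords_ex:
  "is_basis_over K L b d \<Longrightarrow> y \<in> L \<Longrightarrow> \<exists>c. (\<forall>i<d. c i \<in> K) \<and> y = (\<Sum>i<d. c i * b i)"
  unfolding is_basis_over_def by blast

lemma coords_props:
  assumes "is_basis_over K L b d" "y \<in> L"
  shows "(\<forall>i<d. coords K b d y i \<in> K) \<and> y = (\<Sum>i<d. coords K b d y i * b i)"
  unfolding coords_def by (rule someI_ex[OF coords_ex[OF assms]])

lemma coords_in_K: "is_basis_over K L b d \<Longrightarrow> y \<in> L \<Longrightarrow> i < d \<Longrightarrow> coords K b d y i \<in> K"
  and coords_sum: "is_basis_over K L b d \<Longrightarrow> y \<in> L \<Longrightarrow> (\<Sum>i<d. coords K b d y i * b i) = y"
  using coords_props by metis+

lemma coords_unique: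
  assumes "is_basis_over K L b d" "\<And>i. i < d \<Longrightarrow> c i \<in> K" "\<And>i. i < d \<Longrightarrow> c' i \<in> K"
    "(\<Sum>i<d. c i * b i) = (\<Sum>i<d. c' i * b i)" "i < d"
  shows "c i = c' i"
  using V.indep_coords_unique[of d b c c' "\<Sum>i<d. c i * b i" "\<Sum>i<d. c i * b i" i] assms
  unfolding basis_iff V.residue_basis_iff by simp

lemma coords_eq:
  assumes "is_basis_over K L b d" "\<And>i. i < d \<Longrightarrow> c i \<in> K" "y = (\<Sum>i<d. c i * b i)" "i < d"
  shows "coords K b d y i = c i"
proof -
  have y: "y \<in> L" unfolding assms(3) using assms(1,2) basis_in_L by (intro submod_lincomb[OF V.M]) auto
  show ?thesis
    by (rule coords_unique[OF assms(1)]) (use assms coords_in_K[OF assms(1) y] coords_sum[OF assms(1) y] in auto)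
qed

lemma mult_coords:
  assumes b: "is_basis_over K L b d" and x: "x \<in> L"
  shows "\<exists>c. (\<forall>i<d. \<forall>j<d. c i j \<in> K) \<and> (\<forall>i<d. x * b i = (\<Sum>j<d. c i j * b j))"
proof (intro exI[of _ "\<lambda>i. coords K b d (x * b i)"] conjI allI impI)
  have xb: "x * b i \<in> L" if "i < d" for i using that x b basis_in_L subring_set_mult[OF L_ring] by blast
  show "coords K b d (x * b i) j \<in> K" if "i < d" "j < d" for i j using coords_in_K[OF b xb] that by blast
  show "x * b i = (\<Sum>j<d. coords K b d (x * b i) j * b j)" if "i < d" for i using coords_sum[OF b xb[OF that]] by simp
qed

text \<open>\<open>trace_ext\<close> works in a basis picked by \<open>SOME\<close>, so independence
  of the basis comes before any computation. With the base change matrices \<open>q\<close> and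
  \<open>r\<close> one has \<open>c = q k r\<close> and \<open>r q = 1\<close>, and the trace is
  invariant under cyclic permutation.\<close>

lemma matrix_trace_unique:
  assumes b: "is_basis_over K L b d" and v: "is_basis_over K L v d"
    and k: "\<And>i j. i < d \<Longrightarrow> j < d \<Longrightarrow> k i j \<in> K" "\<And>i. i < d \<Longrightarrow> x * b i = (\<Sum>j<d. k i j * b j)"
    and c: "\<And>i j. i < d \<Longrightarrow> j < d \<Longrightarrow> c i j \<in> K" "\<And>i. i < d \<Longrightarrow> x * v i = (\<Sum>j<d. c i j * v j)"
  shows "(\<Sum>i<d. c i i) = (\<Sum>i<d. k i i)"
proof -
  define q where "q i = coords K b d (v i)" for i
  define r where "r i = coords K v d (b i)" for i
  have qK: "q i j \<in> K" if "i < d" "j < d" for i j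
    using coords_in_K[OF b basis_in_L[OF v]] that by (simp add: q_def)
  have rK: "r i j \<in> K" if "i < d" "j < d" for i j
    using coords_in_K[OF v basis_in_L[OF b]] that by (simp add: r_def)
  have vq: "v i = (\<Sum>j<d. q i j * b j)" if "i < d" for i
    using coords_sum[OF b basis_in_L[OF v that]] by (simp add: q_def)
  have br: "b i = (\<Sum>j<d. r i j * v j)" if "i < d" for i
    using coords_sum[OF v basis_in_L[OF b that]] by (simp add: r_def)
  have rq: "(\<Sum>k<d. r j k * q k l) = (if l = j then 1 else 0)" if jl: "j < d" "l < d" for j l
  proof (rule coords_unique[OF b, where i = l])
    have "(\<Sum>i<d. (\<Sum>k<d. r j k * q k i) * b i) = (\<Sum>k<d. r j k * (\<Sum>i<d. q k i * b i))"
      by (simp add: sum_distrib_left sum_distrib_right mult.assoc) (rule sum.swap)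
    also have "\<dots> = (\<Sum>k<d. r j k * v k)" using vq by simp
    also have "\<dots> = (\<Sum>i<d. (if i = j then 1 else 0) * b i)"
      using br[OF jl(1)] jl by (simp add: if_distrib[of "\<lambda>x. x * _"] cong: if_cong)
    finally show "(\<Sum>i<d. (\<Sum>k<d. r j k * q k i) * b i) = (\<Sum>i<d. (if i = j then 1 else 0) * b i)" .
  qed (use jl qK rK K_ring in \<open>auto intro!: subring_set_sum[OF K_ring] subring_set_mult[OF K_ring] simp: subring_set_0 subring_set_1\<close>)
  have cq: "c i m = (\<Sum>j<d. \<Sum>l<d. q i j * k j l * r l m)" if im: "i < d" "m < d" for i m
  proof (rule coords_unique[OF v, where i = m])
    have "(\<Sum>m<d. c i m * v m) = x * v i" using c im by simp
    also have "\<dots> = (\<Sum>j<d. q i j * (x * b j))"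
      using vq[OF im(1)] by (simp add: sum_distrib_left algebra_simps)
    also have "\<dots> = (\<Sum>j<d. \<Sum>l<d. q i j * k j l * b l)"
      using k(2) by (simp add: sum_distrib_left algebra_simps)
    also have "\<dots> = (\<Sum>j<d. \<Sum>l<d. \<Sum>m<d. q i j * k j l * r l m * v m)"
      by (intro sum.cong refl) (simp add: br sum_distrib_left algebra_simps)
    also have "\<dots> = (\<Sum>m<d. (\<Sum>j<d. \<Sum>l<d. q i j * k j l * r l m) * v m)"
      unfolding sum_distrib_right by (rule trans[OF sum.cong[OF refl sum.swap] sum.swap])
    finally show "(\<Sum>m<d. c i m * v m) = (\<Sum>m<d. (\<Sum>j<d. \<Sum>l<d. q i j * k j l * r l m) * v m)" .
  qed (use im c qK k rK in \<open>auto intro!: subring_set_sum[OF K_ring] subring_set_mult[OF K_ring]\<close>)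
  have "(\<Sum>i<d. c i i) = (\<Sum>i<d. \<Sum>j<d. \<Sum>l<d. q i j * k j l * r l i)" using cq by simp
  also have "\<dots> = (\<Sum>j<d. \<Sum>i<d. \<Sum>l<d. q i j * k j l * r l i)" by (rule sum.swap)
  also have "\<dots> = (\<Sum>j<d. \<Sum>l<d. \<Sum>i<d. q i j * k j l * r l i)" by (intro sum.cong refl sum.swap)
  also have "\<dots> = (\<Sum>j<d. \<Sum>l<d. k j l * (\<Sum>i<d. r l i * q i j))" by (simp add: sum_distrib_left algebra_simps)
  also have "\<dots> = (\<Sum>j<d. \<Sum>l<d. k j l * (if j = l then 1 else 0))" using rq by simp
  also have "\<dots> = (\<Sum>j<d. k j j)" by (simp add: if_distrib[of "\<lambda>x. _ * x"] cong: if_cong)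
  finally show ?thesis .
qed

abbreviation Tr :: "'a \<Rightarrow> 'a" where "Tr \<equiv> trace_ext K L d"

lemma some_basis: "is_basis_over K L (SOME b. is_basis_over K L b d) d"
  by (rule someI_ex[OF basis_exists])

lemma trace_eq:
  assumes v: "is_basis_over K L v d" and x: "x \<in> L"
    and c: "\<And>i j. i < d \<Longrightarrow> j < d \<Longrightarrow> c i j \<in> K" "\<And>i. i < d \<Longrightarrow> x * v i = (\<Sum>j<d. c i j * v j)"
  shows "Tr x = (\<Sum>i<d. c i i)"
proof -
  let ?b = "SOME b. is_basis_over K L b d"
  have xb: "x * ?b i \<in> L" if "i < d" for i using that x some_basis basis_in_L subring_set_mult[OF L_ring] by blast
  have "(\<Sum>i<d. c i i) = (\<Sum>i<d. coords K ?b d (x * ?b i) i)"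
    by (rule matrix_trace_unique[OF some_basis v _ _ c])
      (use coords_in_K[OF some_basis xb] coords_sum[OF some_basis xb] in auto)
  then show ?thesis unfolding trace_ext_def Let_def by simp
qed

lemma trace_in_K: "x \<in> L \<Longrightarrow> Tr x \<in> K"
proof -
  assume x: "x \<in> L"
  obtain b where b: "is_basis_over K L b d" using basis_exists by blast
  obtain c where c: "\<forall>i<d. \<forall>j<d. c i j \<in> K" "\<forall>i<d. x * b i = (\<Sum>j<d. c i j * b j)"
    using mult_coords[OF b x] by blast
  have "Tr x = (\<Sum>i<d. c i i)" by (rule trace_eq[OF b x]) (use c in auto)
  then show ?thesis using c K_ring by (auto intro: subring_set_sum)
qed

lemma trace_lincomb:
  fixes n :: nat
  assumes a: "\<And>k. k < n \<Longrightarrow> a k \<in> K" and x: "\<And>k. k < n \<Longrightarrow> x k \<in> L"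
  shows "Tr (\<Sum>k<n. a k * x k) = (\<Sum>k<n. a k * Tr (x k))"
proof -
  obtain b where b: "is_basis_over K L b d" using basis_exists by blast
  have "\<forall>k. \<exists>c. k < n \<longrightarrow> (\<forall>i<d. \<forall>j<d. c i j \<in> K) \<and> (\<forall>i<d. x k * b i = (\<Sum>j<d. c i j * b j))"
    using mult_coords[OF b x] by blast
  then obtain c where c: "\<And>k i j. k < n \<Longrightarrow> i < d \<Longrightarrow> j < d \<Longrightarrow> c k i j \<in> K"
    "\<And>k i. k < n \<Longrightarrow> i < d \<Longrightarrow> x k * b i = (\<Sum>j<d. c k i j * b j)" by metis
  have tr: "Tr (x k) = (\<Sum>i<d. c k i i)" if "k < n" for k
    by (rule trace_eq[OF b x]) (use c that in auto)
  have "Tr (\<Sum>k<n. a k * x k) = (\<Sum>i<d. \<Sum>k<n. a k * c k i i)"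
  proof (rule trace_eq[OF b, where c = "\<lambda>i j. \<Sum>k<n. a k * c k i j"])
    show "(\<Sum>k<n. a k * x k) \<in> L" using a x by (intro submod_lincomb[OF V.M]) auto
    show "(\<Sum>k<n. a k * c k i j) \<in> K" if "i < d" "j < d" for i j
      using a c that by (intro subring_set_sum[OF K_ring] subring_set_mult[OF K_ring]) auto
    show "(\<Sum>k<n. a k * x k) * b i = (\<Sum>j<d. (\<Sum>k<n. a k * c k i j) * b j)" if "i < d" for i
    proof -
      have "(\<Sum>k<n. a k * x k) * b i = (\<Sum>k<n. a k * (\<Sum>j<d. c k i j * b j))"
        unfolding sum_distrib_right using c(2) that by (intro sum.cong refl) (simp add: mult.assoc)
      also have "\<dots> = (\<Sum>j<d. (\<Sum>k<n. a k * c k i j) * b j)"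
        by (simp add: sum_distrib_left sum_distrib_right mult.assoc) (rule sum.swap)
      finally show ?thesis .
    qed
  qed
  also have "\<dots> = (\<Sum>k<n. a k * (\<Sum>i<d. c k i i))"
    by (simp add: sum_distrib_left) (rule sum.swap)
  finally show ?thesis using tr by simp
qed

lemma trace_one: "Tr 1 = of_nat d"
proof -
  obtain b where b: "is_basis_over K L b d" using basis_exists by blast
  have "Tr 1 = (\<Sum>i<d. if i = i then 1 else 0)"
    by (rule trace_eq[OF b, where c = "\<lambda>i j. if i = j then 1 else 0"])
      (use K_ring L_ring in \<open>auto simp: subring_set_0 subring_set_1 if_distrib[of "\<lambda>x. x * _"] cong: if_cong\<close>)
  then show ?thesis by simp
qed

lemma degree_pos: "0 < d"
proof (rule ccontr)
  assume "\<not> 0 < d"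
  obtain b where b: "is_basis_over K L b d" using basis_exists by blast
  show False using coords_ex[OF b subring_set_1[OF L_ring]] \<open>\<not> 0 < d\<close> by simp
qed

end

section \<open>Polynomials over a subring and the determinant trick for integrality\<close>

definition coeffs_in :: "'a::field set \<Rightarrow> 'a poly \<Rightarrow> bool" where
  "coeffs_in A p \<longleftrightarrow> (\<forall>i. coeff p i \<in> A)"

context
  fixes A :: "'a::field set"
  assumes A: "subring_set A"
begin

lemma coeffs_in_add: "coeffs_in A p \<Longrightarrow> coeffs_in A q \<Longrightarrow> coeffs_in A (p + q)"
  using A by (simp add: coeffs_in_def subring_set_add)

lemma coeffs_in_diff: "coeffs_in A p \<Longrightarrow> coeffs_in A q \<Longrightarrow> coeffs_in A (p - q)"
  using A by (simp add: coeffs_in_def subring_set_diff)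

lemma coeffs_in_mult: "coeffs_in A p \<Longrightarrow> coeffs_in A q \<Longrightarrow> coeffs_in A (p * q)"
  using A by (auto simp: coeffs_in_def coeff_mult intro!: subring_set_sum subring_set_mult)

lemma coeffs_in_pCons: "coeffs_in A (pCons a p) \<longleftrightarrow> a \<in> A \<and> coeffs_in A p"
  unfolding coeffs_in_def by (metis coeff_pCons_0 coeff_pCons_Suc not0_implies_Suc)

lemma coeffs_in_0: "coeffs_in A 0"
  using A by (simp add: coeffs_in_def subring_set_0)

lemma coeffs_in_1: "coeffs_in A 1"
  using A by (simp add: one_pCons coeffs_in_pCons coeffs_in_0 subring_set_1)

lemma coeffs_in_monom: "a \<in> A \<Longrightarrow> coeffs_in A (monom a n)"
  using A by (simp add: coeffs_in_def subring_set_0)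

lemma coeffs_in_sum: "(\<And>i. i \<in> I \<Longrightarrow> coeffs_in A (f i)) \<Longrightarrow> coeffs_in A (sum f I)"
  by (induction I rule: infinite_finite_induct) (auto simp: coeffs_in_0 coeffs_in_add)

lemma coeffs_in_prod: "(\<And>i. i \<in> I \<Longrightarrow> coeffs_in A (f i)) \<Longrightarrow> coeffs_in A (prod f I)"
  by (induction I rule: infinite_finite_induct) (auto simp: coeffs_in_1 coeffs_in_mult)

lemma coeffs_in_uminus: "coeffs_in A p \<Longrightarrow> coeffs_in A (- p)"
  using A by (simp add: coeffs_in_def subring_set_uminus)

lemma poly_in: "coeffs_in A p \<Longrightarrow> x \<in> A \<Longrightarrow> poly p x \<in> A"
  using A by (auto simp: poly_altdef coeffs_in_def intro!: subring_set_sum subring_set_mult subring_set_power)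

lemma coeffs_in_char_poly:
  assumes C: "C \<in> carrier_mat n n" and CA: "\<And>i j. i < n \<Longrightarrow> j < n \<Longrightarrow> C $$ (i, j) \<in> A"
  shows "coeffs_in A (char_poly C)"
proof -
  have entry: "coeffs_in A (char_poly_matrix C $$ (i, j))" if "i < n" "j < n" for i j
  proof -
    have "char_poly_matrix C $$ (i, j) = (if i = j then [:0, 1:] else 0) + [:- (C $$ (i, j)):]"
      using C that by (auto simp: char_poly_matrix_def)
    then show ?thesis
      using CA[OF that] A by (auto simp: coeffs_in_pCons coeffs_in_0 subring_set_intros)
  qed
  have perm: "coeffs_in A (signof p)" for p :: "nat \<Rightarrow> nat"
    by (simp add: sign_def coeffs_in_1 coeffs_in_uminus)
  show ?thesis
    unfolding char_poly_def det_def'[OF char_poly_matrix_closed[OF C]]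
  proof (intro coeffs_in_sum coeffs_in_mult coeffs_in_prod entry perm)
    fix p i assume "p \<in> {p. p permutes {0..<n}}" "i \<in> {0..<n}"
    then show "i < n" "p i < n" using permutes_in_image[of p "{0..<n}" i] by auto
  qed
qed

text \<open>\<open>x\<close> is an eigenvalue of the matrix \<open>C\<close> over the ambient field,
  with eigenvector \<open>g\<close>, hence a root of the characteristic polynomial, which is monic
  with coefficients in \<open>A\<close>.\<close>

lemma integral_if_eigenvalue:
  fixes n :: nat
  assumes g: "k < n" "g k \<noteq> 0" and C: "\<And>i j. i < n \<Longrightarrow> j < n \<Longrightarrow> C i j \<in> A"
    "\<And>i. i < n \<Longrightarrow> x * g i = (\<Sum>j<n. C i j * g j)"
  shows "integral_over A x"
proof -
  define D where "D = mat n n (\<lambda>(i, j). C i j)"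
  have D: "D \<in> carrier_mat n n" by (simp add: D_def)
  have "eigenvector D (vec n g) x"
    unfolding eigenvector_def
  proof (intro conjI)
    show "vec n g \<noteq> 0\<^sub>v (dim_row D)"
    proof
      assume "vec n g = 0\<^sub>v (dim_row D)"
      then have "vec n g $ k = 0\<^sub>v n $ k" using D by simp
      then show False using g by simp
    qed
    show "D *\<^sub>v vec n g = x \<cdot>\<^sub>v vec n g"
      by (rule eq_vecI) (auto simp: D_def scalar_prod_def C lessThan_atLeast0)
  qed (simp add: D_def)
  then have "eigenvalue D x" unfolding eigenvalue_def by blast
  then have "poly (char_poly D) x = 0" using eigenvalue_root_char_poly[OF D] by simp
  moreover have "coeffs_in A (char_poly D)"
    by (rule coeffs_in_char_poly[OF D]) (use C in \<open>auto simp: D_def\<close>)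
  ultimately show ?thesis
    using degree_monic_char_poly[OF D] unfolding integral_over_def coeffs_in_def by auto
qed

lemma integral_if_finite_module:
  assumes I: "finite I" "k \<in> I" "g k \<noteq> 0"
    and x: "\<And>i. i \<in> I \<Longrightarrow> \<exists>c. (\<forall>j\<in>I. c j \<in> A) \<and> x * g i = (\<Sum>j\<in>I. c j * g j)"
  shows "integral_over A x"
proof -
  obtain h where h: "bij_betw h {..<card I} I"
    using ex_bij_betw_nat_finite[OF I(1)] by (auto simp: atLeast0LessThan)
  have "\<forall>i. \<exists>c. i \<in> I \<longrightarrow> (\<forall>j\<in>I. c j \<in> A) \<and> x * g i = (\<Sum>j\<in>I. c j * g j)" using x by blast
  then obtain C where C: "\<And>i j. i \<in> I \<Longrightarrow> j \<in> I \<Longrightarrow> C i j \<in> A"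
    "\<And>i. i \<in> I \<Longrightarrow> x * g i = (\<Sum>j\<in>I. C i j * g j)" by metis
  obtain m where m: "m < card I" "h m = k" using h I unfolding bij_betw_def by force
  have hI: "h i \<in> I" if "i < card I" for i using h that unfolding bij_betw_def by blast
  show ?thesis
  proof (rule integral_if_eigenvalue[of m "card I" "g \<circ> h" "\<lambda>i j. C (h i) (h j)"])
    fix i assume "i < card I"
    then have "x * g (h i) = (\<Sum>j\<in>I. C (h i) j * g j)" using C hI by blast
    then show "x * (g \<circ> h) i = (\<Sum>j<card I. C (h i) (h j) * (g \<circ> h) j)"
      using sum.reindex_bij_betw[OF h, of "\<lambda>j. C (h i) j * g j"] by simp
  qed (use m I C hI in auto)
qed

text \<open>The \<open>A\<close>-module \<open>S\<close> spanned by the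
  \<open>x ^ i * y ^ j\<close>, with exponents below the degrees of the two integral equations, is
  stable under \<open>x\<close> and \<open>y\<close>, hence under their sum and product. The
  generator \<open>g (0, 0) = 1\<close> shows that it is nonzero.\<close>

lemma integral_closed:
  assumes x: "integral_over A x" and y: "integral_over A y"
  shows "integral_over A (x + y) \<and> integral_over A (x * y)"
proof -
  obtain p q where p: "coeffs_in A p" "lead_coeff p = 1" "poly p x = 0"
    and q: "coeffs_in A q" "lead_coeff q = 1" "poly q y = 0"
    using x y unfolding integral_over_def coeffs_in_def by blast
  define m n where "m = degree p" and "n = degree q"
  have mn: "0 < m" "0 < n"
    using p q degree_eq_zeroE[of p] degree_eq_zeroE[of q] unfolding m_def n_def
    by (metis gr0I lead_coeff_pCons(2) poly_const_conv zero_neq_one)+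
  define I where "I = {..<m} \<times> {..<n}"
  define g where "g = (\<lambda>(i, j). x ^ i * y ^ j)"
  define S where "S = {\<Sum>k\<in>I. c k * g k | c. \<forall>k\<in>I. c k \<in> A}"
  have I: "finite I" by (simp add: I_def)
  have S: "submod A S" unfolding S_def by (rule submod_lincombs[OF A])
  have gS: "g k \<in> S" if "k \<in> I" for k
    unfolding S_def using that I A
    by (auto intro!: exI[of _ "\<lambda>l. if l = k then 1 else 0"] simp: subring_set_0 subring_set_1 if_distrib[of "\<lambda>x. x * _"] cong: if_cong)
  have monic: "z ^ degree r = (\<Sum>i<degree r. (- coeff r i) * z ^ i)"
    if "lead_coeff r = 1" "poly r z = 0" for r and z :: 'a
  proof -
    have "(\<Sum>i<Suc (degree r). coeff r i * z ^ i) = 0"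
      using that(2) poly_altdef[of r z] by (simp only: lessThan_Suc_atMost)
    then have "(\<Sum>i<degree r. coeff r i * z ^ i) + z ^ degree r = 0"
      using that(1) by simp
    then show ?thesis by (simp add: sum_negf add_eq_0_iff)
  qed
  have xg: "x * g k \<in> S" if k: "k \<in> I" for k
  proof -
    obtain i j where ij: "k = (i, j)" "i < m" "j < n" using k by (auto simp: I_def)
    show ?thesis
    proof (cases "Suc i < m")
      case True
      then show ?thesis using gS[of "(Suc i, j)"] ij by (simp add: g_def I_def mult.assoc)
    next
      case False
      then have "x * g k = x ^ m * y ^ j" using ij by (metis Suc_lessI case_prod_conv g_def mult.assoc power_Suc)
      also have "\<dots> = (\<Sum>i<m. (- coeff p i) * g (i, j))"
        using monic[OF p(2,3)] by (simp add: m_def g_def sum_distrib_right mult.assoc)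
      also have "\<dots> \<in> S"
        by (rule submod_lincomb[OF S]) (use p(1) A ij gS in \<open>auto simp: coeffs_in_def I_def intro: subring_set_uminus\<close>)
      finally show ?thesis .
    qed
  qed
  have yg: "y * g k \<in> S" if k: "k \<in> I" for k
  proof -
    obtain i j where ij: "k = (i, j)" "i < m" "j < n" using k by (auto simp: I_def)
    show ?thesis
    proof (cases "Suc j < n")
      case True
      then show ?thesis using gS[of "(i, Suc j)"] ij by (simp add: g_def I_def algebra_simps)
    next
      case False
      then have "n = Suc j" using ij by simp
      then have "y * g k = x ^ i * y ^ n" using ij by (simp add: g_def)
      also have "\<dots> = (\<Sum>j<n. (- coeff q j) * g (i, j))"
        using monic[OF q(2,3)] by (simp add: n_def g_def sum_distrib_left algebra_simps)
      also have "\<dots> \<in> S"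
        by (rule submod_lincomb[OF S]) (use q(1) A ij gS in \<open>auto simp: coeffs_in_def I_def intro: subring_set_uminus\<close>)
      finally show ?thesis .
    qed
  qed
  have xS: "x * s \<in> S" if "s \<in> S" for s
  proof -
    obtain c where "\<forall>k\<in>I. c k \<in> A" "s = (\<Sum>k\<in>I. c k * g k)" using \<open>s \<in> S\<close> unfolding S_def by blast
    then have "(\<Sum>k\<in>I. c k * (x * g k)) \<in> S" using xg by (intro submod_lincomb[OF S]) auto
    then show ?thesis using \<open>s = _\<close> by (simp add: sum_distrib_left algebra_simps)
  qed
  have g00: "(0, 0) \<in> I" "g (0, 0) \<noteq> 0" using mn by (auto simp: I_def g_def)
  have main: "integral_over A z" if z: "\<And>k. k \<in> I \<Longrightarrow> z * g k \<in> S" for z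
  proof (rule integral_if_finite_module[where g = g, OF I g00])
    fix k assume "k \<in> I"
    then have "z * g k \<in> S" by (rule z)
    then show "\<exists>c. (\<forall>j\<in>I. c j \<in> A) \<and> z * g k = (\<Sum>j\<in>I. c j * g j)" unfolding S_def by blast
  qed
  show ?thesis
  proof
    show "integral_over A (x + y)"
      by (rule main) (simp add: distrib_right submod_add[OF S xg yg])
    show "integral_over A (x * y)"
      by (rule main) (simp add: mult.assoc xS[OF yg])
  qed
qed

lemma integral_self: "a \<in> A \<Longrightarrow> integral_over A a"
  unfolding integral_over_def
  by (rule exI[of _ "[:- a, 1:]"]) (use coeffs_in_pCons A in \<open>simp add: coeffs_in_def[symmetric] coeffs_in_0 subring_set_intros\<close>)

lemma subring_integral_closure:
  assumes "subring_set L"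
  shows "subring_set (integral_closure_in A L)"
proof -
  have "integral_over A (x - y)" if "integral_over A x" "integral_over A y" for x y
    using integral_closed[OF that(1), of "- 1 * y"] integral_closed[OF integral_self[of "- 1"] that(2)]
      subring_set_intros(2,3)[OF A] by simp
  then show ?thesis
    using assms integral_closed integral_self subring_set_1[OF A]
    unfolding subring_set_def integral_closure_in_def by blast
qed

text \<open>The module spanned by \<open>1, x, ..., x ^ (n - 1)\<close> is stable under
  \<open>lead_coeff q * x\<close>, because the equation \<open>q\<close> expresses
  \<open>lead_coeff q * x ^ n\<close> by lower powers.\<close>

lemma integral_multiple:
  assumes "q \<noteq> 0" "coeffs_in A q" "poly q x = 0"
  shows "integral_over A (lead_coeff q * x)"
proof -
  define n where "n = degree q"
  have n: "0 < n" using assms degree_eq_zeroE[of q] unfolding n_def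
    by (metis gr0I pCons_0_0 poly_const_conv)
  define a where "a = lead_coeff q"
  show ?thesis
  proof (rule integral_if_finite_module[of "{..<n}" 0 "\<lambda>i. x ^ i"])
    fix i assume i: "i \<in> {..<n}"
    show "\<exists>c. (\<forall>j\<in>{..<n}. c j \<in> A) \<and> lead_coeff q * x * x ^ i = (\<Sum>j<n. c j * x ^ j)"
    proof (cases "Suc i < n")
      case True
      then show ?thesis
        using assms(2) subring_set_0[OF A]
        by (intro exI[of _ "\<lambda>j. if j = Suc i then lead_coeff q else 0"])
          (auto simp: coeffs_in_def mult.assoc if_distrib[of "\<lambda>x. x * _"] cong: if_cong)
    next
      case False
      then have "n = Suc i" using i by simp
      have "(\<Sum>i<Suc n. coeff q i * x ^ i) = 0"
        using assms(3) poly_altdef[of q x] by (simp only: lessThan_Suc_atMost n_def)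
      then have "(\<Sum>i<n. coeff q i * x ^ i) + lead_coeff q * x ^ n = 0"
        by (simp add: n_def)
      then have "lead_coeff q * x * x ^ i = (\<Sum>j<n. (- coeff q j) * x ^ j)"
        using \<open>n = Suc i\<close> by (simp add: sum_negf add_eq_0_iff mult.assoc)
      then show ?thesis using assms(2) subring_set_uminus[OF A]
        by (intro exI[of _ "\<lambda>j. - coeff q j"]) (auto simp: coeffs_in_def)
    qed
  qed (use n in auto)
qed

end

section \<open>Separability in positive characteristic\<close>

lemma CHAR_poly: "CHAR('a::field poly) = CHAR('a)"
proof (rule CHAR_eqI)
  show "of_nat CHAR('a) = (0 :: 'a poly)" by (simp add: of_nat_poly)
  show "CHAR('a) dvd n" if "of_nat n = (0 :: 'a poly)" for n
    using that by (simp add: of_nat_poly of_nat_eq_0_iff_char_dvd)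
qed

text \<open>If the constant term \<open>a\<close> is nonzero, the equation
  \<open>a + e * poly q e = 0\<close> displays the inverse of \<open>e\<close>; otherwise
  \<open>e\<close> is cancelled and the degree drops.\<close>

lemma inverse_in_if_algebraic:
  assumes E: "subring_set E" and K: "subfield_set K" "K \<subseteq> E" and e: "e \<in> E" "e \<noteq> 0"
  shows "q \<noteq> 0 \<Longrightarrow> coeffs_in K q \<Longrightarrow> poly q e = 0 \<Longrightarrow> inverse e \<in> E"
proof (induction q)
  case 0
  then show ?case by simp
next
  case (pCons a q)
  have K_ring: "subring_set K" using K unfolding subfield_set_def by blast
  have a: "a \<in> K" "coeffs_in K q" using pCons.prems coeffs_in_pCons[OF K_ring] by blast+
  show ?case
  proof (cases "a = 0")
    case True
    then show ?thesis using pCons a e by auto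
  next
    case False
    have "coeffs_in E q" using a K unfolding coeffs_in_def by blast
    then have "poly q e \<in> E" using poly_in[OF E] e by blast
    moreover have "- inverse a \<in> E" using a K K_ring unfolding subfield_set_def by (auto intro: subring_set_uminus)
    moreover have "inverse e = - inverse a * poly q e"
      using pCons.prems(3) False e(2) by (simp add: field_simps add_eq_0_iff)
    ultimately show ?thesis using subring_set_mult[OF E] by metis
  qed
qed

text \<open>Euclidean division carried out by hand: the polynomials live over the ambient field, but
  \<open>h\<close> is minimal only among those over \<open>E\<close>, so every remainder has to keep
  its coefficients in \<open>E\<close>.\<close>

lemma min_poly_dvd:
  assumes E: "subring_set E" and inv: "\<And>e. e \<in> E \<Longrightarrow> inverse e \<in> E"
    and h: "h \<noteq> 0" "coeffs_in E h" "poly h x = 0"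
    and min: "\<And>g. g \<noteq> 0 \<Longrightarrow> coeffs_in E g \<Longrightarrow> poly g x = 0 \<Longrightarrow> degree h \<le> degree g"
  shows "coeffs_in E f \<Longrightarrow> poly f x = 0 \<Longrightarrow> h dvd f"
proof (induction "degree f" arbitrary: f rule: less_induct)
  case less
  show ?case
  proof (cases "f = 0")
    case False
    then have deg: "degree h \<le> degree f" using min less.prems by blast
    define c where "c = lead_coeff f * inverse (lead_coeff h)"
    define g where "g = f - monom c (degree f - degree h) * h"
    have c: "c \<in> E" "c \<noteq> 0"
      using inv h less.prems False E unfolding c_def coeffs_in_def by (auto intro: subring_set_mult)
    have g: "coeffs_in E g" "poly g x = 0"
      using less.prems h c E by (auto simp: g_def intro!: coeffs_in_diff coeffs_in_mult coeffs_in_monom)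
    have "h dvd g"
    proof (cases "g = 0")
      case gnz: False
      have dm: "degree (monom c (degree f - degree h) * h) = degree f"
        using c h deg by (simp add: degree_mult_eq degree_monom_eq)
      have "coeff g (degree f) = 0"
        using h deg by (simp add: g_def c_def coeff_monom_mult)
      moreover have "degree g \<le> degree f" unfolding g_def using dm by (metis degree_diff_le order_refl)
      ultimately have "degree g < degree f" using gnz
        by (metis leading_coeff_0_iff le_neq_implies_less)
      then show ?thesis using less.hyps g by blast
    qed simp
    then have "h dvd g + monom c (degree f - degree h) * h" by simp
    then show ?thesis by (simp add: g_def)
  qed simp
qed

context field_ext
begin

text \<open>The ring \<open>E = K[x ^ l]\<close> is a field, as its elements are algebraic over
  \<open>K\<close>. The minimal polynomial \<open>h\<close> of \<open>x\<close> over
  \<open>E\<close> divides both \<open>(X - x) ^ l\<close>, whose coefficients lie in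
  \<open>E\<close>, and a polynomial coprime to its derivative. So \<open>h\<close> is linear, which
  means \<open>x \<in> E\<close>.\<close>

lemma separable_frobenius:
  assumes sep: "separable_ext K L" and l: "prime l" "l = CHAR('a)" and x: "x \<in> L"
  shows "\<exists>r. coeffs_in K r \<and> x = poly r (x ^ l)"
proof -
  define E where "E = {poly r (x ^ l) | r. coeffs_in K r}"
  have EI: "poly r (x ^ l) \<in> E" if "coeffs_in K r" for r using that unfolding E_def by blast
  have E: "subring_set E"
    unfolding subring_set_def
  proof (intro conjI ballI)
    show "1 \<in> E" using EI[OF coeffs_in_1[OF K_ring]] by simp
  next
    fix y z assume "y \<in> E" "z \<in> E"
    then obtain r s where "coeffs_in K r" "coeffs_in K s" "y = poly r (x ^ l)" "z = poly s (x ^ l)"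
      unfolding E_def by blast
    then show "y - z \<in> E" "y * z \<in> E"
      using EI[OF coeffs_in_diff[OF K_ring, of r s]] EI[OF coeffs_in_mult[OF K_ring, of r s]] by auto
  qed
  have KE: "K \<subseteq> E"
  proof
    fix a assume "a \<in> K"
    then show "a \<in> E" using EI[of "[:a:]"] by (simp add: coeffs_in_pCons[OF K_ring] coeffs_in_0[OF K_ring])
  qed
  have EL: "E \<subseteq> L"
    using poly_in[OF L_ring] subring_set_power[OF L_ring x] KL unfolding E_def coeffs_in_def by blast
  have inv: "inverse e \<in> E" if "e \<in> E" for e
  proof (cases "e = 0")
    case False
    obtain q where "q \<noteq> 0" "coeffs_in K q" "poly q e = 0"
      using bspec[OF sep[unfolded separable_ext_def] subsetD[OF EL \<open>e \<in> E\<close>]] unfolding coeffs_in_def by blast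
    then show ?thesis using inverse_in_if_algebraic[OF E K KE that False] by blast
  qed (use that in simp)
  obtain p where p: "p \<noteq> 0" "coeffs_in K p" "poly p x = 0" "coprime p (pderiv p)"
    using bspec[OF sep[unfolded separable_ext_def] x] unfolding coeffs_in_def by blast
  have pE: "coeffs_in E p" using p KE unfolding coeffs_in_def by blast
  define Q where "Q g \<longleftrightarrow> g \<noteq> 0 \<and> coeffs_in E g \<and> poly g x = 0" for g
  obtain h where h: "Q h" "\<And>g. Q g \<Longrightarrow> degree h \<le> degree g"
    using exists_least_iff[of "\<lambda>n. \<exists>g. Q g \<and> degree g = n"] p pE unfolding Q_def
    by (metis not_le)
  have dvd: "h dvd f" if "coeffs_in E f" "poly f x = 0" for f
    by (rule min_poly_dvd[OF E inv _ _ _ _ that]) (use h in \<open>auto simp: Q_def\<close>)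
  have "[:- x, 1:] ^ l = (monom 1 1 + [:- x:]) ^ l" by (simp add: monom_altdef)
  also have "\<dots> = monom 1 1 ^ l + [:- x:] ^ l"
    by (rule freshmans_dream) (use l in \<open>simp_all add: CHAR_poly\<close>)
  \<comment> \<open>The sign stays in the form \<open>(- 1) ^ l\<close>, so that
    \<open>l = 2\<close> is no special case.\<close>
  also have "\<dots> = monom 1 l + [:(- 1) ^ l * x ^ l:]"
    by (simp add: monom_power pCons_0_as_mult[symmetric] poly_const_pow flip: power_mult_distrib)
  finally have pw: "[:- x, 1:] ^ l = monom 1 l + [:(- 1) ^ l * x ^ l:]" .
  have "(- 1) ^ l * x ^ l \<in> E"
    using EI[of "monom 1 1"] K_ring E
    by (auto simp: poly_monom coeffs_in_monom subring_set_1 intro!: subring_set_mult subring_set_power subring_set_uminus)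
  then have "coeffs_in E ([:- x, 1:] ^ l)"
    unfolding pw using E
    by (intro coeffs_in_add coeffs_in_monom) (auto simp: coeffs_in_pCons coeffs_in_0 subring_set_1)
  then have "h dvd [:- x, 1:] ^ l"
    by (rule dvd) (use prime_gt_0_nat[OF l(1)] in \<open>simp add: poly_power\<close>)
  then obtain w where w: "[:- x, 1:] ^ l = h * w" by (elim dvdE)
  have hw: "h * w \<noteq> 0" unfolding w[symmetric] by simp
  \<comment> \<open>Degrees and orders at \<open>x\<close> both add up to \<open>l\<close>, and an
    order never exceeds the degree. Equality holds in each factor, so \<open>h\<close> is a power of
    \<open>X - x\<close> up to a constant.\<close>
  have "degree h + degree w = l"
    using arg_cong[OF w, of degree] hw by (simp add: degree_mult_eq degree_power_eq)
  moreover have "order x h + order x w = l"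
    using arg_cong[OF w, of "order x"] order_mult[OF hw, of x] by (simp add: order_power_n_n)
  moreover have "order x h \<le> degree h" "order x w \<le> degree w" using hw by (auto intro: order_degree)
  ultimately have deg_h: "degree h = order x h" by simp
  have "order x h < 2"
  proof (rule ccontr)
    assume "\<not> order x h < 2"
    then have "[:- x, 1:] ^ 2 dvd h" by (meson order_1 dvd_trans le_imp_power_dvd not_less)
    then have "[:- x, 1:] ^ 2 dvd p" using dvd[OF pE p(3)] dvd_trans by blast
    then obtain g where g: "p = [:- x, 1:] ^ 2 * g" by (elim dvdE)
    define y where "y = [:- x, 1:]"
    have "p = y * (y * g)" "poly y x = 0" by (simp_all only: g y_def power2_eq_square mult.assoc) simp
    then have "poly (pderiv p) x = 0"
      by (simp add: pderiv_mult)
    then have "[:- x, 1:] dvd pderiv p" "[:- x, 1:] dvd p" using p by (simp_all add: poly_eq_0_iff_dvd)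
    then have "[:- x, 1:] dvd 1" using p(4) coprime_common_divisor[of p "pderiv p"] by blast
    then show False by (simp add: is_unit_iff_degree)
  qed
  moreover have "order x h \<noteq> 0" using h(1) unfolding Q_def by (auto simp: order_root)
  ultimately have "degree h = 1" using deg_h by simp
  then obtain a b where ab: "h = [:a, b:]" "b \<noteq> 0" by (metis degree1_coeffs)
  then have "a \<in> E" "b \<in> E" using h E unfolding Q_def by (auto simp: coeffs_in_pCons)
  moreover have "x = - a * inverse b" using h ab unfolding Q_def by (simp add: field_simps add_eq_0_iff)
  ultimately have "x \<in> E" using inv E by (metis subring_set_mult subring_set_uminus)
  then show ?thesis unfolding E_def by blast
qed

text \<open>The \<open>K\<close>-span \<open>S\<close> of the \<open>b i ^ l\<close> contains all
  \<open>l\<close>-th powers by the Frobenius map, hence \<open>K[y ^ l]\<close> for each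
  \<open>y \<in> L\<close>, hence \<open>y\<close> itself by separability. A spanning family of
  \<open>d\<close> elements is a basis.\<close>

lemma separable_power_basis:
  assumes sep: "separable_ext K L" and l: "prime l" "l = CHAR('a)" and b: "is_basis_over K L b d"
  shows "is_basis_over K L (\<lambda>i. b i ^ l) d"
proof -
  have bL: "b i ^ l \<in> L" if "i < d" for i using basis_in_L[OF b that] subring_set_power[OF L_ring] by blast
  define S where "S = {\<Sum>i<d. c i * b i ^ l | c. \<forall>i<d. c i \<in> K}"
  have SI: "(\<Sum>i<d. c i * b i ^ l) \<in> S" if "\<forall>i<d. c i \<in> K" for c
    using that unfolding S_def by blast
  have S: "submod K S" unfolding S_def using submod_lincombs[OF K_ring, where I = "{..<d}" and g = "\<lambda>i. b i ^ l"]
    by (simp add: Ball_def)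
  have pow: "y ^ l \<in> S" if "y \<in> L" for y
  proof -
    obtain c where c: "\<forall>i<d. c i \<in> K" "y = (\<Sum>i<d. c i * b i)" using coords_ex[OF b \<open>y \<in> L\<close>] by blast
    have "y ^ l = (\<Sum>i<d. c i ^ l * b i ^ l)"
      using c freshmans_dream_sum[of l "\<lambda>i. c i * b i" "{..<d}"] l by (simp add: power_mult_distrib)
    then show ?thesis using SI[of "\<lambda>i. c i ^ l"] c subring_set_power[OF K_ring] by simp
  qed
  have "V.spans d (\<lambda>i. b i ^ l)"
    unfolding V.spans_def
  proof
    fix y assume y: "y \<in> L"
    obtain r where r: "coeffs_in K r" "y = poly r (y ^ l)" using separable_frobenius[OF sep l y] by blast
    have "poly r (y ^ l) = (\<Sum>j\<le>degree r. coeff r j * (y ^ j) ^ l)"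
      by (simp add: poly_altdef power_mult[symmetric] mult.commute)
    also have "\<dots> \<in> S"
      using r pow subring_set_power[OF L_ring y] by (intro submod_lincomb[OF S]) (auto simp: coeffs_in_def)
    finally have "y \<in> S" using r by simp
    then show "\<exists>c. (\<forall>i<d. c i \<in> K) \<and> y - (\<Sum>i<d. c i * b i ^ l) \<in> {0}" unfolding S_def by auto
  qed
  then have "residue_basis K L {0} {0} (\<lambda>i. b i ^ l) d"
    using V.spans_card_basis[OF b[unfolded basis_iff], of "\<lambda>i. b i ^ l"] bL by blast
  then show ?thesis by (simp add: basis_iff)
qed

text \<open>In characteristic 0 the trace of 1 is \<open>d\<close>. In characteristic
  \<open>l\<close>, where \<open>l\<close> may divide \<open>d\<close>, the criterion for
  \<open>linfield\<close> is applied to \<open>L\<close> over \<open>K\<close> with zero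
  ideals.\<close>

lemma trace_not_zero:
  assumes sep: "separable_ext K L"
  shows "\<exists>x\<in>L. Tr x \<noteq> 0"
proof (cases "CHAR('a) = 0")
  case True
  then have "Tr 1 \<noteq> 0" using trace_one degree_pos by (simp add: of_nat_eq_0_iff_char_dvd)
  then show ?thesis using subring_set_1[OF L_ring] by blast
next
  case False
  then have l: "prime CHAR('a)" by (intro prime_CHAR_semidom) auto
  interpret W: linfield K "{0}" L "{0}"
  proof unfold_locales
    fix x w :: 'a assume "x \<in> L" "x \<notin> {0}" "w \<in> L"
    then show "\<exists>y\<in>L. x * y - w \<in> {0}"
      using L subfield_set_divide[OF L, of w x] by (intro bexI[of _ "w / x"]) auto
  qed (use L_ring subring_set_1[OF L_ring] in \<open>auto intro: subring_set_mult\<close>)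
  obtain b where b: "is_basis_over K L b d" using basis_exists by blast
  have "V.indep d (\<lambda>i. b i ^ CHAR('a))"
    using separable_power_basis[OF sep l refl b] unfolding basis_iff V.residue_basis_iff by blast
  then obtain x where x: "x \<in> L"
    "\<forall>m. (\<forall>i<d. \<forall>j<d. m i j \<in> K) \<and> (\<forall>i<d. x * b i - (\<Sum>j<d. m i j * b j) \<in> {0}) \<longrightarrow> (\<Sum>i<d. m i i) \<notin> {0}"
    using W.trace_nonzero[OF b[unfolded basis_iff] degree_pos l] by auto
  obtain c where c: "\<forall>i<d. \<forall>j<d. c i j \<in> K" "\<forall>i<d. x * b i = (\<Sum>j<d. c i j * b j)"
    using mult_coords[OF b x(1)] by blast
  have "Tr x = (\<Sum>i<d. c i i)" by (rule trace_eq[OF b x(1)]) (use c in auto)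
  then have "Tr x \<noteq> 0" using x(2)[rule_format, of c] c by auto
  then show ?thesis using x by blast
qed

lemma trace_nondegenerate:
  assumes "separable_ext K L" "z \<in> L" "z \<noteq> 0"
  shows "\<exists>w\<in>L. Tr (z * w) \<noteq> 0"
proof -
  obtain x where "x \<in> L" "Tr x \<noteq> 0" using trace_not_zero[OF assms(1)] by blast
  then show ?thesis using assms subfield_set_divide[OF L, of x z] by (intro bexI[of _ "x / z"]) auto
qed

end

section \<open>Dedekind domains\<close>

definition ideal_set :: "'a::field set \<Rightarrow> 'a set \<Rightarrow> bool" where
  "ideal_set A I \<longleftrightarrow> submod A I \<and> I \<subseteq> A"

definition prime_set :: "'a::field set \<Rightarrow> 'a set \<Rightarrow> bool" where
  "prime_set A p \<longleftrightarrow> ideal_set A p \<and> 1 \<notin> p \<and> (\<forall>a\<in>A. \<forall>b\<in>A. a * b \<in> p \<longrightarrow> a \<in> p \<or> b \<in> p)"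

lemma ideal_plus_principal:
  assumes A: "subring_set A" and J: "ideal_set A J" and a: "a \<in> A"
  shows "ideal_set A {j + a * x | j x. j \<in> J \<and> x \<in> A}" (is "ideal_set A ?S")
  unfolding ideal_set_def submod_def
proof (intro conjI ballI subsetI)
  have J': "submod A J" "J \<subseteq> A" using J unfolding ideal_set_def by blast+
  show "0 \<in> ?S" using submod_0[OF J'(1)] subring_set_0[OF A] by (auto intro!: exI[of _ 0])
  fix s t assume "s \<in> ?S" "t \<in> ?S"
  then obtain j x j' x' where s: "s = j + a * x" "t = j' + a * x'" "j \<in> J" "j' \<in> J" "x \<in> A" "x' \<in> A" by blast
  then have "s + t = (j + j') + a * (x + x')" by (simp add: algebra_simps)
  then show "s + t \<in> ?S" using s submod_add[OF J'(1)] subring_set_add[OF A] by blast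
next
  have J': "submod A J" "J \<subseteq> A" using J unfolding ideal_set_def by blast+
  fix b s assume b: "b \<in> A" and "s \<in> ?S"
  then obtain j x where s: "s = j + a * x" "j \<in> J" "x \<in> A" by blast
  then have "b * s = b * j + a * (b * x)" by (simp add: algebra_simps)
  then show "b * s \<in> ?S" using s b submod_smult[OF J'(1)] subring_set_mult[OF A] by blast
next
  have J': "submod A J" "J \<subseteq> A" using J unfolding ideal_set_def by blast+
  fix s assume "s \<in> ?S"
  then show "s \<in> A" using J' a subring_set_add[OF A] subring_set_mult[OF A] by blast
qed

lemma ideal_plus_principal_mem:
  assumes A: "subring_set A" and J: "ideal_set A J"
  shows "J \<subseteq> {j + a * x | j x. j \<in> J \<and> x \<in> A}" "a \<in> {j + a * x | j x. j \<in> J \<and> x \<in> A}"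
proof -
  have "j = j + a * 0 \<and> 0 \<in> A" for j using subring_set_0[OF A] by simp
  then show "J \<subseteq> {j + a * x | j x. j \<in> J \<and> x \<in> A}" by blast
  have "a = 0 + a * 1 \<and> 0 \<in> J \<and> 1 \<in> A"
    using J subring_set_1[OF A] unfolding ideal_set_def submod_def by simp
  then show "a \<in> {j + a * x | j x. j \<in> J \<and> x \<in> A}" by blast
qed

text \<open>Noetherianity is stated as the maximal condition on nonempty families of ideals, the
  form in which stationary chains, maximal ideals and maximal colon ideals are all obtained
  directly.\<close>

locale dedekind_set =
  fixes A K :: "'a::field set"
  assumes A: "subring_set A"
    and K_eq: "K = {a / b | a b. a \<in> A \<and> b \<in> A \<and> b \<noteq> 0}"
    and int_closed: "\<And>x. x \<in> K \<Longrightarrow> integral_over A x \<Longrightarrow> x \<in> A"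
    and noeth: "\<And>F. F \<noteq> {} \<Longrightarrow> (\<And>I. I \<in> F \<Longrightarrow> ideal_set A I) \<Longrightarrow> \<exists>I\<in>F. \<forall>J\<in>F. I \<subseteq> J \<longrightarrow> J = I"
    and prime_max: "\<And>p. prime_set A p \<Longrightarrow> p \<noteq> {0} \<Longrightarrow> field_mod A p"
begin

lemma K_I: "a \<in> A \<Longrightarrow> b \<in> A \<Longrightarrow> b \<noteq> 0 \<Longrightarrow> a / b \<in> K"
  unfolding K_eq by blast

lemma K_E:
  assumes "x \<in> K"
  obtains a b where "a \<in> A" "b \<in> A" "b \<noteq> 0" "x = a / b"
  using assms unfolding K_eq by blast

lemma A_K: "A \<subseteq> K"
  using K_I[of _ 1] subring_set_1[OF A] by auto

lemma K_subfield: "subfield_set K"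
proof -
  note ring = subring_set_diff[OF A] subring_set_mult[OF A]
  have "1 \<in> K" using A_K subring_set_1[OF A] by blast
  moreover have "x - y \<in> K \<and> x * y \<in> K" if "x \<in> K" "y \<in> K" for x y
  proof -
    obtain a b where x: "a \<in> A" "b \<in> A" "b \<noteq> 0" "x = a / b" using \<open>x \<in> K\<close> by (rule K_E)
    obtain c e where y: "c \<in> A" "e \<in> A" "e \<noteq> 0" "y = c / e" using \<open>y \<in> K\<close> by (rule K_E)
    have "x - y = (a * e - c * b) / (b * e)" "x * y = (a * c) / (b * e)"
      using x y by (simp_all add: field_simps)
    then show ?thesis using x y ring K_I by simp
  qed
  moreover have "inverse x \<in> K" if "x \<in> K" for x
  proof -
    obtain a b where x: "a \<in> A" "b \<in> A" "b \<noteq> 0" "x = a / b" using \<open>x \<in> K\<close> by (rule K_E)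
    show ?thesis
    proof (cases "a = 0")
      case True
      then show ?thesis using x A_K subring_set_0[OF A] by auto
    next
      case False
      then show ?thesis using x K_I[of b a] by simp
    qed
  qed
  ultimately show ?thesis unfolding subfield_set_def subring_set_def by blast
qed

lemma K_ring: "subring_set K"
  using K_subfield unfolding subfield_set_def by blast

lemma common_denominator:
  assumes "finite I" "\<And>i. i \<in> I \<Longrightarrow> c i \<in> K"
  shows "\<exists>h\<in>A. h \<noteq> 0 \<and> (\<forall>i\<in>I. h * c i \<in> A)"
  using assms
proof (induction I rule: finite_induct)
  case empty
  then show ?case using subring_set_1[OF A] by (intro bexI[of _ 1]) auto
next
  case (insert k I)
  then obtain h where h: "h \<in> A" "h \<noteq> 0" "\<forall>i\<in>I. h * c i \<in> A" by auto
  obtain a b where ab: "a \<in> A" "b \<in> A" "b \<noteq> 0" "c k = a / b" using insert.prems[of k] K_E by blast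
  show ?case
  proof (intro bexI[of _ "h * b"] conjI ballI)
    fix i assume "i \<in> insert k I"
    then show "h * b * c i \<in> A"
    proof
      assume "i = k"
      then show ?thesis using h ab subring_set_mult[OF A] by simp
    next
      assume "i \<in> I"
      then have "b * (h * c i) \<in> A" using h ab subring_set_mult[OF A] by blast
      then show ?thesis by (simp add: algebra_simps)
    qed
  qed (use h ab subring_set_mult[OF A] in auto)
qed

lemma ideal_set_lincombs:
  assumes "\<And>i. i \<in> I \<Longrightarrow> g i \<in> A"
  shows "ideal_set A {\<Sum>i\<in>I. c i * g i | c. \<forall>i\<in>I. c i \<in> A}"
  unfolding ideal_set_def using submod_lincombs[OF A] assms
  by (auto intro!: subring_set_sum[OF A] subring_set_mult[OF A])

text \<open>Almost integral elements are integral: the ideals generated by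
  \<open>c, t c, ..., t ^ k c\<close> become stationary, and cancelling \<open>c\<close> leaves an
  integral equation for \<open>t\<close>. This stands in for a valuation: every argument that plays
  powers of \<open>t\<close> against \<open>t \<notin> A\<close> ends here.\<close>

lemma bounded_powers_integral:
  assumes t: "t \<in> K" and c: "c \<noteq> 0" and pw: "\<And>k. t ^ k * c \<in> A"
  shows "t \<in> A"
proof -
  define J where "J k = {\<Sum>i\<in>{..<Suc k}. a i * (t ^ i * c) | a. \<forall>i\<in>{..<Suc k}. a i \<in> A}" for k
  have J: "ideal_set A (J k)" for k
    unfolding J_def by (rule ideal_set_lincombs) (use pw in auto)
  have "\<exists>I\<in>range J. \<forall>J'\<in>range J. I \<subseteq> J' \<longrightarrow> J' = I" by (rule noeth) (use J in auto)
  then obtain k where k: "\<And>m. J k \<subseteq> J m \<Longrightarrow> J m = J k" by auto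
  have "J k \<subseteq> J (Suc k)"
  proof
    fix s assume "s \<in> J k"
    then obtain a where a: "\<forall>i\<in>{..<Suc k}. a i \<in> A" "s = (\<Sum>i\<in>{..<Suc k}. a i * (t ^ i * c))" unfolding J_def by blast
    show "s \<in> J (Suc k)"
      unfolding J_def mem_Collect_eq
      by (rule exI[of _ "a(Suc k := 0)"]) (use a subring_set_0[OF A] in auto)
  qed
  then have "J (Suc k) = J k" by (rule k)
  moreover have "t ^ Suc k * c \<in> J (Suc k)"
    unfolding J_def mem_Collect_eq
    by (rule exI[of _ "\<lambda>i. if i = Suc k then 1 else 0"])
      (use subring_set_0[OF A] subring_set_1[OF A] in \<open>auto simp: if_distrib[of "\<lambda>x. x * _"] cong: if_cong\<close>)
  ultimately obtain a where a: "\<forall>i\<in>{..<Suc k}. a i \<in> A" "t ^ Suc k * c = (\<Sum>i\<in>{..<Suc k}. a i * (t ^ i * c))"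
    unfolding J_def by blast
  then have "t ^ Suc k * c = (\<Sum>i\<in>{..<Suc k}. a i * t ^ i) * c" by (simp only: sum_distrib_right mult.assoc)
  then have eq: "t ^ Suc k = (\<Sum>i\<in>{..<Suc k}. a i * t ^ i)" using c by (simp only: mult_cancel_right) simp
  have "integral_over A t"
  proof (rule integral_if_finite_module[OF A, of "{..<Suc k}" 0 "\<lambda>i. t ^ i"])
    fix i assume i: "i \<in> {..<Suc k}"
    show "\<exists>c. (\<forall>j\<in>{..<Suc k}. c j \<in> A) \<and> t * t ^ i = (\<Sum>j<Suc k. c j * t ^ j)"
    proof (cases "i = k")
      case True
      then show ?thesis using a eq by (intro exI[of _ a]) auto
    next
      case False
      then have "Suc i < Suc k" using i by simp
      then show ?thesis using subring_set_0[OF A] subring_set_1[OF A]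
        by (intro exI[of _ "\<lambda>j. if j = Suc i then 1 else 0"])
          (auto simp: if_distrib[of "\<lambda>x. x * _"] cong: if_cong)
    qed
  qed auto
  then show ?thesis using int_closed t by blast
qed

lemma prime_above:
  assumes I: "ideal_set A I" "1 \<notin> I"
  shows "\<exists>p. prime_set A p \<and> I \<subseteq> p"
proof -
  have "\<exists>J\<in>{J. ideal_set A J \<and> I \<subseteq> J \<and> 1 \<notin> J}. \<forall>J'\<in>{J. ideal_set A J \<and> I \<subseteq> J \<and> 1 \<notin> J}. J \<subseteq> J' \<longrightarrow> J' = J"
    by (rule noeth) (use I in auto)
  then obtain J where J: "ideal_set A J" "I \<subseteq> J" "1 \<notin> J"
    and max: "\<And>J'. ideal_set A J' \<Longrightarrow> J \<subseteq> J' \<Longrightarrow> 1 \<notin> J' \<Longrightarrow> J' = J" by auto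
  have J': "submod A J" "J \<subseteq> A" using J unfolding ideal_set_def by blast+
  have "b \<in> J" if ab: "a \<in> A" "b \<in> A" "a * b \<in> J" "a \<notin> J" for a b
  proof -
    let ?S = "{j + a * x | j x. j \<in> J \<and> x \<in> A}"
    have S: "ideal_set A ?S" by (rule ideal_plus_principal[OF A J(1) ab(1)])
    have "J \<subseteq> ?S" "a \<in> ?S" by (rule ideal_plus_principal_mem[OF A J(1)])+
    then have "1 \<in> ?S" using max[OF S] ab(4) by blast
    then obtain j x where jx: "1 = j + a * x" "j \<in> J" "x \<in> A" by blast
    have "b * j + x * (a * b) \<in> J"
      by (rule submod_add[OF J'(1) submod_smult[OF J'(1) ab(2) jx(2)] submod_smult[OF J'(1) jx(3) ab(3)]])
    also have "b * j + x * (a * b) = b * (j + a * x)" by (simp add: algebra_simps)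
    finally show ?thesis using jx(1) by simp
  qed
  then show ?thesis using J unfolding prime_set_def by blast
qed

text \<open>A maximal ideal among the \<open>{x. x * b \<in> (a)}\<close> contained in \<open>p\<close> is a prime, hence equals \<open>p\<close>;
  the quotient \<open>b / a\<close> then lies in the inverse of \<open>p\<close> but not in \<open>A\<close>.\<close>

lemma uniformizer_exists:
  assumes p: "prime_set A p" "p \<noteq> {0}"
  shows "\<exists>t\<in>K. t \<notin> A \<and> (\<forall>a\<in>p. t * a \<in> A)"
proof -
  have pI: "submod A p" "p \<subseteq> A" "1 \<notin> p" using p unfolding prime_set_def ideal_set_def by blast+
  have pp: "a \<in> p \<or> b \<in> p" if "a \<in> A" "b \<in> A" "a * b \<in> p" for a b using that p unfolding prime_set_def by blast
  obtain a where a: "a \<in> p" "a \<noteq> 0" using p(2) submod_0[OF pI(1)] by blast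
  then have aA: "a \<in> A" using pI by blast
  define Ia where "Ia = {a * x | x. x \<in> A}"
  have IaI: "a * x \<in> Ia" if "x \<in> A" for x using that unfolding Ia_def by blast
  have Ia: "submod A Ia"
    unfolding submod_def
  proof (intro conjI ballI)
    show "0 \<in> Ia" using IaI[OF subring_set_0[OF A]] by simp
  next
    fix x y assume "x \<in> Ia" "y \<in> Ia"
    then obtain x' y' where "x = a * x'" "y = a * y'" "x' \<in> A" "y' \<in> A" unfolding Ia_def by blast
    then show "x + y \<in> Ia" using IaI[OF subring_set_add[OF A, of x' y']] by (simp add: distrib_left)
  next
    fix b x assume "b \<in> A" "x \<in> Ia"
    then obtain x' where "x = a * x'" "x' \<in> A" unfolding Ia_def by blast
    then show "b * x \<in> Ia" using IaI[OF subring_set_mult[OF A, of b x']] \<open>b \<in> A\<close> by (simp add: algebra_simps)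
  qed
  define q where "q b = {x \<in> A. x * b \<in> Ia}" for b
  have qI: "ideal_set A (q b)" if "b \<in> A" for b
    unfolding ideal_set_def submod_def q_def
    using subring_set_0[OF A] subring_set_add[OF A] subring_set_mult[OF A] submod_0[OF Ia] submod_add[OF Ia] submod_smult[OF Ia]
    by (auto simp: distrib_right mult.assoc)
  let ?F = "{q b | b. b \<in> A \<and> q b \<subseteq> p}"
  have "Ia \<subseteq> p" unfolding Ia_def using a submod_smult_right[OF pI(1)] by blast
  then have "q 1 \<subseteq> p" unfolding q_def by auto
  then have "q 1 \<in> ?F" using subring_set_1[OF A] by blast
  then have "\<exists>I\<in>?F. \<forall>J\<in>?F. I \<subseteq> J \<longrightarrow> J = I" by (intro noeth) (use qI in auto)
  then obtain I where I: "I \<in> ?F" "\<forall>J\<in>?F. I \<subseteq> J \<longrightarrow> J = I" by (elim bexE)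
  then obtain b where b: "b \<in> A" "q b \<subseteq> p" "I = q b" by blast
  have max: "q c = q b" if "c \<in> A" "q c \<subseteq> p" "q b \<subseteq> q c" for c
  proof -
    have "q c \<in> ?F" using that by blast
    then show ?thesis using I(2) b(3) that(3) by blast
  qed
  have mono: "q b \<subseteq> q (x * b)" if "x \<in> A" for x
  proof
    fix y assume "y \<in> q b"
    then have "y \<in> A" "x * (y * b) \<in> Ia" using submod_smult[OF Ia that] unfolding q_def by blast+
    then show "y \<in> q (x * b)" unfolding q_def by (simp add: mult.left_commute)
  qed
  have prime: "x \<in> q b \<or> y \<in> q b" if xy: "x \<in> A" "y \<in> A" "x * y \<in> q b" for x y
  proof (cases "q (x * b) \<subseteq> p")
    case True
    have "q (x * b) = q b" using max[OF subring_set_mult[OF A xy(1) b(1)] True mono[OF xy(1)]] .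
    moreover have "y \<in> q (x * b)" using xy unfolding q_def by (auto simp: algebra_simps)
    ultimately show ?thesis by blast
  next
    case False
    \<comment> \<open>Some \<open>s\<close> outside \<open>p\<close> annihilates \<open>x b\<close>
      modulo \<open>a\<close>. Since \<open>p\<close> is prime, \<open>q (s * b)\<close> still lies
      in \<open>p\<close>, so by maximality it equals \<open>q b\<close>; and it contains
      \<open>x\<close>.\<close>
    then obtain s where s: "s \<in> A" "s * (x * b) \<in> Ia" "s \<notin> p" unfolding q_def by blast
    have "q (s * b) \<subseteq> p"
    proof
      fix r assume r: "r \<in> q (s * b)"
      then have "r * s \<in> q b" unfolding q_def using s subring_set_mult[OF A] by (auto simp: algebra_simps)
      then have "r * s \<in> p" using b by blast
      then show "r \<in> p" using pp[of r s] r s unfolding q_def by blast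
    qed
    then have "q (s * b) = q b" using max[OF subring_set_mult[OF A s(1) b(1)] _ mono[OF s(1)]] by blast
    moreover have "x \<in> q (s * b)" using xy s unfolding q_def by (auto simp: algebra_simps)
    ultimately show ?thesis by blast
  qed
  have "prime_set A (q b)" using qI[OF b(1)] b(2) pI(3) prime unfolding prime_set_def by blast
  moreover have "a \<in> q b" unfolding q_def using aA b IaI by blast
  ultimately have fm: "field_mod A (q b)" using prime_max a(2) by blast
  have "p \<subseteq> q b"
  proof (rule ccontr)
    assume "\<not> p \<subseteq> q b"
    then obtain x where x: "x \<in> p" "x \<notin> q b" by blast
    then obtain x' where x': "x' \<in> A" "x * x' - 1 \<in> q b" using fm pI unfolding field_mod_def by blast
    have "x * x' - (x * x' - 1) \<in> p"
      by (rule submod_diff[OF A pI(1) submod_smult_right[OF pI(1) x'(1) x(1)] subsetD[OF b(2) x'(2)]])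
    then show False using pI(3) by simp
  qed
  show ?thesis
  proof (intro bexI[of _ "b / a"] conjI ballI)
    show "b / a \<notin> A"
    proof
      assume "b / a \<in> A"
      then have "1 \<in> q b" unfolding q_def using IaI[of "b / a"] a subring_set_1[OF A] by simp
      then show False using b(2) pI(3) by blast
    qed
    fix x assume "x \<in> p"
    then have "x * b \<in> Ia" using \<open>p \<subseteq> q b\<close> unfolding q_def by blast
    then show "b / a * x \<in> A" unfolding Ia_def using a by (auto simp: algebra_simps)
  qed (use b a aA K_I in auto)
qed

end

text \<open>The fractional ideal \<open>A + t A\<close> is the inverse of \<open>p\<close>, as witnessed by \<open>u + t v = 1\<close>.\<close>

locale dedekind_prime = dedekind_set +
  fixes p :: "'a::field set" and t u v :: 'a
  assumes p_prime_set: "prime_set A p" and p_field: "field_mod A p"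
    and t: "t \<in> K" "t \<notin> A" and tp: "\<And>a. a \<in> p \<Longrightarrow> t * a \<in> A"
    and u: "u \<in> p" and v: "v \<in> p" and uv: "u + t * v = 1"
begin

lemma p_submod: "submod A p" and p_subset: "p \<subseteq> A" and one_notin_p: "1 \<notin> p"
  using p_field unfolding field_mod_def by blast+

lemma prime_p: "a \<in> A \<Longrightarrow> b \<in> A \<Longrightarrow> a * b \<in> p \<Longrightarrow> a \<in> p \<or> b \<in> p"
  using p_prime_set unfolding prime_set_def by blast

text \<open>Multiply \<open>u + t v = 1\<close> by \<open>a\<close>. Together with \<open>tp\<close>
  this gives \<open>p = {a \<in> A. t * a \<in> A}\<close>, the case \<open>M = A\<close> of the
  description of \<open>p M\<close>.\<close>

lemma mem_p: "a \<in> A \<Longrightarrow> t * a \<in> A \<Longrightarrow> a \<in> p"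
proof -
  assume a: "a \<in> A" "t * a \<in> A"
  have "a * u + t * a * v \<in> p"
    using a u v submod_add[OF p_submod] submod_smult[OF p_submod] by blast
  moreover have "a * u + t * a * v = a * (u + t * v)" by (simp add: algebra_simps)
  ultimately show ?thesis using uv by simp
qed

text \<open>Makes a vector primitive at \<open>p\<close> without localizing: clear denominators by
  \<open>h\<close>, then multiply by \<open>t\<close> as long as all entries stay in
  \<open>A\<close>. The process stops because \<open>t\<close> is not integral, and when it stops
  some entry is outside \<open>p\<close>, since \<open>t\<close> maps \<open>p\<close> into
  \<open>A\<close>.\<close>

lemma scale_primitive:
  assumes I: "finite I" and c: "\<And>i. i \<in> I \<Longrightarrow> c i \<in> K" and k: "k \<in> I" "c k \<noteq> 0"
  shows "\<exists>a\<in>K. (\<forall>i\<in>I. a * c i \<in> A) \<and> (\<exists>i\<in>I. a * c i \<notin> p)"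
proof -
  obtain h where h: "h \<in> A" "h \<noteq> 0" "\<forall>i\<in>I. h * c i \<in> A" using common_denominator[OF I, of c] c by blast
  define Q where "Q n \<longleftrightarrow> (\<forall>i\<in>I. t ^ n * (h * c i) \<in> A)" for n
  have "\<exists>n. \<not> Q n"
  proof (rule ccontr)
    assume "\<nexists>n. \<not> Q n"
    then have "t ^ n * (h * c k) \<in> A" for n using k unfolding Q_def by blast
    then have "t \<in> A" using bounded_powers_integral[OF t(1), of "h * c k"] h k by auto
    then show False using t by blast
  qed
  then obtain n where n: "\<not> Q n" "\<And>m. m < n \<Longrightarrow> Q m"
    using LeastI_ex[of "\<lambda>n. \<not> Q n"] not_less_Least[of _ "\<lambda>n. \<not> Q n"] by blast
  have "Q 0" using h unfolding Q_def by simp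
  then obtain m where m: "n = Suc m" using n by (cases n) auto
  then have Qm: "Q m" using n by simp
  obtain i where i: "i \<in> I" "t ^ Suc m * (h * c i) \<notin> A" using n m unfolding Q_def by blast
  have "t ^ m * (h * c i) \<notin> p" using tp[of "t ^ m * (h * c i)"] i by (auto simp: algebra_simps)
  moreover have "t ^ m * h \<in> K" using t h A_K subring_set_mult[OF K_ring] subring_set_power[OF K_ring] by blast
  ultimately show ?thesis
    using Qm i unfolding Q_def by (intro bexI[of _ "t ^ m * h"]) (auto simp: mult.assoc)
qed

end

text \<open>If \<open>t p \<subseteq> p\<close> held, all \<open>t ^ k * c\<close> with
  \<open>c \<in> p\<close> would stay in \<open>A\<close> and \<open>t\<close> would be integral. So
  some \<open>t a\<close> is a unit modulo \<open>p\<close>, and its inverse \<open>s\<close> yields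
  \<open>u\<close> and \<open>v\<close>.\<close>

lemma (in dedekind_set) dedekind_prime_exists:
  assumes p: "prime_set A p" "p \<noteq> {0}"
  shows "\<exists>t u v. dedekind_prime A K p t u v"
proof -
  have fm: "field_mod A p" by (rule prime_max[OF p])
  then have pI: "submod A p" "p \<subseteq> A" "1 \<notin> p" unfolding field_mod_def by blast+
  obtain t where t: "t \<in> K" "t \<notin> A" "\<forall>a\<in>p. t * a \<in> A" using uniformizer_exists[OF p] by blast
  obtain c where c: "c \<in> p" "c \<noteq> 0" using p(2) submod_0[OF pI(1)] by blast
  have "\<exists>a\<in>p. t * a \<notin> p"
  proof (rule ccontr)
    assume "\<not> (\<exists>a\<in>p. t * a \<notin> p)"
    then have step: "t * a \<in> p" if "a \<in> p" for a using that by blast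
    have "t ^ k * c \<in> p" for k
    proof (induction k)
      case 0 then show ?case using c by simp
    next
      case (Suc k) then show ?case using step[of "t ^ k * c"] by (simp add: mult.assoc)
    qed
    then have "t \<in> A" using bounded_powers_integral[OF t(1) c(2)] pI(2) by blast
    then show False using t by blast
  qed
  then obtain a where a: "a \<in> p" "t * a \<notin> p" by blast
  then obtain s where s: "s \<in> A" "t * a * s - 1 \<in> p" using fm t unfolding field_mod_def by blast
  have "dedekind_prime A K p t (- (t * a * s - 1)) (a * s)"
  proof unfold_locales
    show "- (t * a * s - 1) \<in> p" using s submod_uminus[OF A pI(1)] by blast
    show "a * s \<in> p" using a s submod_smult_right[OF pI(1)] by blast
  qed (use p fm t in \<open>auto simp: algebra_simps\<close>)
  then show ?thesis by blast
qed

section \<open>Lattices at a prime\<close>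

text \<open>A full \<open>A\<close>-lattice \<open>M\<close> in \<open>L\<close>; since the inverse of \<open>p\<close> is \<open>A + t A\<close>, the submodule \<open>p M\<close>
  is the set of all \<open>x \<in> M\<close> with \<open>t x \<in> M\<close>.\<close>

locale lattice_at_prime = dedekind_prime A K p t u v + field_ext K L d
  for A K p L M :: "'a::field set" and t u v :: 'a and d :: nat +
  assumes M: "submod A M" and M_sub: "M \<subseteq> L"
    and M_full: "\<And>y. y \<in> L \<Longrightarrow> \<exists>a\<in>A. a \<noteq> 0 \<and> a * y \<in> M"
    and M_bounded: "\<exists>h b. h \<in> A \<and> h \<noteq> 0 \<and> is_basis_over K L b d \<and>
      (\<forall>x\<in>M. \<exists>c. (\<forall>i<d. c i \<in> A) \<and> h * x = (\<Sum>i<d. c i * b i))"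
begin

definition pM :: "'a set" where "pM = {x \<in> M. t * x \<in> M}"

lemma p_times_M: "a \<in> p \<Longrightarrow> x \<in> M \<Longrightarrow> a * x \<in> pM"
  unfolding pM_def using submod_smult[OF M, of a x] submod_smult[OF M tp, of a x] p_subset
  by (auto simp: mult.assoc)

lemma pM_submod: "submod A pM"
  unfolding submod_def pM_def
proof (intro conjI ballI CollectI)
  fix a x assume a: "a \<in> A" and x: "x \<in> {x \<in> M. t * x \<in> M}"
  then show "a * x \<in> M" using submod_smult[OF M] by blast
  have "a * (t * x) \<in> M" using a x submod_smult[OF M] by blast
  then show "t * (a * x) \<in> M" by (simp add: mult.left_commute)
qed (use submod_0[OF M] submod_add[OF M] in \<open>auto simp: distrib_left\<close>)

sublocale R: linmod A p M pM
  using A p_field M pM_submod p_times_M by unfold_locales (auto simp: pM_def)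

lemma A_in_K: "a \<in> A \<Longrightarrow> a \<in> K"
  using A_K by blast

text \<open>A nontrivial relation over \<open>K\<close>, rescaled to be primitive at
  \<open>p\<close>, is a relation over \<open>A\<close> that does not vanish modulo
  \<open>p\<close>.\<close>

lemma indep_over_K:
  assumes y: "R.indep r y"
  shows "V.indep r y"
  unfolding V.indep_def
proof (intro allI impI)
  fix c k assume c: "(\<forall>i<r. c i \<in> K) \<and> (\<Sum>i<r. c i * y i) \<in> {0}" and k: "k < r"
  show "c k \<in> {0}"
  proof (rule ccontr)
    assume "c k \<notin> {0}"
    then obtain a where a: "\<forall>i\<in>{..<r}. a * c i \<in> A" "\<exists>i\<in>{..<r}. a * c i \<notin> p"
      using scale_primitive[of "{..<r}" c k] c k by auto
    have "(\<Sum>i<r. (a * c i) * y i) = a * (\<Sum>i<r. c i * y i)" by (simp add: sum_distrib_left mult.assoc)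
    then have "(\<Sum>i<r. (a * c i) * y i) \<in> pM" using c submod_0[OF pM_submod] by simp
    then show False using R.indepD[OF y, of "\<lambda>i. a * c i"] a by auto
  qed
qed

lemma indep_le_degree:
  assumes "R.indep r y" "\<forall>i<r. y i \<in> M"
  shows "r \<le> d"
proof -
  obtain b where "is_basis_over K L b d" using basis_exists by blast
  then show ?thesis
    using V.indep_le_spans[of d b r y] indep_over_K[OF assms(1)] assms(2) M_sub
    unfolding basis_iff V.residue_basis_iff by blast
qed

lemma indep_imp_basis:
  assumes w: "\<And>i. i < d \<Longrightarrow> w i \<in> M" "R.indep d w"
  shows "is_basis_over K L w d"
proof -
  obtain b where "is_basis_over K L b d" using basis_exists by blast
  then show ?thesis
    using V.indep_card_basis[of b d w] indep_over_K[OF w(2)] w(1) M_sub unfolding basis_iff by blast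
qed

text \<open>The coordinates lie in the localization at \<open>p\<close>, expressed by a denominator
  \<open>s\<close> outside \<open>p\<close>. An entry 1 is appended before rescaling, so that the
  scaling factor \<open>a\<close> is itself one of the entries. If \<open>a\<close> were in
  \<open>p\<close>, then \<open>a x\<close> would be zero in \<open>M / pM\<close>, forcing all
  entries into \<open>p\<close>.\<close>

lemma coords_p_integral:
  assumes w: "\<And>i. i < d \<Longrightarrow> w i \<in> M" "R.indep d w" and x: "x \<in> M"
    and c: "\<And>i. i < d \<Longrightarrow> c i \<in> K" "x = (\<Sum>i<d. c i * w i)"
  shows "\<exists>s\<in>A. s \<notin> p \<and> (\<forall>i<d. s * c i \<in> A)"
proof -
  define c' where "c' i = (if i < d then c i else 1)" for i
  obtain a where a: "\<forall>i\<in>{..<Suc d}. a * c' i \<in> A" "\<exists>i\<in>{..<Suc d}. a * c' i \<notin> p"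
  proof -
    have "\<exists>a\<in>K. (\<forall>i\<in>{..<Suc d}. a * c' i \<in> A) \<and> (\<exists>i\<in>{..<Suc d}. a * c' i \<notin> p)"
      by (rule scale_primitive[of _ _ d]) (use c subring_set_1[OF K_ring] in \<open>auto simp: c'_def\<close>)
    then show ?thesis using that by blast
  qed
  have aA: "a \<in> A" using bspec[OF a(1), of d] by (simp add: c'_def)
  have acA: "a * c i \<in> A" if "i < d" for i using bspec[OF a(1), of i] that by (simp add: c'_def)
  have "a \<notin> p"
  proof
    assume ap: "a \<in> p"
    have "(\<Sum>i<d. (a * c i) * w i) = a * x" using c by (simp add: sum_distrib_left mult.assoc)
    then have "(\<Sum>i<d. (a * c i) * w i) \<in> pM" using p_times_M[OF ap x] by simp
    then have "a * c i \<in> p" if "i < d" for i using R.indepD[OF w(2), of "\<lambda>i. a * c i"] acA that by blast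
    then show False using a(2) ap by (auto simp: c'_def split: if_splits)
  qed
  then show ?thesis using aA acA by blast
qed

lemma common_unit:
  fixes n :: nat
  assumes "\<And>i. i < n \<Longrightarrow> \<exists>s\<in>A. s \<notin> p \<and> (\<forall>x\<in>X i. s * x \<in> A)"
  shows "\<exists>s\<in>A. s \<notin> p \<and> (\<forall>i<n. \<forall>x\<in>X i. s * x \<in> A)"
  using assms
proof (induction n)
  case 0
  then show ?case using subring_set_1[OF A] one_notin_p by blast
next
  case (Suc n)
  obtain s where s: "s \<in> A" "s \<notin> p" "\<forall>i<n. \<forall>x\<in>X i. s * x \<in> A" using Suc by fastforce
  obtain r where r: "r \<in> A" "r \<notin> p" "\<forall>x\<in>X n. r * x \<in> A" using Suc.prems[of n] by blast
  show ?case
  proof (intro bexI[of _ "s * r"] conjI allI impI ballI)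
    show "s * r \<notin> p" using prime_p s r by blast
    fix i x assume i: "i < Suc n" and x: "x \<in> X i"
    show "s * r * x \<in> A"
    proof (cases "i = n")
      case True
      then have "s * (r * x) \<in> A" using r x s subring_set_mult[OF A] by blast
      then show ?thesis by (simp add: mult.assoc)
    next
      case False
      then have "i < n" using i by simp
      then have "r * (s * x) \<in> A" using r x s subring_set_mult[OF A] by blast
      then show ?thesis by (simp add: algebra_simps)
    qed
  qed (use s r subring_set_mult[OF A] in blast)
qed

text \<open>The denominator \<open>s\<close> appears because \<open>Tr x \<in> A\<close> is not yet
  available; it is later derived from this lemma. After multiplication by \<open>s\<close>, the
  exact matrix \<open>k\<close> and the matrix \<open>c\<close> modulo \<open>pM\<close> can be
  compared by independence.\<close>

lemma trace_mod_p_local: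
  assumes w: "\<And>i. i < d \<Longrightarrow> w i \<in> M" "R.indep d w" and x: "x \<in> L" "\<And>y. y \<in> M \<Longrightarrow> x * y \<in> M"
    and c: "\<And>i j. i < d \<Longrightarrow> j < d \<Longrightarrow> c i j \<in> A" "\<And>i. i < d \<Longrightarrow> x * w i - (\<Sum>j<d. c i j * w j) \<in> pM"
  shows "\<exists>s\<in>A. s \<notin> p \<and> s * (Tr x - (\<Sum>i<d. c i i)) \<in> p"
proof -
  have bas: "is_basis_over K L w d" by (rule indep_imp_basis[OF w])
  obtain k where k: "\<forall>i<d. \<forall>j<d. k i j \<in> K" "\<forall>i<d. x * w i = (\<Sum>j<d. k i j * w j)"
    using mult_coords[OF bas x(1)] by blast
  have tr: "Tr x = (\<Sum>i<d. k i i)" by (rule trace_eq[OF bas x(1)]) (use k in auto)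
  have "\<exists>s\<in>A. s \<notin> p \<and> (\<forall>y\<in>{k i j | j. j < d}. s * y \<in> A)" if "i < d" for i
  proof -
    obtain s where "s \<in> A" "s \<notin> p" "\<forall>j<d. s * k i j \<in> A"
      using coords_p_integral[OF w x(2)[OF w(1)[OF \<open>i < d\<close>]], of "k i"] k \<open>i < d\<close> by auto
    then show ?thesis by blast
  qed
  then have "\<exists>s\<in>A. s \<notin> p \<and> (\<forall>i<d. \<forall>y\<in>{k i j | j. j < d}. s * y \<in> A)"
    by (rule common_unit)
  then obtain s where s: "s \<in> A" "s \<notin> p" "\<forall>i<d. \<forall>y\<in>{k i j | j. j < d}. s * y \<in> A"
    by (elim bexE conjE)
  have sk: "s * k i j \<in> A" if "i < d" "j < d" for i j using s(3) that by blast
  have "s * k i j - s * c i j \<in> p" if ij: "i < d" "j < d" for i j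
  proof -
    have "s * (x * w i - (\<Sum>j<d. c i j * w j)) \<in> pM" by (rule submod_smult[OF pM_submod s(1) c(2)[OF ij(1)]])
    also have "s * (x * w i - (\<Sum>j<d. c i j * w j)) = (\<Sum>j<d. (s * k i j - s * c i j) * w j)"
      using k ij by (simp add: sum_distrib_left sum_subtractf algebra_simps)
    finally show ?thesis
      by (rule R.indepD[OF w(2), rotated])
        (use ij sk subring_set_mult[OF A s(1) c(1)] in \<open>auto intro: subring_set_diff[OF A]\<close>)
  qed
  then have "(\<Sum>i<d. s * k i i - s * c i i) \<in> p" by (intro submod_sum[OF p_submod]) auto
  also have "(\<Sum>i<d. s * k i i - s * c i i) = s * (Tr x - (\<Sum>i<d. c i i))"
    unfolding tr by (simp add: sum_distrib_left sum_subtractf algebra_simps)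
  finally show ?thesis using s by blast
qed

text \<open>If a basis of \<open>M / p M\<close> did not span \<open>L\<close>, some linear form \<open>\<phi>\<close> would vanish on it, whence
  \<open>\<phi> M = \<phi> (p M)\<close> and \<open>t \<phi> M \<subseteq> \<phi> M\<close>; boundedness of \<open>M\<close> would then make \<open>t\<close> integral over \<open>A\<close>.\<close>

lemma residue_basis_size:
  assumes g: "residue_basis A M p pM g m"
  shows "m = d"
proof (rule ccontr)
  assume "m \<noteq> d"
  have gM: "\<And>i. i < m \<Longrightarrow> g i \<in> M" and ind: "R.indep m g" and sp: "R.spans m g"
    using g unfolding R.residue_basis_iff by blast+
  then have "m < d" using indep_le_degree[OF ind] \<open>m \<noteq> d\<close> by simp
  obtain b where b: "is_basis_over K L b d" using basis_exists by blast
  have bound: "n \<le> d" if "\<forall>i<n. z i \<in> L" "V.indep n z" for n z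
    using V.indep_le_spans[of d b n z] b that unfolding basis_iff V.residue_basis_iff by blast
  have "\<exists>w n. m \<le> n \<and> (\<forall>i<m. w i = g i) \<and> residue_basis K L {0} {0} w n"
    by (rule V.extend_to_basis[where D = d]) (use gM M_sub indep_over_K[OF ind] bound in auto)
  then obtain w n where w: "\<forall>i<m. w i = g i" "residue_basis K L {0} {0} w n" by (elim exE conjE)
  then have "n = d" using V.basis_size_unique[of w n b d] b unfolding basis_iff by blast
  then have wb: "is_basis_over K L w d" using w by (simp add: basis_iff)
  \<comment> \<open>The vectors \<open>w 0, ..., w (m - 1)\<close> are the given \<open>g i\<close>,
    so the coordinate with index \<open>m\<close> is the first linear form that vanishes on all of
    them.\<close>
  define phi where "phi y = coords K w d y m" for y
  have phi_lin: "phi (\<Sum>i<k. a i * y i) = (\<Sum>i<k. a i * phi (y i))"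
    if "\<And>i. i < k \<Longrightarrow> a i \<in> K" "\<And>i. i < k \<Longrightarrow> y i \<in> L" for k :: nat and a y
    unfolding phi_def
  proof (rule coords_eq[OF wb, where c = "\<lambda>l. \<Sum>i<k. a i * coords K w d (y i) l"])
    have "(\<Sum>l<d. (\<Sum>i<k. a i * coords K w d (y i) l) * w l) = (\<Sum>i<k. a i * (\<Sum>l<d. coords K w d (y i) l * w l))"
      by (simp add: sum_distrib_left sum_distrib_right mult.assoc) (rule sum.swap)
    then show "(\<Sum>i<k. a i * y i) = (\<Sum>l<d. (\<Sum>i<k. a i * coords K w d (y i) l) * w l)"
      using coords_sum[OF wb] that by simp
  qed (use \<open>m < d\<close> coords_in_K[OF wb] that in \<open>auto intro!: subring_set_sum[OF K_ring] subring_set_mult[OF K_ring]\<close>)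
  have phi1: "phi (a * y) = a * phi y" if "a \<in> K" "y \<in> L" for a y
    using phi_lin[of 1 "\<lambda>_. a" "\<lambda>_. y"] that by simp
  have phi_add: "phi (y + z) = phi y + phi z" if "y \<in> L" "z \<in> L" for y z
    using phi_lin[of 2 "\<lambda>_. 1" "\<lambda>i. if i = 0 then y else z"] that subring_set_1[OF K_ring]
    by (simp add: numeral_2_eq_2)
  have phi_w: "phi (w i) = (if i = m then 1 else 0)" if "i < d" for i
    unfolding phi_def
    by (rule coords_eq[OF wb, where c = "\<lambda>l. if i = l then 1 else 0"])
      (use that \<open>m < d\<close> subring_set_0[OF K_ring] subring_set_1[OF K_ring] in \<open>auto simp: if_distrib[of "\<lambda>x. x * _"] cong: if_cong\<close>)
  have phi_K: "phi y \<in> K" if "y \<in> L" for y unfolding phi_def using coords_in_K[OF wb that \<open>m < d\<close>] .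
  \<comment> \<open>Subtracting from \<open>x\<close> its combination of the \<open>g i\<close> does
    not change \<open>phi\<close> and leaves an element of \<open>pM\<close>, which \<open>t\<close>
    maps into \<open>M\<close>.\<close>
  have step: "\<exists>z\<in>M. phi z = t * phi x" if x: "x \<in> M" for x
  proof -
    obtain c where c: "\<And>i. i < m \<Longrightarrow> c i \<in> A" "x - (\<Sum>i<m. c i * g i) \<in> pM" using R.spansE[OF sp x] by blast
    define z where "z = x - (\<Sum>i<m. c i * g i)"
    have z: "z \<in> M" "t * z \<in> M" using c(2) unfolding z_def pM_def by blast+
    have s: "(\<Sum>i<m. c i * g i) \<in> L" using c(1) gM M_sub submod_lincomb[OF M, of "{..<m}" c g] by auto
    have "phi (\<Sum>i<m. c i * g i) = (\<Sum>i<m. c i * phi (g i))"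
      by (rule phi_lin) (use c(1) gM M_sub A_in_K in auto)
    also have "\<dots> = 0" using phi_w w(1) \<open>m < d\<close> by (intro sum.neutral) (metis lessThan_iff less_irrefl less_trans mult_zero_right)
    finally have "phi (\<Sum>i<m. c i * g i) = 0" .
    moreover have "phi x = phi z + phi (\<Sum>i<m. c i * g i)"
      using phi_add[of z "\<Sum>i<m. c i * g i"] z M_sub s by (auto simp: z_def)
    ultimately have "phi x = phi z" by simp
    then show ?thesis using z phi1[OF t(1), of z] M_sub by (intro bexI[of _ "t * z"]) auto
  qed
  have steps: "\<exists>z\<in>M. phi z = t ^ k * phi x" if "x \<in> M" for k x
  proof (induction k)
    case 0
    then show ?case using that by auto
  next
    case (Suc k)
    then obtain z where "z \<in> M" "phi z = t ^ k * phi x" by blast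
    then show ?case using step[of z] by (auto simp: mult.assoc)
  qed
  obtain h b' where hb: "h \<in> A" "h \<noteq> 0" "is_basis_over K L b' d"
    "\<forall>x\<in>M. \<exists>c. (\<forall>i<d. c i \<in> A) \<and> h * x = (\<Sum>i<d. c i * b' i)" using M_bounded by blast
  obtain e where e: "e \<in> A" "e \<noteq> 0" "\<forall>i\<in>{..<d}. e * phi (b' i) \<in> A"
    using common_denominator[of "{..<d}" "\<lambda>i. phi (b' i)"] phi_K basis_in_L[OF hb(3)] by auto
  have bounded: "e * h * phi x \<in> A" if x: "x \<in> M" for x
  proof -
    obtain c where c: "\<forall>i<d. c i \<in> A" "h * x = (\<Sum>i<d. c i * b' i)" using hb(4) x by blast
    have "h * phi x = phi (h * x)" using phi1[of h x] hb x M_sub A_in_K by auto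
    also have "\<dots> = (\<Sum>i<d. c i * phi (b' i))"
      unfolding c(2) by (rule phi_lin) (use c A_in_K basis_in_L[OF hb(3)] in auto)
    finally have "e * h * phi x = (\<Sum>i<d. c i * (e * phi (b' i)))" by (simp add: sum_distrib_left mult.assoc mult.left_commute)
    also have "\<dots> \<in> A" by (rule submod_lincomb[OF submod_self[OF A]]) (use c e in auto)
    finally show ?thesis .
  qed
  \<comment> \<open>Fullness supplies a multiple of \<open>w m\<close> in \<open>M\<close>, so
    \<open>phi\<close> takes the nonzero value \<open>a\<close> there. Then all
    \<open>t ^ k * a\<close> are values of \<open>phi\<close> on \<open>M\<close>, with the common
    denominator \<open>e * h\<close>.\<close>
  obtain a where a: "a \<in> A" "a \<noteq> 0" "a * w m \<in> M" using M_full[OF basis_in_L[OF wb \<open>m < d\<close>]] by blast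
  have "phi (a * w m) = a" using phi1[of a "w m"] a A_in_K basis_in_L[OF wb \<open>m < d\<close>] phi_w[OF \<open>m < d\<close>] by simp
  then have "t ^ k * (e * h * a) \<in> A" for k
  proof -
    obtain z where z: "z \<in> M" "phi z = t ^ k * a" using steps[OF a(3), of k] \<open>phi (a * w m) = a\<close> by auto
    then show ?thesis using bounded[OF z(1)] by (simp add: mult.assoc mult.left_commute)
  qed
  then have "t \<in> A" using bounded_powers_integral[OF t(1), of "e * h * a"] e hb a by auto
  then show False using t by blast
qed

lemma extend_residue_basis:
  assumes "\<And>i. i < r \<Longrightarrow> y i \<in> M" "R.indep r y"
  shows "\<exists>z. r \<le> d \<and> (\<forall>i<r. z i = y i) \<and> residue_basis A M p pM z d"
proof -
  have "\<exists>z m. r \<le> m \<and> (\<forall>i<r. z i = y i) \<and> residue_basis A M p pM z m"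
    by (rule R.extend_to_basis[where D = d]) (use assms indep_le_degree in auto)
  then obtain z m where z: "r \<le> m" "\<forall>i<r. z i = y i" "residue_basis A M p pM z m" by (elim exE conjE)
  then have "m = d" using residue_basis_size by blast
  then show ?thesis using z by blast
qed

lemma residue_basis_exists: "\<exists>z. residue_basis A M p pM z d"
  using extend_residue_basis[of 0 "\<lambda>_. 0"] unfolding R.indep_def by auto

lemma trace_local:
  assumes x: "x \<in> L" "\<And>y. y \<in> M \<Longrightarrow> x * y \<in> M"
  shows "\<exists>s\<in>A. s \<notin> p \<and> s * Tr x \<in> A"
proof -
  obtain w where w: "residue_basis A M p pM w d" using residue_basis_exists by blast
  then have wM: "\<And>i. i < d \<Longrightarrow> w i \<in> M" and ind: "R.indep d w" and sp: "R.spans d w"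
    unfolding R.residue_basis_iff by blast+
  have "\<forall>i. \<exists>c. i < d \<longrightarrow> (\<forall>j<d. c j \<in> A) \<and> x * w i - (\<Sum>j<d. c j * w j) \<in> pM"
    using sp x(2) wM unfolding R.spans_def by blast
  then obtain c where c: "\<And>i j. i < d \<Longrightarrow> j < d \<Longrightarrow> c i j \<in> A"
    "\<And>i. i < d \<Longrightarrow> x * w i - (\<Sum>j<d. c i j * w j) \<in> pM" by metis
  obtain s where s: "s \<in> A" "s \<notin> p" "s * (Tr x - (\<Sum>i<d. c i i)) \<in> p"
    using trace_mod_p_local[OF wM ind x c] by blast
  have "s * (Tr x - (\<Sum>i<d. c i i)) + s * (\<Sum>i<d. c i i) \<in> A"
    by (rule subring_set_add[OF A subsetD[OF p_subset s(3)] subring_set_mult[OF A s(1) subring_set_sum[OF A]]])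
      (use c(1) in auto)
  then show ?thesis using s by (auto simp: algebra_simps)
qed

end

section \<open>The trace form and the discriminant\<close>

locale dedekind_ext = dedekind_set A K + field_ext K L d
  for A K L :: "'a::field set" and d :: nat +
  assumes sep: "separable_ext K L"
begin

abbreviation B :: "'a set" where "B \<equiv> integral_closure_in A L"

lemma B_ring: "subring_set B"
  by (rule subring_integral_closure[OF A L_ring])

lemma B_L: "B \<subseteq> L"
  unfolding integral_closure_in_def by blast

lemma A_B: "A \<subseteq> B"
  unfolding integral_closure_in_def using integral_self[OF A] A_K KL by blast

lemma B_submod: "submod A B"
  using B_ring A_B unfolding submod_def by (auto simp: subring_set_0 subring_set_add intro: subring_set_mult)

lemma B_full:
  assumes y: "y \<in> L"
  shows "\<exists>a\<in>A. a \<noteq> 0 \<and> a * y \<in> B"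
proof -
  obtain q where q: "q \<noteq> 0" "\<And>i. coeff q i \<in> K" "poly q y = 0"
    using bspec[OF sep[unfolded separable_ext_def] y] by blast
  obtain h where h: "h \<in> A" "h \<noteq> 0" "\<forall>i\<in>{..degree q}. h * coeff q i \<in> A"
    using common_denominator[of "{..degree q}" "coeff q"] q(2) by auto
  define r where "r = Polynomial.smult h q"
  have r: "r \<noteq> 0" "poly r y = 0" using q h by (auto simp: r_def)
  have "coeff r i \<in> A" for i
    using h subring_set_0[OF A] by (cases "i \<le> degree q") (auto simp: r_def coeff_eq_0)
  then have rA: "coeffs_in A r" unfolding coeffs_in_def by blast
  then have a: "lead_coeff r \<in> A" unfolding coeffs_in_def by blast
  have "lead_coeff r * y \<in> L" using a A_K KL y subring_set_mult[OF L_ring] by blast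
  then have "lead_coeff r * y \<in> B"
    using integral_multiple[OF A r(1) rA r(2)] unfolding integral_closure_in_def by blast
  then show ?thesis using a r by (intro bexI[of _ "lead_coeff r"]) auto
qed

lemma basis_in_B: "\<exists>b. is_basis_over K L b d \<and> (\<forall>i<d. b i \<in> B)"
proof -
  obtain b where b: "is_basis_over K L b d" using basis_exists by blast
  have "\<forall>i. \<exists>a. i < d \<longrightarrow> a \<in> A \<and> a \<noteq> 0 \<and> a * b i \<in> B" using B_full basis_in_L[OF b] by blast
  then obtain a where a: "\<And>i. i < d \<Longrightarrow> a i \<in> A" "\<And>i. i < d \<Longrightarrow> a i \<noteq> 0" "\<And>i. i < d \<Longrightarrow> a i * b i \<in> B" by metis
  have "V.indep d (\<lambda>i. a i * b i)"
    unfolding V.indep_def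
  proof (intro allI impI)
    fix c i assume c: "(\<forall>i<d. c i \<in> K) \<and> (\<Sum>i<d. c i * (a i * b i)) \<in> {0}" and i: "i < d"
    have "c i * a i = 0"
      by (rule coords_unique[OF b, where c = "\<lambda>i. c i * a i" and c' = "\<lambda>_. 0"])
        (use c i subsetD[OF A_K a(1)] subring_set_mult[OF K_ring] subring_set_0[OF K_ring] in \<open>auto simp: mult.assoc\<close>)
    then show "c i \<in> {0}" using a(2)[OF i] by simp
  qed
  then have "residue_basis K L {0} {0} (\<lambda>i. a i * b i) d"
    using V.indep_card_basis[OF b[unfolded basis_iff], of "\<lambda>i. a i * b i"] a(3) B_L by blast
  then show ?thesis using a(3) unfolding basis_iff by blast
qed

text \<open>The denominators of \<open>Tr x\<close> form an ideal. If it were proper, a prime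
  \<open>p\<close> would contain it, whereas \<open>trace_local\<close> finds a denominator outside
  \<open>p\<close>. That lemma asks for a lattice stable under \<open>x\<close>. The boundedness of
  \<open>B\<close> is a consequence of the present statement, so the largest \<open>x\<close>-stable
  submodule \<open>M\<close> of a free module \<open>Lam\<close> is taken instead; it is full
  because \<open>x\<close> is integral.\<close>

lemma trace_in_A:
  assumes x: "x \<in> B"
  shows "Tr x \<in> A"
proof -
  have xL: "x \<in> L" using x B_L by blast
  define I where "I = {s \<in> A. s * Tr x \<in> A}"
  have I: "ideal_set A I"
    unfolding ideal_set_def submod_def I_def
    using subring_set_0[OF A] subring_set_add[OF A] subring_set_mult[OF A]
    by (auto simp: distrib_right mult.assoc)
  have "1 \<in> I"
  proof (rule ccontr)
    assume "1 \<notin> I"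
    then obtain p where p: "prime_set A p" "I \<subseteq> p" using prime_above[OF I] by blast
    obtain a b where ab: "a \<in> A" "b \<in> A" "b \<noteq> 0" "Tr x = a / b" using K_E[OF trace_in_K[OF xL]] by blast
    then have "b \<in> I" unfolding I_def by simp
    then have "p \<noteq> {0}" using p ab by blast
    then obtain t u v where "dedekind_prime A K p t u v" using dedekind_prime_exists[OF p(1)] by blast
    then interpret D: dedekind_prime A K p t u v .
    obtain e where e: "is_basis_over K L e d" using basis_exists by blast
    define Lam where "Lam = {\<Sum>i<d. c i * e i | c. \<forall>i<d. c i \<in> A}"
    have LamI: "(\<Sum>i<d. c i * e i) \<in> Lam" if "\<forall>i<d. c i \<in> A" for c using that unfolding Lam_def by blast
    have Lam: "submod A Lam" unfolding Lam_def using submod_lincombs[OF A, where I = "{..<d}" and g = e]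
      by (simp add: Ball_def)
    define M where "M = {y \<in> L. \<forall>k. x ^ k * y \<in> Lam}"
    interpret X: lattice_at_prime A K p L M t u v d
    proof unfold_locales
      show "submod A M"
        unfolding submod_def M_def
      proof (intro conjI ballI CollectI allI)
        fix a y k assume a: "a \<in> A" and y: "y \<in> {y \<in> L. \<forall>k. x ^ k * y \<in> Lam}"
        show "a * y \<in> L" using a y A_K KL subring_set_mult[OF L_ring] by blast
        have "a * (x ^ k * y) \<in> Lam" using a y submod_smult[OF Lam] by blast
        then show "x ^ k * (a * y) \<in> Lam" by (simp add: mult.left_commute)
      qed (use subring_set_0[OF L_ring] subring_set_add[OF L_ring] submod_0[OF Lam] submod_add[OF Lam] in \<open>auto simp: distrib_left\<close>)
    next
      fix y assume y: "y \<in> L"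
      obtain r where r: "\<And>i. coeff r i \<in> A" "lead_coeff r = 1" "poly r x = 0"
        using x unfolding integral_closure_in_def integral_over_def by blast
      define m where "m = degree r"
      have xy: "x ^ k * y \<in> L" for k using xL y subring_set_mult[OF L_ring] subring_set_power[OF L_ring] by blast
      \<comment> \<open>One denominator for the finitely many powers \<open>x ^ k\<close> with
        \<open>k < m\<close> suffices, because the integral equation of degree \<open>m\<close>
        reduces all higher powers to these.\<close>
      obtain a where a: "a \<in> A" "a \<noteq> 0"
        "\<forall>ki\<in>{..<m} \<times> {..<d}. a * coords K e d (x ^ fst ki * y) (snd ki) \<in> A"
        using common_denominator[of "{..<m} \<times> {..<d}" "\<lambda>ki. coords K e d (x ^ fst ki * y) (snd ki)"]
          coords_in_K[OF e xy] by auto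
      have rel: "x ^ m = (\<Sum>i<m. (- coeff r i) * x ^ i)"
      proof -
        have "(\<Sum>i<Suc m. coeff r i * x ^ i) = 0"
          using r(3) poly_altdef[of r x] by (simp only: lessThan_Suc_atMost m_def)
        then have "(\<Sum>i<m. coeff r i * x ^ i) + x ^ m = 0"
          using r(2) by (simp add: m_def)
        then show ?thesis by (simp add: sum_negf add_eq_0_iff)
      qed
      have "a * (x ^ k * y) \<in> Lam" for k
      proof (induction k rule: less_induct)
        case (less k)
        show ?case
        proof (cases "k < m")
          case True
          have "a * (x ^ k * y) = (\<Sum>i<d. (a * coords K e d (x ^ k * y) i) * e i)"
            using coords_sum[OF e xy[of k]] by (simp add: sum_distrib_left[symmetric] mult.assoc)
          moreover have "\<forall>i<d. a * coords K e d (x ^ k * y) i \<in> A" using a(3) True by auto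
          ultimately show ?thesis using LamI by simp
        next
          case False
          then have "x ^ k = x ^ (k - m) * x ^ m" by (simp flip: power_add)
          also have "\<dots> = (\<Sum>i<m. (- coeff r i) * x ^ (k - m + i))"
            unfolding rel by (simp add: sum_distrib_left power_add mult.left_commute)
          finally have "a * (x ^ k * y) = (\<Sum>i<m. (- coeff r i) * (a * (x ^ (k - m + i) * y)))"
            by (simp add: sum_distrib_left sum_distrib_right mult.assoc mult.left_commute)
          also have "\<dots> \<in> Lam"
            by (rule submod_lincomb[OF Lam]) (use r(1) less False in \<open>auto intro: subring_set_uminus[OF A]\<close>)
          finally show ?thesis .
        qed
      qed
      then show "\<exists>a\<in>A. a \<noteq> 0 \<and> a * y \<in> M"
        using a y A_K KL subring_set_mult[OF L_ring]
        by (intro bexI[of _ a]) (auto simp: M_def mult.left_commute)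
    next
      show "\<exists>h b. h \<in> A \<and> h \<noteq> 0 \<and> is_basis_over K L b d \<and>
          (\<forall>x\<in>M. \<exists>c. (\<forall>i<d. c i \<in> A) \<and> h * x = (\<Sum>i<d. c i * b i))"
      proof (rule exI[of _ 1], rule exI[of _ e], intro conjI ballI)
        fix y assume "y \<in> M"
        then have "x ^ 0 * y \<in> Lam" unfolding M_def by blast
        then show "\<exists>c. (\<forall>i<d. c i \<in> A) \<and> 1 * y = (\<Sum>i<d. c i * e i)" unfolding Lam_def by auto
      qed (use e subring_set_1[OF A] in auto)
    qed (auto simp: M_def)
    have "x * y \<in> M" if "y \<in> M" for y
    proof -
      have "x ^ k * (x * y) \<in> Lam" for k
        using that[unfolded M_def, THEN CollectD, THEN conjunct2, rule_format, of "Suc k"]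
        by (simp add: mult.assoc mult.left_commute)
      then show ?thesis using that xL subring_set_mult[OF L_ring] unfolding M_def by blast
    qed
    then obtain s where "s \<in> A" "s \<notin> p" "s * Tr x \<in> A" using X.trace_local[OF xL] by blast
    then show False using p(2) unfolding I_def by blast
  qed
  then show ?thesis unfolding I_def by simp
qed

lemma trace_mult_in_A: "x \<in> B \<Longrightarrow> y \<in> B \<Longrightarrow> Tr (x * y) \<in> A"
  using trace_in_A subring_set_mult[OF B_ring] by blast

lemma trace_lincomb_mult:
  assumes "\<And>i. i < d \<Longrightarrow> c i \<in> K" "\<And>i. i < d \<Longrightarrow> x i \<in> L" "y \<in> L"
  shows "Tr ((\<Sum>i<d. c i * x i) * y) = (\<Sum>i<d. c i * Tr (x i * y))"
proof -
  have "(\<Sum>i<d. c i * x i) * y = (\<Sum>i<d. c i * (x i * y))" by (simp add: sum_distrib_right mult.assoc)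
  then show ?thesis using trace_lincomb[of d c "\<lambda>i. x i * y"] assms subring_set_mult[OF L_ring] by simp
qed

text \<open>Separability makes the Gram matrix \<open>G\<close> of a basis in \<open>B\<close>
  invertible over \<open>K\<close>. Its inverse \<open>N\<close> recovers the coordinates of
  \<open>x\<close> from the traces \<open>Tr (x * b k)\<close>, which lie in \<open>A\<close> for
  \<open>x \<in> B\<close>; a common denominator of \<open>N\<close> therefore works for all of
  \<open>B\<close>.\<close>

lemma B_bounded:
  "\<exists>h b. h \<in> A \<and> h \<noteq> 0 \<and> is_basis_over K L b d \<and>
    (\<forall>x\<in>B. \<exists>c. (\<forall>i<d. c i \<in> A) \<and> h * x = (\<Sum>i<d. c i * b i))"
proof -
  obtain b where b: "is_basis_over K L b d" and bB: "\<And>i. i < d \<Longrightarrow> b i \<in> B" using basis_in_B by blast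
  have bL: "b i \<in> L" if "i < d" for i using basis_in_L[OF b that] .
  define G where "G i j = Tr (b i * b j)" for i j
  have GK: "G i j \<in> K" if "i < d" "j < d" for i j
    unfolding G_def using that bL subring_set_mult[OF L_ring] trace_in_K by blast
  have ker: "\<forall>i<d. c i \<in> {0}"
    if c: "\<And>i. i < d \<Longrightarrow> c i \<in> K" and cG: "\<And>j. j < d \<Longrightarrow> (\<Sum>i<d. c i * G i j) \<in> {0}" for c
  proof -
    define z where "z = (\<Sum>i<d. c i * b i)"
    have zL: "z \<in> L" unfolding z_def using c bL by (intro submod_lincomb[OF V.M]) auto
    have zb: "Tr (z * b j) = 0" if "j < d" for j
      unfolding z_def using trace_lincomb_mult[of c b "b j"] c bL that cG[OF that] by (simp add: G_def)
    have "Tr (z * w) = 0" if w: "w \<in> L" for w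
    proof -
      obtain e where e: "\<forall>i<d. e i \<in> K" "w = (\<Sum>i<d. e i * b i)" using coords_ex[OF b w] by blast
      have "Tr (z * w) = (\<Sum>i<d. e i * Tr (b i * z))"
        unfolding e(2) using trace_lincomb_mult[of e b z] e(1) bL zL by (simp add: mult.commute)
      also have "\<dots> = 0" using zb by (intro sum.neutral) (simp add: mult.commute)
      finally show ?thesis .
    qed
    then have "z = 0" using trace_nondegenerate[OF sep zL] by blast
    then show ?thesis
      using V.indepD[of d b c] b c unfolding basis_iff V.residue_basis_iff z_def by simp
  qed
  have "\<exists>N. (\<forall>i<d. \<forall>j<d. N i j \<in> K) \<and>
     (\<forall>i<d. \<forall>j<d. (\<Sum>k<d. N i k * G k j) - (if i = j then 1 else 0) \<in> {0})"
    by (rule V.inverse_matrix) (use GK ker in auto)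
  then obtain N where N: "\<forall>i<d. \<forall>j<d. N i j \<in> K"
    "\<forall>i<d. \<forall>j<d. (\<Sum>k<d. N i k * G k j) - (if i = j then 1 else 0) \<in> {0}" by (elim exE conjE)
  obtain h where h: "h \<in> A" "h \<noteq> 0" "\<forall>ij\<in>{..<d} \<times> {..<d}. h * N (fst ij) (snd ij) \<in> A"
    using common_denominator[of "{..<d} \<times> {..<d}" "\<lambda>ij. N (fst ij) (snd ij)"] N(1) by auto
  have "\<exists>c. (\<forall>i<d. c i \<in> A) \<and> h * x = (\<Sum>i<d. c i * b i)" if x: "x \<in> B" for x
  proof -
    have xL: "x \<in> L" using x B_L by blast
    obtain c where c: "\<forall>i<d. c i \<in> K" "x = (\<Sum>i<d. c i * b i)" using coords_ex[OF b xL] by blast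
    have ci: "c i = (\<Sum>k<d. N i k * Tr (x * b k))" if i: "i < d" for i
    proof -
      have "(\<Sum>k<d. N i k * Tr (x * b k)) = (\<Sum>k<d. N i k * (\<Sum>j<d. c j * G k j))"
      proof (intro sum.cong refl)
        fix k assume "k \<in> {..<d}"
        then have "Tr (x * b k) = (\<Sum>j<d. c j * G j k)"
          unfolding c(2) G_def using trace_lincomb_mult[of c b "b k"] c(1) bL by simp
        then show "N i k * Tr (x * b k) = N i k * (\<Sum>j<d. c j * G k j)"
          by (simp add: G_def mult.commute)
      qed
      also have "\<dots> = (\<Sum>j<d. c j * (\<Sum>k<d. N i k * G k j))"
        by (simp add: sum_distrib_left mult.left_commute) (rule sum.swap)
      also have "\<dots> = (\<Sum>j<d. c j * (if i = j then 1 else 0))" using N(2) i by simp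
      also have "\<dots> = c i" using i by (simp add: if_distrib[of "\<lambda>x. _ * x"] cong: if_cong)
      finally show ?thesis by simp
    qed
    have "h * c i \<in> A" if i: "i < d" for i
    proof -
      have "h * c i = (\<Sum>k<d. (h * N i k) * Tr (x * b k))" using ci[OF i] by (simp add: sum_distrib_left mult.assoc)
      also have "\<dots> \<in> A"
        by (rule submod_lincomb[OF submod_self[OF A]]) (use h i x bB trace_mult_in_A in auto)
      finally show ?thesis .
    qed
    moreover have "h * x = (\<Sum>i<d. (h * c i) * b i)" using c(2) by (simp add: sum_distrib_left mult.assoc)
    ultimately show ?thesis by (intro exI[of _ "\<lambda>i. h * c i"]) auto
  qed
  then show ?thesis using h b by blast
qed

end

section \<open>Determinants over a subring and modulo an ideal\<close>

lemma det_in_subring: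
  assumes A: "subring_set A" and M: "M \<in> carrier_mat n n" "\<And>i j. i < n \<Longrightarrow> j < n \<Longrightarrow> M $$ (i, j) \<in> A"
  shows "det M \<in> A"
proof -
  have "(signof p :: 'a::field) \<in> A" for p :: "nat \<Rightarrow> nat"
    using A by (simp add: sign_def subring_set_intros)
  moreover have "(\<Prod>i = 0..<n. M $$ (i, p i)) \<in> A" if "p permutes {0..<n}" for p
    using M(2) permutes_in_image[OF that] by (intro subring_set_prod[OF A]) auto
  ultimately show ?thesis
    unfolding det_def'[OF M(1)] by (auto intro!: subring_set_sum[OF A] subring_set_mult[OF A])
qed

lemma prod_cong_mod:
  assumes A: "subring_set A" and p: "submod A p"
    and "\<And>i. i \<in> I \<Longrightarrow> f i \<in> A" "\<And>i. i \<in> I \<Longrightarrow> g i \<in> A" "\<And>i. i \<in> I \<Longrightarrow> f i - g i \<in> p"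
  shows "prod f I - prod g I \<in> p"
  using assms(3-)
proof (induction I rule: infinite_finite_induct)
  case (insert k I)
  have 1: "(prod f I - prod g I) * f k \<in> p"
    using insert by (intro submod_smult_right[OF p]) auto
  have 2: "prod g I * (f k - g k) \<in> p"
    using insert.prems by (intro submod_smult[OF p] subring_set_prod[OF A]) auto
  have "(prod f I - prod g I) * f k + prod g I * (f k - g k) \<in> p" by (rule submod_add[OF p 1 2])
  then show ?case using insert(1,2) by (simp add: algebra_simps)
qed (use submod_0[OF p] in auto)

lemma det_cong_mod:
  assumes A: "subring_set A" and p: "submod A p"
    and M: "M \<in> carrier_mat n n" "\<And>i j. i < n \<Longrightarrow> j < n \<Longrightarrow> M $$ (i, j) \<in> A"
    and N: "N \<in> carrier_mat n n" "\<And>i j. i < n \<Longrightarrow> j < n \<Longrightarrow> N $$ (i, j) \<in> A"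
    and MN: "\<And>i j. i < n \<Longrightarrow> j < n \<Longrightarrow> M $$ (i, j) - N $$ (i, j) \<in> p"
  shows "det M - det N \<in> p"
  unfolding det_def'[OF M(1)] det_def'[OF N(1)]
proof (rule submod_diff_sum[OF p])
  fix q assume "q \<in> {p. p permutes {0..<n}}"
  then have q: "q permutes {0..<n}" by simp
  have "(signof q :: 'a::field) \<in> A" using A by (simp add: sign_def subring_set_intros)
  moreover have "(\<Prod>i = 0..<n. M $$ (i, q i)) - (\<Prod>i = 0..<n. N $$ (i, q i)) \<in> p"
    using M(2) N(2) MN permutes_in_image[OF q] by (intro prod_cong_mod[OF A p]) auto
  ultimately have "signof q * ((\<Prod>i = 0..<n. M $$ (i, q i)) - (\<Prod>i = 0..<n. N $$ (i, q i))) \<in> p"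
    by (rule submod_smult[OF p])
  then show "signof q * (\<Prod>i = 0..<n. M $$ (i, q i)) - signof q * (\<Prod>i = 0..<n. N $$ (i, q i)) \<in> p"
    by (simp add: right_diff_distrib)
qed

text \<open>Multiplication by the adjugate. The \<open>c i\<close> range over the whole ambient
  field and only their combinations with \<open>G\<close> are constrained: the rule is applied to
  coordinates in \<open>K\<close>, modulo \<open>{0}\<close> as well as modulo
  \<open>p\<close>.\<close>

lemma cramer_in_ideal:
  assumes A: "subring_set A" and p: "submod A p"
    and G: "\<And>i j. i < n \<Longrightarrow> j < n \<Longrightarrow> G i j \<in> A"
    and r: "\<And>j. j < n \<Longrightarrow> (\<Sum>i<n. c i * G i j) \<in> p" and k: "k < n"
  shows "det (mat n n (\<lambda>(i, j). G i j)) * c k \<in> p"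
proof -
  define M where "M = mat n n (\<lambda>(i, j). G i j)"
  have M: "M \<in> carrier_mat n n" by (simp add: M_def)
  have adjA: "adj_mat M $$ (j, k) \<in> A" if "j < n" for j
  proof -
    have "det (mat_delete M k j) \<in> A"
    proof (rule det_in_subring[OF A])
      show "mat_delete M k j \<in> carrier_mat (n - 1) (n - 1)" using M by (rule mat_delete_carrier)
      show "mat_delete M k j $$ (i, l) \<in> A" if "i < n - 1" "l < n - 1" for i l
        using that G unfolding mat_delete_def by (auto simp: M_def)
    qed
    moreover have "(- 1) ^ (k + j) \<in> A" using A by (intro subring_set_power) (simp_all add: subring_set_intros)
    ultimately show ?thesis
      using that k M A unfolding adj_mat_def by (simp add: cofactor_def subring_set_mult)
  qed
  have "(\<Sum>j<n. adj_mat M $$ (j, k) * (\<Sum>i<n. c i * G i j)) \<in> p"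
    by (rule submod_lincomb[OF p]) (use adjA r in auto)
  also have "(\<Sum>j<n. adj_mat M $$ (j, k) * (\<Sum>i<n. c i * G i j)) = (\<Sum>i<n. c i * (\<Sum>j<n. G i j * adj_mat M $$ (j, k)))"
    by (simp add: sum_distrib_left mult.assoc mult.left_commute mult.commute) (rule sum.swap)
  also have "\<dots> = (\<Sum>i<n. c i * (M * adj_mat M) $$ (i, k))"
    using M adj_mat(1)[OF M] k by (intro sum.cong refl) (auto simp: scalar_prod_def M_def lessThan_atLeast0)
  also have "\<dots> = (\<Sum>i<n. c i * (if i = k then det M else 0))"
    unfolding adj_mat(2)[OF M] using k by (intro sum.cong refl) auto
  also have "\<dots> = det M * c k" using k by (simp add: if_distrib[of "\<lambda>x. _ * x"] mult.commute cong: if_cong)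
  finally show ?thesis by (simp add: M_def)
qed

lemma disc_tuple_det: "disc_tuple K L d x = det (mat d d (\<lambda>(i, j). trace_ext K L d (x i * x j)))"
proof -
  have "(\<Prod>i<d. trace_ext K L d (x i * x (p i))) =
     (\<Prod>i<d. mat d d (\<lambda>(i, j). trace_ext K L d (x i * x j)) $$ (i, p i))" if "p permutes {..<d}" for p
    using permutes_in_image[OF that] by (intro prod.cong) auto
  then show ?thesis
    unfolding disc_tuple_def by (subst det_def'[of _ d]) (auto simp: atLeast0LessThan intro!: sum.cong)
qed

lemma (in dedekind_ext) disc_in_A: "(\<And>i. i < d \<Longrightarrow> x i \<in> B) \<Longrightarrow> disc_tuple K L d x \<in> A"
  unfolding disc_tuple_det by (rule det_in_subring[OF A, of _ d]) (auto simp: trace_mult_in_A)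

text \<open>The ambient field may have characteristic 0 while the quotient by \<open>Z\<close> has
  characteristic \<open>l\<close>, hence the form as a congruence.\<close>

lemma freshman_mod:
  assumes B: "subring_set B" and Z: "submod B Z" and l: "prime l" "of_nat l \<in> Z"
  shows "finite I \<Longrightarrow> (\<And>i. i \<in> I \<Longrightarrow> x i \<in> B) \<Longrightarrow> (\<Sum>i\<in>I. x i) ^ l - (\<Sum>i\<in>I. x i ^ l) \<in> Z"
proof (induction I rule: finite_induct)
  case empty
  then show ?case using submod_0[OF Z] prime_gt_0_nat[OF l(1)] by (simp add: power_0_left)
next
  case (insert k I)
  let ?y = "\<Sum>i\<in>I. x i"
  have l0: "0 < l" using prime_gt_0_nat[OF l(1)] .
  have yB: "?y \<in> B" "x k \<in> B" using insert.prems by (auto intro: subring_set_sum[OF B])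
  have set: "{..l} = insert 0 (insert l {0<..<l})" by auto
  have "(x k + ?y) ^ l = (\<Sum>j\<le>l. of_nat (l choose j) * x k ^ j * ?y ^ (l - j))" by (rule binomial_ring)
  also have "\<dots> = ?y ^ l + (x k ^ l + (\<Sum>j\<in>{0<..<l}. of_nat (l choose j) * x k ^ j * ?y ^ (l - j)))"
    unfolding set using l0 by simp
  finally have eq: "(x k + ?y) ^ l = ?y ^ l + (x k ^ l + (\<Sum>j\<in>{0<..<l}. of_nat (l choose j) * x k ^ j * ?y ^ (l - j)))" .
  have "(\<Sum>j\<in>{0<..<l}. of_nat (l choose j) * x k ^ j * ?y ^ (l - j)) \<in> Z"
  proof (rule submod_sum[OF Z])
    fix j assume j: "j \<in> {0<..<l}"
    then have "l dvd (l choose j)" using l by (intro dvd_choose_prime) auto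
    then obtain m where m: "l choose j = l * m" by auto
    have "of_nat (l choose j) \<in> Z"
      unfolding m using l(2) by (auto intro: submod_smult_right[OF Z] subring_set_of_nat[OF B])
    then show "of_nat (l choose j) * x k ^ j * ?y ^ (l - j) \<in> Z"
      using yB by (intro submod_smult_right[OF Z] subring_set_power[OF B])
  qed
  then have "(?y ^ l - (\<Sum>i\<in>I. x i ^ l)) + (\<Sum>j\<in>{0<..<l}. of_nat (l choose j) * x k ^ j * ?y ^ (l - j)) \<in> Z"
    using insert by (intro submod_add[OF Z]) auto
  then show ?case using insert(1,2) by (simp add: eq algebra_simps)
qed

section \<open>Finite residue rings: characteristic and Frobenius\<close>

definition cosets :: "'a::field set \<Rightarrow> 'a set \<Rightarrow> 'a set set" where
  "cosets M Z = (\<lambda>x. {y \<in> M. y - x \<in> Z}) ` M"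

lemma coset_eq_iff:
  assumes A: "subring_set A" and Z: "submod A Z" and x: "x \<in> M" "y \<in> M"
  shows "{w \<in> M. w - x \<in> Z} = {w \<in> M. w - y \<in> Z} \<longleftrightarrow> x - y \<in> Z"
proof
  assume "{w \<in> M. w - x \<in> Z} = {w \<in> M. w - y \<in> Z}"
  moreover have "x \<in> {w \<in> M. w - x \<in> Z}" using x submod_0[OF Z] by simp
  ultimately show "x - y \<in> Z" by blast
next
  assume "x - y \<in> Z"
  then show "{w \<in> M. w - x \<in> Z} = {w \<in> M. w - y \<in> Z}"
    using submod_trans[OF Z] submod_diff_swap[OF A Z] by blast
qed

lemma pigeonhole_cosets:
  assumes A: "subring_set A" and Z: "submod A Z" and fin: "finite (cosets M Z)" and f: "\<And>i::nat. f i \<in> M"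
  shows "\<exists>i j. i < j \<and> f j - f i \<in> Z"
proof -
  let ?g = "\<lambda>i. {w \<in> M. w - f i \<in> Z}"
  have "range ?g \<subseteq> cosets M Z" using f unfolding cosets_def by blast
  then have "finite (range ?g)" using fin by (rule finite_subset)
  then have "\<not> inj ?g" using finite_imageD[of ?g UNIV] infinite_UNIV_nat by auto
  then obtain i j where "i \<noteq> j" "?g i = ?g j" unfolding inj_def by blast
  then obtain i j where ij: "i < j" "?g i = ?g j" by (cases "i < j") (auto simp: not_less le_less)
  then have "f j - f i \<in> Z" using coset_eq_iff[OF A Z f f, of j i] by simp
  then show ?thesis using ij by blast
qed

text \<open>Two natural numbers agree modulo \<open>p\<close> by finiteness. Primality of
  \<open>p\<close> then passes from their difference to one of its prime factors.\<close>

lemma residue_char: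
  assumes A: "subring_set A" and p: "field_mod A p" and fin: "finite (cosets A p)"
  shows "\<exists>l. prime l \<and> of_nat l \<in> p"
proof -
  have pI: "submod A p" "p \<subseteq> A" "1 \<notin> p" using p unfolding field_mod_def by blast+
  obtain i j :: nat where ij: "i < j" "(of_nat j :: 'a) - of_nat i \<in> p"
    using pigeonhole_cosets[OF A pI(1) fin, of of_nat] subring_set_of_nat[OF A] by blast
  then have n: "of_nat (j - i) \<in> p" by (simp add: of_nat_diff)
  have "\<exists>l. prime l \<and> of_nat l \<in> p" if "of_nat n \<in> p" "n \<noteq> 0" for n
    using that
  proof (induction n rule: less_induct)
    case (less n)
    show ?case
    proof (cases "n = 1")
      case True
      then show ?thesis using less pI by simp
    next
      case False
      then obtain l where l: "prime l" "l dvd n" using prime_factor_nat by blast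
      then obtain m where m: "n = l * m" by auto
      have "of_nat l * of_nat m \<in> p" using less.prems m by simp
      then have "of_nat l \<in> p \<or> of_nat m \<in> p"
        using field_mod_prime[OF A p subring_set_of_nat[OF A] subring_set_of_nat[OF A]] by blast
      moreover have "m < n" "m \<noteq> 0" using less.prems m prime_gt_1_nat[OF l(1)] by auto
      ultimately show ?thesis using less.IH[of m] l by blast
    qed
  qed
  from this[OF n] show ?thesis using ij(1) by simp
qed

text \<open>Frobenius is injective on \<open>A / p\<close>. Among the iterates
  \<open>c ^ (l ^ i)\<close> two agree by finiteness, and cancelling the common iterations exhibits
  \<open>c\<close> as an \<open>l\<close>-th power.\<close>

lemma frobenius_surj_mod:
  assumes A: "subring_set A" and p: "field_mod A p" and fin: "finite (cosets A p)"
    and l: "prime l" "of_nat l \<in> p" and c: "c \<in> A"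
  shows "\<exists>g\<in>A. g ^ l - c \<in> p"
proof -
  have pI: "submod A p" "p \<subseteq> A" "1 \<notin> p" using p unfolding field_mod_def by blast+
  have nil: "x \<in> p" if "x \<in> A" "x ^ n \<in> p" for x n
    using that(2)
  proof (induction n)
    case 0
    then show ?case using pI by simp
  next
    case (Suc n)
    then show ?case using field_mod_prime[OF A p that(1) subring_set_power[OF A that(1), of n]] by auto
  qed
  have inj: "x - y \<in> p" if xy: "x \<in> A" "y \<in> A" "x ^ l - y ^ l \<in> p" for x y
  proof -
    have "(\<Sum>i\<in>{0::nat, 1}. if i = 0 then x - y else y) ^ l - (\<Sum>i\<in>{0::nat, 1}. (if i = 0 then x - y else y) ^ l) \<in> p"
      by (rule freshman_mod[OF A pI(1) l]) (use xy in \<open>auto intro: subring_set_diff[OF A]\<close>)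
    then have "x ^ l - ((x - y) ^ l + y ^ l) \<in> p" by simp
    then have "(x ^ l - y ^ l) - (x ^ l - ((x - y) ^ l + y ^ l)) \<in> p" by (rule submod_diff[OF A pI(1) xy(3)])
    then have "(x - y) ^ l \<in> p" by simp
    then show ?thesis using nil[of "x - y" l] xy subring_set_diff[OF A] by blast
  qed
  obtain i j where ij: "i < j" "c ^ (l ^ j) - c ^ (l ^ i) \<in> p"
    using pigeonhole_cosets[OF A pI(1) fin, of "\<lambda>i. c ^ (l ^ i)"] subring_set_power[OF A c] by blast
  have "c ^ (l ^ (k + m)) - c ^ (l ^ k) \<in> p \<Longrightarrow> c ^ (l ^ m) - c \<in> p" for k m
  proof (induction k)
    case 0
    then show ?case by simp
  next
    case (Suc k)
    have "(c ^ (l ^ (k + m))) ^ l - (c ^ (l ^ k)) ^ l \<in> p"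
      using Suc.prems by (simp add: power_mult[symmetric] mult.commute)
    then show ?case using inj[of "c ^ (l ^ (k + m))" "c ^ (l ^ k)"] subring_set_power[OF A c] Suc.IH by blast
  qed
  from this[of i "j - i"] ij have "c ^ (l ^ (j - i)) - c \<in> p" by simp
  moreover have "l ^ (j - i) = l ^ (j - i - 1) * l"
    using ij(1) by (metis Suc_diff_Suc diff_Suc_1 mult.commute power_Suc diff_Suc_eq_diff_pred)
  ultimately have "(c ^ (l ^ (j - i - 1))) ^ l - c \<in> p" by (simp add: power_mult)
  then show ?thesis using subring_set_power[OF A c] by blast
qed

section \<open>Trace and discriminant of \<open>B\<close> modulo \<open>p\<close>\<close>

locale ext_at_prime = dedekind_ext A K L d + dedekind_prime A K p t u v
  for A K L p :: "'a::field set" and d :: nat and t u v :: 'a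
begin

sublocale lattice_at_prime A K p L B t u v d
  using B_submod B_L B_full B_bounded by unfold_locales auto

abbreviation pB :: "'a set" where "pB \<equiv> pM"

lemma pB_iff: "x \<in> pB \<longleftrightarrow> x \<in> B \<and> t * x \<in> B"
  unfolding pM_def by blast

lemma pB_B: "pB \<subseteq> B"
  using pB_iff by blast

lemma pB_ideal: "submod B pB"
  unfolding submod_def
proof (intro conjI ballI)
  fix a x assume a: "a \<in> B" and x: "x \<in> pB"
  then have "a * x \<in> B" "a * (t * x) \<in> B" using pB_iff subring_set_mult[OF B_ring] by blast+
  then show "a * x \<in> pB" by (simp add: pB_iff mult.left_commute)
qed (use submod_0[OF pM_submod] submod_add[OF pM_submod] in auto)

lemma p_pB: "p \<subseteq> pB"
  using p_times_M[of _ 1] subring_set_1[OF B_ring] by auto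

lemma trace_mod_p:
  assumes w: "residue_basis A B p pB w d" and x: "x \<in> B"
    and c: "\<And>i j. i < d \<Longrightarrow> j < d \<Longrightarrow> c i j \<in> A" "\<And>i. i < d \<Longrightarrow> x * w i - (\<Sum>j<d. c i j * w j) \<in> pB"
  shows "Tr x - (\<Sum>i<d. c i i) \<in> p"
proof -
  have wB: "\<And>i. i < d \<Longrightarrow> w i \<in> B" and ind: "R.indep d w" using w unfolding R.residue_basis_iff by blast+
  obtain s where s: "s \<in> A" "s \<notin> p" "s * (Tr x - (\<Sum>i<d. c i i)) \<in> p"
    using trace_mod_p_local[OF wB ind subsetD[OF B_L x] subring_set_mult[OF B_ring x] c] by blast
  have "Tr x - (\<Sum>i<d. c i i) \<in> A"
    using trace_in_A[OF x] c(1) by (auto intro!: subring_set_diff[OF A] subring_set_sum[OF A])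
  then show ?thesis using prime_p[OF s(1) _ s(3)] s(2) by blast
qed

text \<open>Both \<open>Tr x\<close> and \<open>t * Tr x = Tr (t * x)\<close> lie in
  \<open>A\<close>, which characterizes membership in \<open>p\<close>.\<close>

lemma trace_pB: "x \<in> pB \<Longrightarrow> Tr x \<in> p"
proof -
  assume x: "x \<in> pB"
  then have "x \<in> L" using pB_B B_L by blast
  then have "Tr (t * x) = t * Tr x" using trace_lincomb[of 1 "\<lambda>_. t" "\<lambda>_. x"] t(1) by simp
  then show ?thesis using mem_p[of "Tr x"] trace_in_A x pB_iff by metis
qed

text \<open>Since \<open>x\<close> maps \<open>B\<close> into \<open>F\<close>, its trace on
  \<open>B / pB\<close> is already that of its restriction to \<open>F / pB\<close>. This links
  \<open>Tr\<close> to traces computed inside an ideal.\<close>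

lemma trace_on_submodule:
  assumes F: "submod A F" "F \<subseteq> B" "pB \<subseteq> F" and b: "residue_basis A F p pB b f"
    and x: "x \<in> B" "\<And>y. y \<in> B \<Longrightarrow> x * y \<in> F"
    and c: "\<And>i j. i < f \<Longrightarrow> j < f \<Longrightarrow> c i j \<in> A" "\<And>i. i < f \<Longrightarrow> x * b i - (\<Sum>j<f. c i j * b j) \<in> pB"
  shows "Tr x - (\<Sum>i<f. c i i) \<in> p"
proof -
  interpret FF: linmod A p F pB
    using A p_field F pM_submod p_times_M by unfold_locales auto
  have bF: "\<And>i. i < f \<Longrightarrow> b i \<in> F" and ind: "R.indep f b" and sp: "FF.spans f b"
    using b unfolding FF.residue_basis_iff by blast+
  obtain w where w: "f \<le> d" "\<forall>i<f. w i = b i" "residue_basis A B p pB w d"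
    using extend_residue_basis[OF _ ind] bF F by blast
  have wB: "w i \<in> B" if "i < d" for i using w(3) that unfolding residue_basis_def by blast
  have "\<forall>i. \<exists>e. i < d \<longrightarrow> (\<forall>j<f. e j \<in> A) \<and> x * w i - (\<Sum>j<f. e j * b j) \<in> pB"
    using sp x(2) wB unfolding FF.spans_def by blast
  then obtain e where e: "\<And>i j. i < d \<Longrightarrow> j < f \<Longrightarrow> e i j \<in> A"
    "\<And>i. i < d \<Longrightarrow> x * w i - (\<Sum>j<f. e i j * b j) \<in> pB" by metis
  \<comment> \<open>The matrix of \<open>x\<close> in the extended basis: rows below
    \<open>f\<close> come from \<open>c\<close>, the others from \<open>e\<close>. Columns from
    \<open>f\<close> on vanish because the image lies in \<open>F\<close>, so the diagonal stops
    contributing at \<open>f\<close>.\<close>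
  define m where "m i j = (if j < f then if i < f then c i j else e i j else 0)" for i j
  have "Tr x - (\<Sum>i<d. m i i) \<in> p"
  proof (rule trace_mod_p[OF w(3) x(1), where c = m])
    show "m i j \<in> A" if "i < d" "j < d" for i j
      using that c e subring_set_0[OF A] by (auto simp: m_def)
    show "x * w i - (\<Sum>j<d. m i j * w j) \<in> pB" if i: "i < d" for i
    proof -
      have "(\<Sum>j<d. m i j * w j) = (\<Sum>j<f. m i j * w j)"
        using w(1) by (intro sum.mono_neutral_right) (auto simp: m_def)
      also have "\<dots> = (\<Sum>j<f. (if i < f then c i j else e i j) * b j)"
        using w(2) by (intro sum.cong) (auto simp: m_def)
      finally have eq: "(\<Sum>j<d. m i j * w j) = (\<Sum>j<f. (if i < f then c i j else e i j) * b j)" .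
      show ?thesis
      proof (cases "i < f")
        case True
        then show ?thesis using c(2)[OF True] w(2) unfolding eq by simp
      next
        case False
        then show ?thesis using e(2)[OF i] unfolding eq by simp
      qed
    qed
  qed
  also have "(\<Sum>i<d. m i i) = (\<Sum>i<f. m i i)"
    using w(1) by (intro sum.mono_neutral_right) (auto simp: m_def)
  also have "\<dots> = (\<Sum>i<f. c i i)" by (intro sum.cong) (auto simp: m_def)
  finally show ?thesis .
qed

lemma submodule_basis:
  assumes F: "submod A F" "F \<subseteq> B" "pB \<subseteq> F"
  shows "\<exists>b f. residue_basis A F p pB b f"
proof -
  interpret FF: linmod A p F pB
    using A p_field F pM_submod p_times_M by unfold_locales auto
  have "\<exists>z m. 0 \<le> m \<and> (\<forall>i<0. z i = (0::'a)) \<and> residue_basis A F p pB z m"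
  proof (rule FF.extend_to_basis[where D = d])
    show "m \<le> d" if "\<forall>i<m. z i \<in> F" "R.indep m z" for m z
      using indep_le_degree[OF that(2)] that(1) F(2) by blast
  qed (auto simp: FF.indep_def)
  then show ?thesis by blast
qed

lemma ideal_mult_plus_pB:
  assumes F: "submod B F" "F \<subseteq> B" and x: "x \<in> B"
  shows "submod B {x * y + z | y z. y \<in> F \<and> z \<in> pB}" (is "submod B ?S")
  unfolding submod_def
proof (intro conjI ballI)
  have "0 = x * 0 + 0" by simp
  then show "0 \<in> ?S" using submod_0[OF F(1)] submod_0[OF pB_ideal] by blast
next
  fix a b assume "a \<in> ?S" "b \<in> ?S"
  then obtain y z y' z' where "a = x * y + z" "b = x * y' + z'" "y \<in> F" "y' \<in> F" "z \<in> pB" "z' \<in> pB" by blast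
  moreover from this have "a + b = x * (y + y') + (z + z')" by (simp add: algebra_simps)
  ultimately show "a + b \<in> ?S" using submod_add[OF F(1)] submod_add[OF pB_ideal] by blast
next
  fix a b assume a: "a \<in> B" and "b \<in> ?S"
  then obtain y z where "b = x * y + z" "y \<in> F" "z \<in> pB" by blast
  moreover from this have "a * b = x * (a * y) + a * z" by (simp add: algebra_simps)
  ultimately show "a * b \<in> ?S" using a submod_smult[OF F(1)] submod_smult[OF pB_ideal] by blast
qed

lemma mult_plus_pB_mem: "y \<in> F \<Longrightarrow> x * y \<in> {x * y + z | y z. y \<in> F \<and> z \<in> pB}"
proof -
  assume "y \<in> F"
  moreover have "x * y = x * y + 0" by simp
  ultimately show ?thesis using submod_0[OF pB_ideal] by blast
qed

lemma pB_mult_plus_pB: "0 \<in> F \<Longrightarrow> pB \<subseteq> {x * y + z | y z. y \<in> F \<and> z \<in> pB}"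
proof
  fix z assume "z \<in> pB" "0 \<in> F"
  moreover have "z = x * 0 + z" by simp
  ultimately show "z \<in> {x * y + z | y z. y \<in> F \<and> z \<in> pB}" by blast
qed

lemma B_self: "submod B B"
  by (rule submod_self[OF B_ring])

lemma submod_A_of_B: "submod B F \<Longrightarrow> submod A F"
  using A_B unfolding submod_def by blast

text \<open>\<open>z\<close> maps \<open>B\<close> into \<open>F = z B + pB\<close> and
  \<open>F\<close> into \<open>pB\<close>, so on \<open>F / pB\<close> it is represented by the zero
  matrix.\<close>

lemma trace_square_zero:
  assumes z: "z \<in> B" "z * z \<in> pB"
  shows "Tr z \<in> p"
proof -
  define F where "F = {z * y + w | y w. y \<in> B \<and> w \<in> pB}"
  have FB: "submod B F" unfolding F_def by (rule ideal_mult_plus_pB[OF B_self _ z(1)]) simp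
  have F: "submod A F" "F \<subseteq> B" "pB \<subseteq> F"
    using submod_A_of_B[OF FB] pB_mult_plus_pB[OF subring_set_0[OF B_ring], of z]
      subring_set_add[OF B_ring] subring_set_mult[OF B_ring z(1)] pB_B unfolding F_def by blast+
  obtain b f where b: "residue_basis A F p pB b f" using submodule_basis[OF F] by blast
  have "Tr z - (\<Sum>i<f. 0) \<in> p"
  proof (rule trace_on_submodule[OF F b z(1), where c = "\<lambda>_ _. 0"])
    show "z * y \<in> F" if "y \<in> B" for y unfolding F_def using mult_plus_pB_mem[OF that] .
    show "z * b i - (\<Sum>j<f. 0 * b j) \<in> pB" if "i < f" for i
    proof -
      have "b i \<in> F" using b that unfolding residue_basis_def by blast
      then obtain y w where yw: "b i = z * y + w" "y \<in> B" "w \<in> pB" unfolding F_def by blast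
      have "y * (z * z) + z * w \<in> pB"
        using yw z submod_smult[OF pB_ideal] submod_add[OF pB_ideal] by blast
      then show ?thesis using yw(1) by (simp add: algebra_simps)
    qed
  qed (use subring_set_0[OF A] in auto)
  then show ?thesis by simp
qed

text \<open>For a lift \<open>w\<close> of a basis of \<open>B / pB\<close>, a Gram matrix without
  kernel modulo \<open>p\<close> would be invertible there, against its determinant lying in
  \<open>p\<close>. A kernel vector gives the coordinates of \<open>z\<close>. The pairing with a
  general \<open>y\<close> reduces to the \<open>w i\<close>, since traces of \<open>pB\<close> lie
  in \<open>p\<close>.\<close>

lemma trace_radical:
  assumes disc: "\<And>x. (\<And>i. i < d \<Longrightarrow> x i \<in> B) \<Longrightarrow> disc_tuple K L d x \<in> p"
  shows "\<exists>z\<in>B. z \<notin> pB \<and> (\<forall>w\<in>B. Tr (z * w) \<in> p)"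
proof -
  obtain w where w: "residue_basis A B p pB w d" using residue_basis_exists by blast
  then have wB: "\<And>i. i < d \<Longrightarrow> w i \<in> B" and ind: "R.indep d w" and sp: "R.spans d w"
    unfolding R.residue_basis_iff by blast+
  define G where "G i j = Tr (w i * w j)" for i j
  have GA: "G i j \<in> A" if "i < d" "j < d" for i j unfolding G_def using that wB trace_mult_in_A by blast
  define GM where "GM = mat d d (\<lambda>(i, j). G i j)"
  have GM: "GM \<in> carrier_mat d d" by (simp add: GM_def)
  have detG: "det GM \<in> p" using disc[OF wB] unfolding disc_tuple_det GM_def G_def .
  have "\<not> (\<forall>c. (\<forall>i<d. c i \<in> A) \<longrightarrow> (\<forall>j<d. (\<Sum>i<d. c i * G i j) \<in> p) \<longrightarrow> (\<forall>i<d. c i \<in> p))"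
  proof
    assume ker: "\<forall>c. (\<forall>i<d. c i \<in> A) \<longrightarrow> (\<forall>j<d. (\<Sum>i<d. c i * G i j) \<in> p) \<longrightarrow> (\<forall>i<d. c i \<in> p)"
    have "\<exists>N. (\<forall>i<d. \<forall>j<d. N i j \<in> A) \<and>
       (\<forall>i<d. \<forall>j<d. (\<Sum>k<d. N i k * G k j) - (if i = j then 1 else 0) \<in> p)"
      by (rule R.inverse_matrix) (use GA ker in auto)
    then obtain N where N: "\<forall>i<d. \<forall>j<d. N i j \<in> A"
      "\<forall>i<d. \<forall>j<d. (\<Sum>k<d. N i k * G k j) - (if i = j then 1 else 0) \<in> p" by (elim exE conjE)
    define NM where "NM = mat d d (\<lambda>(i, j). N i j)"
    have NM: "NM \<in> carrier_mat d d" by (simp add: NM_def)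
    have entry: "(NM * GM) $$ (i, j) = (\<Sum>k<d. N i k * G k j)" if "i < d" "j < d" for i j
      using that by (simp add: NM_def GM_def scalar_prod_def lessThan_atLeast0)
    have "det (NM * GM) - det (1\<^sub>m d) \<in> p"
    proof (rule det_cong_mod[OF A p_submod, of _ d])
      show "(NM * GM) $$ (i, j) \<in> A" if "i < d" "j < d" for i j
        unfolding entry[OF that] by (rule submod_lincomb[OF submod_self[OF A]]) (use that N GA in auto)
      show "(NM * GM) $$ (i, j) - 1\<^sub>m d $$ (i, j) \<in> p" if "i < d" "j < d" for i j
        unfolding entry[OF that] using that N(2) by simp
    qed (use NM GM subring_set_0[OF A] subring_set_1[OF A] in auto)
    moreover have "det NM * det GM \<in> p"
      using det_in_subring[OF A NM] N(1) detG by (intro submod_smult[OF p_submod]) (auto simp: NM_def)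
    ultimately have "1 \<in> p"
      using submod_mem_cong[OF A p_submod] by (simp add: det_mult[OF NM GM])
    then show False using one_notin_p by blast
  qed
  then obtain c k where c: "\<forall>i<d. c i \<in> A" "\<forall>j<d. (\<Sum>i<d. c i * G i j) \<in> p" "k < d" "c k \<notin> p" by blast
  define z where "z = (\<Sum>i<d. c i * w i)"
  have zB: "z \<in> B" unfolding z_def using c wB by (intro submod_lincomb[OF B_submod]) auto
  have wL: "w i \<in> L" if "i < d" for i using wB[OF that] B_L by blast
  have zL: "z \<in> L" using zB B_L by blast
  have cK: "c i \<in> K" if "i < d" for i using c(1) that A_K by blast
  have "z \<notin> pB" using R.indepD[OF ind, of c k] c unfolding z_def by blast
  moreover have "Tr (z * y) \<in> p" if y: "y \<in> B" for y
  proof -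
    obtain e where e: "\<And>i. i < d \<Longrightarrow> e i \<in> A" "y - (\<Sum>i<d. e i * w i) \<in> pB" using R.spansE[OF sp y] by blast
    define r where "r = y - (\<Sum>i<d. e i * w i)"
    have rB: "r \<in> pB" using e r_def by simp
    then have zr: "z * r \<in> pB" using submod_smult[OF pB_ideal zB] by blast
    have zw: "Tr (w j * z) \<in> p" if "j < d" for j
    proof -
      have "Tr (z * w j) = (\<Sum>i<d. c i * G i j)"
        unfolding z_def G_def by (rule trace_lincomb_mult) (use cK wL that in auto)
      then show ?thesis using c(2) that by (simp add: mult.commute)
    qed
    have s: "(\<Sum>i<d. e i * w i) * z \<in> L"
      using e(1) A_K KL wL zL by (intro subring_set_mult[OF L_ring] submod_lincomb[OF V.M]) auto
    have eq: "z * y = (\<Sum>i<d. e i * w i) * z + z * r" by (simp add: r_def algebra_simps)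
    have "Tr (z * y) = Tr ((\<Sum>i<d. e i * w i) * z) + Tr (z * r)"
      using trace_lincomb[of 2 "\<lambda>_. 1" "\<lambda>i. if i = 0 then (\<Sum>i<d. e i * w i) * z else z * r"] s zr pB_B B_L subring_set_1[OF K_ring]
      unfolding eq by (auto simp: numeral_2_eq_2)
    also have "Tr ((\<Sum>i<d. e i * w i) * z) = (\<Sum>i<d. e i * Tr (w i * z))"
      by (rule trace_lincomb_mult) (use e(1) A_K wL zL in auto)
    also have "(\<Sum>i<d. e i * Tr (w i * z)) + Tr (z * r) \<in> p"
      by (rule submod_add[OF p_submod submod_lincomb[OF p_submod] trace_pB[OF zr]]) (use e(1) zw in auto)
    finally show ?thesis .
  qed
  ultimately show ?thesis using zB by blast
qed

text \<open>A nonzero discriminant \<open>D\<close> makes \<open>x\<close> a \<open>K\<close>-basis.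
  All \<open>z * x j\<close> have square in \<open>pB\<close>, so their traces lie in
  \<open>p\<close>, and Cramer's rule puts \<open>D\<close> times each coordinate of
  \<open>z\<close> into \<open>p\<close>. Thus \<open>D * z \<in> pB\<close>, and \<open>D\<close>
  is invertible modulo \<open>p\<close>. The tuple \<open>x\<close> is not assumed to generate
  \<open>B\<close> modulo \<open>p\<close>.\<close>

lemma reduced_if_disc:
  assumes x: "\<And>i. i < d \<Longrightarrow> x i \<in> B" and disc: "disc_tuple K L d x \<notin> p"
    and z: "z \<in> B" "z * z \<in> pB"
  shows "z \<in> pB"
proof -
  define G where "G i j = Tr (x i * x j)" for i j
  have GA: "G i j \<in> A" if "i < d" "j < d" for i j unfolding G_def using that x trace_mult_in_A by blast
  define D where "D = disc_tuple K L d x"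
  have D: "D = det (mat d d (\<lambda>(i, j). G i j))" unfolding D_def disc_tuple_det G_def ..
  have DA: "D \<in> A" "D \<notin> p" using disc_in_A[OF x] disc unfolding D_def by auto
  have xL: "x i \<in> L" if "i < d" for i using x[OF that] B_L by blast
  have "V.indep d x"
    unfolding V.indep_def
  proof (intro allI impI)
    fix c i assume c: "(\<forall>i<d. c i \<in> K) \<and> (\<Sum>i<d. c i * x i) \<in> {0}" and i: "i < d"
    have "(\<Sum>i<d. c i * G i j) \<in> {0}" if "j < d" for j
    proof -
      have "Tr ((\<Sum>i<d. c i * x i) * x j) = (\<Sum>i<d. c i * G i j)"
        unfolding G_def by (rule trace_lincomb_mult) (use c xL that in auto)
      moreover have "Tr 0 = 0" using trace_lincomb[of 0 "\<lambda>_. 0" "\<lambda>_. 0"] by simp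
      ultimately show ?thesis using c by simp
    qed
    then have "D * c i \<in> {0}" unfolding D by (intro cramer_in_ideal[OF A submod_singleton_0 GA _ i]) auto
    then show "c i \<in> {0}" using DA submod_0[OF p_submod] by auto
  qed
  then have bas: "is_basis_over K L x d"
  proof -
    assume ind: "V.indep d x"
    obtain b where b: "is_basis_over K L b d" using basis_exists by blast
    then show ?thesis using V.indep_card_basis[OF b[unfolded basis_iff] xL ind] by (simp add: basis_iff)
  qed
  obtain c where c: "\<forall>i<d. c i \<in> K" "z = (\<Sum>i<d. c i * x i)" using coords_ex[OF bas] z B_L by blast
  have "(\<Sum>i<d. c i * G i j) \<in> p" if j: "j < d" for j
  proof -
    have "(z * x j) * (z * x j) \<in> pB"
      using submod_smult[OF pB_ideal subring_set_mult[OF B_ring x[OF j] x[OF j]] z(2)] by (simp add: algebra_simps)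
    then have "Tr (z * x j) \<in> p" using trace_square_zero subring_set_mult[OF B_ring z(1) x[OF j]] by blast
    also have "Tr (z * x j) = (\<Sum>i<d. c i * G i j)"
      unfolding c(2) G_def by (rule trace_lincomb_mult) (use c xL j in auto)
    finally show ?thesis .
  qed
  then have Dc: "D * c i \<in> p" if "i < d" for i
    unfolding D by (intro cramer_in_ideal[OF A p_submod GA _ that]) auto
  have "D * z = (\<Sum>i<d. (D * c i) * x i)" using c(2) by (simp add: sum_distrib_left mult.assoc)
  also have "\<dots> \<in> pB" by (rule submod_sum[OF pM_submod]) (use Dc x in \<open>auto intro: p_times_M\<close>)
  finally have Dz: "D * z \<in> pB" .
  obtain D' where D': "D' \<in> A" "D * D' - 1 \<in> p" using R.inv_mod[OF DA] by blast
  have "D' * (D * z) - (D * D' - 1) * z \<in> pB"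
    by (rule submod_diff[OF A pM_submod submod_smult[OF pM_submod D'(1) Dz] p_times_M[OF D'(2) z(1)]])
  then show ?thesis by (simp add: algebra_simps)
qed

end

section \<open>Reducedness modulo a prime\<close>

context ext_at_prime
begin

definition reduced :: bool where
  "reduced \<longleftrightarrow> (\<forall>z\<in>B. z * z \<in> pB \<longrightarrow> z \<in> pB)"

text \<open>Minimality is measured by the dimension over \<open>A / p\<close>, so no finiteness is needed.\<close>

lemma minimal_ideal_field:
  assumes red: reduced and I: "submod B I" "I \<subseteq> B" "pB \<subseteq> I" "I \<noteq> pB"
  shows "\<exists>F. submod B F \<and> pB \<subseteq> F \<and> F \<subseteq> I \<and> F \<noteq> pB \<and> (\<forall>x\<in>F - pB. \<forall>w\<in>F. \<exists>y\<in>F. x * y - w \<in> pB)"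
proof -
  define Q where "Q F f \<longleftrightarrow> submod B F \<and> pB \<subseteq> F \<and> F \<subseteq> I \<and> F \<noteq> pB \<and> (\<exists>b. residue_basis A F p pB b f)" for F f
  have dim: "\<exists>f. Q F f" if "submod B F" "pB \<subseteq> F" "F \<subseteq> I" "F \<noteq> pB" for F
    using submodule_basis[OF submod_A_of_B[OF that(1)] _ that(2)] that I(2) unfolding Q_def by blast
  define f where "f = (LEAST f. \<exists>F. Q F f)"
  have "\<exists>f. \<exists>F. Q F f" using dim[of I] I by blast
  then have "\<exists>F. Q F f" unfolding f_def by (rule LeastI_ex)
  then obtain F where F: "Q F f" by blast
  have min: "f \<le> g" if "Q F' g" for F' g unfolding f_def using that by (intro Least_le) blast
  have FB: "submod B F" "pB \<subseteq> F" "F \<subseteq> I" "F \<noteq> pB" using F unfolding Q_def by blast+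
  have F_sub: "F \<subseteq> B" using FB I by blast
  obtain b where b: "residue_basis A F p pB b f" using F unfolding Q_def by blast
  interpret FF: linmod A p F pB
    using A p_field submod_A_of_B[OF FB(1)] pM_submod FB(2) p_times_M F_sub by unfold_locales auto
  have "\<exists>y\<in>F. x * y - w \<in> pB" if x: "x \<in> F" "x \<notin> pB" and w: "w \<in> F" for x w
  proof -
    have xB: "x \<in> B" using x F_sub by blast
    define F' where "F' = {x * y + z | y z. y \<in> F \<and> z \<in> pB}"
    have F': "submod B F'" unfolding F'_def by (rule ideal_mult_plus_pB[OF FB(1) F_sub xB])
    have sub: "F' \<subseteq> F"
    proof
      fix s assume "s \<in> F'"
      then obtain y z where "s = x * y + z" "y \<in> F" "z \<in> pB" unfolding F'_def by blast
      then show "s \<in> F" using submod_add[OF FB(1)] submod_smult[OF FB(1) xB] FB(2) by blast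
    qed
    have pF': "pB \<subseteq> F'" unfolding F'_def by (rule pB_mult_plus_pB[OF submod_0[OF FB(1)]])
    \<comment> \<open>Reducedness enters here: \<open>x F + pB\<close> contains \<open>x * x\<close>
      and so is strictly larger than \<open>pB\<close>. By minimality its dimension is that of
      \<open>F\<close>, and the two ideals coincide.\<close>
    have "x * x \<in> F'" unfolding F'_def using mult_plus_pB_mem[OF x(1)] .
    moreover have "x * x \<notin> pB" using red x xB unfolding reduced_def by blast
    ultimately obtain g where g: "Q F' g" using dim[OF F' pF'] sub FB(3) by blast
    then obtain b' where b': "residue_basis A F' p pB b' g" unfolding Q_def by blast
    interpret FF': linmod A p F' pB
      using A p_field submod_A_of_B[OF F'] pM_submod pF' p_times_M F_sub sub by unfold_locales auto
    have ind: "FF.indep g b'" and bF': "\<And>i. i < g \<Longrightarrow> b' i \<in> F'" using b' unfolding FF'.residue_basis_iff by blast+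
    have "g \<le> f" by (rule FF.indep_le_spans[of f b g b']) (use b ind bF' sub in \<open>auto simp: FF.residue_basis_iff\<close>)
    then have "g = f" using min[OF g] by simp
    have "residue_basis A F p pB b' f"
      by (rule FF.indep_card_basis[OF b]) (use ind bF' sub \<open>g = f\<close> in auto)
    then have "FF.spans f b'" unfolding FF.residue_basis_iff by blast
    then obtain c where c: "\<And>i. i < f \<Longrightarrow> c i \<in> A" "w - (\<Sum>i<f. c i * b' i) \<in> pB" using FF.spansE[OF _ w] by blast
    have "(\<Sum>i<f. c i * b' i) \<in> F'"
      by (rule submod_lincomb[OF submod_A_of_B[OF F']]) (use c(1) bF' \<open>g = f\<close> in auto)
    then have "w \<in> F'" using submod_mem_cong'[OF F' subsetD[OF pF' c(2)]] by blast
    then obtain y z where yz: "w = x * y + z" "y \<in> F" "z \<in> pB" unfolding F'_def by blast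
    then have "x * y - w = - z" by simp
    then show ?thesis using yz submod_uminus[OF B_ring pB_ideal yz(3)] by (intro bexI[of _ y]) auto
  qed
  then show ?thesis using FB by blast
qed

lemma ideal_field_locale:
  assumes F: "submod B F" "pB \<subseteq> F" "F \<subseteq> B" "F \<noteq> pB" "\<forall>x\<in>F - pB. \<forall>w\<in>F. \<exists>y\<in>F. x * y - w \<in> pB"
  shows "linfield A p F pB"
proof unfold_locales
  show "subring_set A" "field_mod A p" "submod A F" "submod A pB" "pB \<subseteq> F"
    using A p_field submod_A_of_B[OF F(1)] pM_submod F(2) by auto
  show "a * x \<in> pB" if "a \<in> p" "x \<in> F" for a x using p_times_M that F(3) by blast
  show "x * y \<in> F" if "x \<in> F" "y \<in> F" for x y using submod_smult[OF F(1)] that F(3) by blast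
  show "x * y \<in> pB" if "x \<in> pB" "y \<in> F" for x y using submod_smult_right[OF pB_ideal] that F(3) by blast
qed (use F in auto)

text \<open>Otherwise a nonzero class \<open>z\<close> is orthogonal to all of
  \<open>B / pB\<close>, and \<open>Tr\<close> takes values in \<open>p\<close> on the whole ideal
  \<open>z B + pB\<close>. That ideal contains a minimal one, \<open>F\<close>; it is a field modulo
  \<open>pB\<close>, some element has nonzero trace on it, and this trace agrees with
  \<open>Tr\<close>. Finiteness of \<open>A / p\<close> supplies the independence of the
  \<open>l\<close>-th powers.\<close>

lemma disc_not_in_p:
  assumes red: reduced and fin: "finite (cosets A p)"
  shows "\<exists>x. (\<forall>i<d. x i \<in> B) \<and> disc_tuple K L d x \<notin> p"
proof (rule ccontr)
  assume "\<not> ?thesis"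
  then obtain z where z: "z \<in> B" "z \<notin> pB" "\<forall>w\<in>B. Tr (z * w) \<in> p" using trace_radical by blast
  define I where "I = {z * y + w | y w. y \<in> B \<and> w \<in> pB}"
  have I: "submod B I" "pB \<subseteq> I"
    unfolding I_def using ideal_mult_plus_pB[OF B_self _ z(1)] pB_mult_plus_pB[OF subring_set_0[OF B_ring]] by auto
  have "z \<in> I" unfolding I_def using mult_plus_pB_mem[OF subring_set_1[OF B_ring], of z] by simp
  have trI: "Tr x \<in> p" if "x \<in> I" for x
  proof -
    obtain y w where yw: "x = z * y + w" "y \<in> B" "w \<in> pB" using \<open>x \<in> I\<close> unfolding I_def by blast
    have "z * y \<in> L" "w \<in> L" using z yw subring_set_mult[OF B_ring] B_L pB_B by blast+
    then have "Tr x = Tr (z * y) + Tr w"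
      using trace_lincomb[of 2 "\<lambda>_. 1" "\<lambda>i. if i = 0 then z * y else w"] subring_set_1[OF K_ring]
      unfolding yw(1) by (simp add: numeral_2_eq_2)
    then show ?thesis using z(3) yw trace_pB[OF yw(3)] submod_add[OF p_submod] by simp
  qed
  have IB: "I \<subseteq> B" unfolding I_def using z subring_set_mult[OF B_ring] subring_set_add[OF B_ring] pB_B by blast
  obtain F where F: "submod B F" "pB \<subseteq> F" "F \<subseteq> I" "F \<noteq> pB" "\<forall>x\<in>F - pB. \<forall>w\<in>F. \<exists>y\<in>F. x * y - w \<in> pB"
    using minimal_ideal_field[OF red I(1) IB I(2)] \<open>z \<in> I\<close> z(2) by blast
  have F_sub: "F \<subseteq> B" using F IB by blast
  interpret W: linfield A p F pB by (rule ideal_field_locale[OF F(1,2) F_sub F(4,5)])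
  obtain b f where b: "residue_basis A F p pB b f" using submodule_basis[OF submod_A_of_B[OF F(1)] F_sub F(2)] by blast
  have bF: "\<And>i. i < f \<Longrightarrow> b i \<in> F" and ind: "W.indep f b" and sp: "W.spans f b"
    using b unfolding W.residue_basis_iff by blast+
  have f: "0 < f"
  proof (rule ccontr)
    assume "\<not> 0 < f"
    then have "F \<subseteq> pB" using sp unfolding W.spans_def by auto
    then show False using F by blast
  qed
  obtain l where l: "prime l" "of_nat l \<in> p" using residue_char[OF A p_field fin] by blast
  \<comment> \<open>As \<open>A / p\<close> is perfect, the coefficients \<open>c i\<close> are
    \<open>l\<close>-th powers of some \<open>g i\<close> modulo \<open>p\<close>. The relation
    becomes \<open>y ^ l = 0\<close> modulo \<open>pB\<close> for
    \<open>y = \<Sum>i<f. g i * b i\<close>, so \<open>y\<close> vanishes and independence of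
    \<open>b\<close> applies.\<close>
  have indl: "W.indep f (\<lambda>i. b i ^ l)"
    unfolding W.indep_def
  proof (intro allI impI, elim conjE)
    fix c k assume c: "\<forall>i<f. c i \<in> A" "(\<Sum>i<f. c i * b i ^ l) \<in> pB" and k: "k < f"
    have "\<forall>i. \<exists>g. i < f \<longrightarrow> g \<in> A \<and> g ^ l - c i \<in> p"
      using frobenius_surj_mod[OF A p_field fin l] c(1) by blast
    then obtain g where g: "\<And>i. i < f \<Longrightarrow> g i \<in> A" "\<And>i. i < f \<Longrightarrow> g i ^ l - c i \<in> p" by metis
    have gb: "g i * b i \<in> B" if "i < f" for i using g(1)[OF that] bF[OF that] F_sub submod_smult[OF B_submod] by blast
    have blB: "b i ^ l \<in> B" if "i < f" for i using bF[OF that] F_sub subring_set_power[OF B_ring] by blast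
    define y where "y = (\<Sum>i<f. g i * b i)"
    have yF: "y \<in> F" unfolding y_def by (rule submod_lincomb[OF W.M]) (use g(1) bF in auto)
    have "y ^ l - (\<Sum>i<f. (g i * b i) ^ l) \<in> pB"
      unfolding y_def by (rule freshman_mod[OF B_ring pB_ideal l(1)]) (use l(2) p_pB gb in auto)
    moreover have "(\<Sum>i<f. (g i * b i) ^ l) - (\<Sum>i<f. c i * b i ^ l) \<in> pB"
    proof (rule submod_diff_sum[OF pM_submod])
      fix i assume "i \<in> {..<f}"
      then have "(g i ^ l - c i) * b i ^ l \<in> pB" using g(2) blB by (intro p_times_M) auto
      then show "(g i * b i) ^ l - c i * b i ^ l \<in> pB" by (simp add: algebra_simps power_mult_distrib)
    qed
    ultimately have yl: "y ^ l \<in> pB"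
      using submod_mem_cong'[OF pM_submod] c(2) by blast
    have "y \<in> pB"
      by (rule W.nilpotent_imp_Z[OF yF, of l]) (use yl submod_smult[OF pB_ideal] F_sub in blast)
    then have "g k \<in> p" using W.indepD[OF ind, of g k] g(1) k unfolding y_def by blast
    then have "g k ^ l \<in> p"
      using submod_smult[OF p_submod subring_set_power[OF A g(1)[OF k], of "l - 1"]] prime_gt_0_nat[OF l(1)]
      by (simp add: power_eq_if mult.commute)
    then show "c k \<in> p" using submod_mem_cong[OF A p_submod g(2)[OF k]] by blast
  qed
  obtain x where x: "x \<in> F"
    and tr: "\<forall>m. (\<forall>i<f. \<forall>j<f. m i j \<in> A) \<and> (\<forall>i<f. x * b i - (\<Sum>j<f. m i j * b j) \<in> pB) \<longrightarrow> (\<Sum>i<f. m i i) \<notin> p"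
    using W.trace_nonzero[OF b f l indl] by (elim bexE)
  have "\<forall>i. \<exists>e. i < f \<longrightarrow> (\<forall>j<f. e j \<in> A) \<and> x * b i - (\<Sum>j<f. e j * b j) \<in> pB"
    using sp W.M_mult[OF x bF] unfolding W.spans_def by blast
  then obtain m where m: "\<And>i j. i < f \<Longrightarrow> j < f \<Longrightarrow> m i j \<in> A"
    "\<And>i. i < f \<Longrightarrow> x * b i - (\<Sum>j<f. m i j * b j) \<in> pB" by metis
  have "Tr x - (\<Sum>i<f. m i i) \<in> p"
    by (rule trace_on_submodule[OF W.M F_sub F(2) b _ _ m]) (use x F_sub submod_smult_right[OF F(1)] in auto)
  moreover have "Tr x \<in> p" using trI F(3) x by blast
  ultimately have "(\<Sum>i<f. m i i) \<in> p" using submod_mem_cong[OF A p_submod] by blast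
  then show False using tr m by blast
qed

text \<open>\<open>P\<close> is the annihilator modulo \<open>pB\<close> of a minimal ideal
  \<open>F\<close> inside \<open>x B + pB\<close>; it is prime because \<open>F\<close> is a field
  modulo \<open>pB\<close>. If \<open>x\<close> annihilated \<open>F\<close>, an element
  \<open>e = x * y + w\<close> of \<open>F\<close> would have its square in \<open>pB\<close>. Hence
  for reduced \<open>B / pB\<close> the primes above \<open>p\<close> intersect in
  \<open>pB\<close>.\<close>

lemma prime_avoiding:
  assumes red: reduced and x: "x \<in> B" "x \<notin> pB"
  shows "\<exists>P. prime_set B P \<and> P \<inter> A = p \<and> x \<notin> P"
proof -
  define I where "I = {x * y + w | y w. y \<in> B \<and> w \<in> pB}"
  have I: "submod B I" "pB \<subseteq> I"
    unfolding I_def using ideal_mult_plus_pB[OF B_self _ x(1)] pB_mult_plus_pB[OF subring_set_0[OF B_ring]] by auto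
  have "x \<in> I" unfolding I_def using mult_plus_pB_mem[OF subring_set_1[OF B_ring], of x] by simp
  have IB: "I \<subseteq> B" unfolding I_def using x subring_set_mult[OF B_ring] subring_set_add[OF B_ring] pB_B by blast
  obtain F where F: "submod B F" "pB \<subseteq> F" "F \<subseteq> I" "F \<noteq> pB" "\<forall>x\<in>F - pB. \<forall>w\<in>F. \<exists>y\<in>F. x * y - w \<in> pB"
    using minimal_ideal_field[OF red I(1) IB I(2)] \<open>x \<in> I\<close> x(2) by blast
  have F_sub: "F \<subseteq> B" using F IB by blast
  obtain e where e: "e \<in> F" "e \<notin> pB" using F(2,4) by blast
  define P where "P = {y \<in> B. \<forall>g\<in>F. y * g \<in> pB}"
  have PI: "ideal_set B P"
    unfolding ideal_set_def submod_def P_def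
    using submod_0[OF pB_ideal] submod_add[OF pB_ideal] submod_smult[OF pB_ideal]
      subring_set_0[OF B_ring] subring_set_add[OF B_ring] subring_set_mult[OF B_ring]
    by (auto simp: distrib_right mult.assoc)
  have one: "1 \<notin> P" using e unfolding P_def by auto
  have prime: "a \<in> P \<or> b \<in> P" if ab: "a \<in> B" "b \<in> B" "a * b \<in> P" for a b
  proof (rule disjCI)
    assume "b \<notin> P"
    then obtain g where g: "g \<in> F" "b * g \<notin> pB" using ab unfolding P_def by blast
    have bg: "b * g \<in> F" using submod_smult[OF F(1) ab(2) g(1)] .
    have "a * w \<in> pB" if w: "w \<in> F" for w
    proof -
      obtain y where y: "y \<in> F" "b * g * y - w \<in> pB" using F(5) bg g(2) w by blast
      have 1: "y * (a * b * g) \<in> pB"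
        using submod_smult[OF pB_ideal, of y] y(1) F_sub ab(3) g(1) unfolding P_def by blast
      have 2: "a * (b * g * y - w) \<in> pB" using submod_smult[OF pB_ideal ab(1) y(2)] .
      have "y * (a * b * g) - a * (b * g * y - w) \<in> pB" by (rule submod_diff[OF A pM_submod 1 2])
      then show ?thesis by (simp add: algebra_simps)
    qed
    then show "a \<in> P" using ab(1) unfolding P_def by blast
  qed
  have P: "prime_set B P" unfolding prime_set_def using PI one prime by blast
  moreover have "x \<notin> P"
  proof
    assume xP: "x \<in> P"
    obtain y w where yw: "e = x * y + w" "y \<in> B" "w \<in> pB" using e(1) F(3) unfolding I_def by blast
    have 1: "y * (x * e) \<in> pB" using submod_smult[OF pB_ideal yw(2)] xP e(1) unfolding P_def by blast
    have 2: "e * w \<in> pB" using submod_smult[OF pB_ideal] e(1) F_sub yw(3) by blast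
    have "y * (x * e) + e * w \<in> pB" by (rule submod_add[OF pM_submod 1 2])
    also have "y * (x * e) + e * w = e * (x * y + w)" by (simp add: algebra_simps)
    finally have "e * e \<in> pB" using yw(1) by simp
    then show False using red e F_sub unfolding reduced_def by blast
  qed
  moreover have "P \<inter> A = p"
  proof
    show "p \<subseteq> P \<inter> A" using p_times_M F_sub p_subset A_B unfolding P_def by blast
    show "P \<inter> A \<subseteq> p"
    proof
      fix a assume a: "a \<in> P \<inter> A"
      show "a \<in> p"
      proof (rule ccontr)
        assume "a \<notin> p"
        then obtain a' where a': "a' \<in> A" "a * a' - 1 \<in> p" using R.inv_mod[of a] a by blast
        have "a' * (a * e) - (a * a' - 1) * e \<in> pB"
          by (rule submod_diff[OF A pM_submod submod_smult[OF pM_submod a'(1)] p_times_M[OF a'(2)]])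
            (use a e F_sub in \<open>auto simp: P_def\<close>)
        then show False using e(2) by (simp add: algebra_simps)
      qed
    qed
  qed
  ultimately show ?thesis by blast
qed

end

section \<open>Counting residue classes\<close>

context linmod
begin

lemma card_cosets_basis:
  assumes b: "residue_basis A M p Z y f" and fin: "finite (cosets A p)"
  shows "finite (cosets M Z) \<and> card (cosets M Z) = card (cosets A p) ^ f"
proof -
  have yM: "\<And>i. i < f \<Longrightarrow> y i \<in> M" and ind: "indep f y" and sp: "spans f y"
    using b unfolding residue_basis_iff by blast+
  \<comment> \<open>Coordinate tuples are functions into the set of cosets of \<open>p\<close>;
    \<open>r\<close> chooses a lift of each class.\<close>
  define r where "r X = (SOME a. a \<in> X)" for X :: "'a set"
  have r: "r X \<in> A" "{a \<in> A. a - r X \<in> p} = X" if X: "X \<in> cosets A p" for X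
  proof -
    obtain a where a: "a \<in> A" "X = {w \<in> A. w - a \<in> p}" using X unfolding cosets_def by blast
    then have "a \<in> X" using submod_0[OF p_sub] by simp
    then have "r X \<in> X" unfolding r_def by (rule someI)
    then have "r X \<in> A" "r X - a \<in> p" using a by blast+
    then show "r X \<in> A" "{a \<in> A. a - r X \<in> p} = X" using coset_eq_iff[OF A p_sub, of "r X" A a] a by auto
  qed
  define phi where "phi h = {w \<in> M. w - (\<Sum>i<f. r (h i) * y i) \<in> Z}" for h
  let ?D = "{..<f} \<rightarrow>\<^sub>E cosets A p"
  have hA: "r (h i) \<in> A" if "h \<in> ?D" "i < f" for h i using r that by auto
  have hM: "(\<Sum>i<f. r (h i) * y i) \<in> M" if "h \<in> ?D" for h
    by (rule submod_lincomb[OF M]) (use hA[OF that] yM in auto)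
  have bij: "bij_betw phi ?D (cosets M Z)"
  proof (rule bij_betwI')
    fix h k assume hk: "h \<in> ?D" "k \<in> ?D"
    show "(phi h = phi k) = (h = k)"
    proof
      assume "phi h = phi k"
      then have "(\<Sum>i<f. r (h i) * y i) - (\<Sum>i<f. r (k i) * y i) \<in> Z"
        unfolding phi_def using coset_eq_iff[OF A Z hM[OF hk(1)] hM[OF hk(2)]] by simp
      then have s: "(\<Sum>i<f. (r (h i) - r (k i)) * y i) \<in> Z" by (simp add: sum_subtractf left_diff_distrib)
      show "h = k"
      proof (rule PiE_ext[OF hk])
        fix i assume i: "i \<in> {..<f}"
        have "r (h i) - r (k i) \<in> p"
          by (rule indepD[OF ind _ s]) (use i hA hk in \<open>auto intro!: subring_set_diff[OF A]\<close>)
        then have "{a \<in> A. a - r (h i) \<in> p} = {a \<in> A. a - r (k i) \<in> p}"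
          using coset_eq_iff[OF A p_sub] hA hk i by auto
        moreover have "h i \<in> cosets A p" "k i \<in> cosets A p" using hk i by auto
        ultimately show "h i = k i" using r(2)[of "h i"] r(2)[of "k i"] by simp
      qed
    qed simp
  next
    fix h assume "h \<in> ?D"
    then show "phi h \<in> cosets M Z" using hM unfolding phi_def cosets_def by blast
  next
    fix X assume "X \<in> cosets M Z"
    then obtain x where x: "x \<in> M" "X = {w \<in> M. w - x \<in> Z}" unfolding cosets_def by blast
    obtain c where c: "\<And>i. i < f \<Longrightarrow> c i \<in> A" "x - (\<Sum>i<f. c i * y i) \<in> Z" using spansE[OF sp x(1)] by blast
    define h where "h = (\<lambda>i\<in>{..<f}. {a \<in> A. a - c i \<in> p})"
    have h: "h \<in> ?D" unfolding h_def cosets_def using c(1) by auto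
    have "c i - r (h i) \<in> p" if i: "i < f" for i
    proof -
      have "h i \<in> cosets A p" using h i by auto
      then have "{a \<in> A. a - r (h i) \<in> p} = h i" by (rule r(2))
      also have "h i = {a \<in> A. a - c i \<in> p}" using i by (simp add: h_def)
      finally show ?thesis using coset_eq_iff[OF A p_sub, of "c i" A "r (h i)"] c(1)[OF i] hA[OF h i] by simp
    qed
    then have "(\<Sum>i<f. (c i - r (h i)) * y i) \<in> Z" using yM by (intro submod_sum[OF Z] pM) auto
    then have "(\<Sum>i<f. c i * y i) - (\<Sum>i<f. r (h i) * y i) \<in> Z" by (simp add: sum_subtractf left_diff_distrib)
    then have "x - (\<Sum>i<f. r (h i) * y i) \<in> Z" using submod_trans[OF Z c(2)] by blast
    then have "X = phi h" unfolding phi_def x(2) using coset_eq_iff[OF A Z x(1) hM[OF h]] by simp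
    then show "\<exists>h\<in>?D. X = phi h" using h by blast
  qed
  have "finite ?D" using fin by (intro finite_PiE) auto
  moreover have "card ?D = card (cosets A p) ^ f" by (simp add: card_PiE)
  ultimately show ?thesis using bij_betw_same_card[OF bij] bij_betw_finite[OF bij] by simp
qed

end

text \<open>Chinese remainder theorem, with \<open>g\<close> and \<open>h\<close> witnessing
  comaximality. Finiteness is an equivalence because it is used both ways: downwards from
  \<open>n\<close> to its factors in \<open>A\<close>, upwards from the factors of
  \<open>n B\<close> in \<open>B\<close>.\<close>

lemma card_cosets_crt:
  assumes B: "subring_set B" and I: "ideal_set B I" and J: "ideal_set B J"
    and g: "g \<in> I" "h \<in> J" "g + h = 1"
  shows "card (cosets B (I \<inter> J)) = card (cosets B I) * card (cosets B J)"
    and "finite (cosets B (I \<inter> J)) \<longleftrightarrow> finite (cosets B I \<times> cosets B J)"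
proof -
  have IJ: "submod B I" "submod B J" "I \<subseteq> B" "J \<subseteq> B" using I J unfolding ideal_set_def by blast+
  have K: "submod B (I \<inter> J)" using IJ unfolding submod_def by blast
  let ?c = "\<lambda>Z x. {w \<in> B. w - x \<in> Z}"
  have cap: "?c I x \<inter> ?c J x = ?c (I \<inter> J) x" for x by blast
  have comb: "\<exists>z\<in>B. ?c I z = ?c I x \<and> ?c J z = ?c J y" if xy: "x \<in> B" "y \<in> B" for x y
  proof (rule bexI[of _ "h * x + g * y"])
    have gh: "g \<in> B" "h \<in> B" using g IJ by blast+
    show zB: "h * x + g * y \<in> B" using gh xy subring_set_add[OF B] subring_set_mult[OF B] by blast
    have h: "h = 1 - g" using g(3) by (simp add: eq_diff_eq add.commute)
    have "h * x + g * y - x = g * (y - x)" unfolding h by (simp add: algebra_simps)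
    also have "\<dots> \<in> I" using submod_smult_right[OF IJ(1) subring_set_diff[OF B xy(2,1)] g(1)] .
    finally have 1: "h * x + g * y - x \<in> I" .
    have g': "g = 1 - h" using g(3) by (simp add: eq_diff_eq)
    have "h * x + g * y - y = h * (x - y)" unfolding g' by (simp add: algebra_simps)
    also have "\<dots> \<in> J" using submod_smult_right[OF IJ(2) subring_set_diff[OF B xy] g(2)] .
    finally have 2: "h * x + g * y - y \<in> J" .
    show "?c I (h * x + g * y) = ?c I x \<and> ?c J (h * x + g * y) = ?c J y"
      using coset_eq_iff[OF B IJ(1) zB xy(1)] coset_eq_iff[OF B IJ(2) zB xy(2)] 1 2 by blast
  qed
  have bij: "bij_betw (\<lambda>(X, Y). X \<inter> Y) (cosets B I \<times> cosets B J) (cosets B (I \<inter> J))"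
  proof (rule bij_betwI')
    fix S T assume S: "S \<in> cosets B I \<times> cosets B J" and T: "T \<in> cosets B I \<times> cosets B J"
    have rep: "\<exists>z\<in>B. X = (?c I z, ?c J z)" if X: "X \<in> cosets B I \<times> cosets B J" for X
    proof -
      obtain x y where xy: "x \<in> B" "y \<in> B" "X = (?c I x, ?c J y)" using X unfolding cosets_def by blast
      obtain z where "z \<in> B" "?c I z = ?c I x \<and> ?c J z = ?c J y" using comb[OF xy(1,2)] by (elim bexE)
      then show ?thesis unfolding xy(3) by (intro bexI[of _ z]) simp_all
    qed
    obtain x where x: "x \<in> B" "S = (?c I x, ?c J x)" using rep[OF S] by blast
    obtain y where y: "y \<in> B" "T = (?c I y, ?c J y)" using rep[OF T] by blast
    show "((case S of (X, Y) \<Rightarrow> X \<inter> Y) = (case T of (X, Y) \<Rightarrow> X \<inter> Y)) = (S = T)"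
      using coset_eq_iff[OF B IJ(1) x(1) y(1)] coset_eq_iff[OF B IJ(2) x(1) y(1)] coset_eq_iff[OF B K x(1) y(1)]
      unfolding x(2) y(2) prod.case cap by auto
    show "(case S of (X, Y) \<Rightarrow> X \<inter> Y) \<in> cosets B (I \<inter> J)"
      unfolding x(2) prod.case cap using x(1) unfolding cosets_def by blast
  next
    fix S assume "S \<in> cosets B (I \<inter> J)"
    then obtain x where x: "x \<in> B" "S = ?c (I \<inter> J) x" unfolding cosets_def by blast
    then show "\<exists>T\<in>cosets B I \<times> cosets B J. S = (case T of (X, Y) \<Rightarrow> X \<inter> Y)"
      by (intro bexI[of _ "(?c I x, ?c J x)"]) (auto simp: cosets_def)
  qed
  show "card (cosets B (I \<inter> J)) = card (cosets B I) * card (cosets B J)"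
    using bij_betw_same_card[OF bij] by (simp add: card_cartesian_product)
  show "finite (cosets B (I \<inter> J)) \<longleftrightarrow> finite (cosets B I \<times> cosets B J)"
    using bij_betw_finite[OF bij] by simp
qed

section \<open>Extension of squarefree ideals\<close>

definition gen_ideal :: "'a::field set \<Rightarrow> 'a set \<Rightarrow> 'a set" where
  "gen_ideal B S = \<Inter>{I. ideal_set B I \<and> S \<subseteq> I}"

lemma ideal_set_self: "subring_set B \<Longrightarrow> ideal_set B B"
  by (simp add: ideal_set_def submod_self)

lemma gen_ideal_minimal: "ideal_set B I \<Longrightarrow> S \<subseteq> I \<Longrightarrow> gen_ideal B S \<subseteq> I"
  unfolding gen_ideal_def by blast

lemma gen_ideal_superset: "S \<subseteq> gen_ideal B S"
  unfolding gen_ideal_def by blast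

lemma gen_ideal_ideal:
  assumes "subring_set B" "S \<subseteq> B"
  shows "ideal_set B (gen_ideal B S)"
proof -
  have "gen_ideal B S \<subseteq> B" by (rule gen_ideal_minimal[OF ideal_set_self[OF assms(1)] assms(2)])
  then show ?thesis unfolding ideal_set_def submod_def gen_ideal_def by blast
qed

lemma ideal_set_one: "subring_set B \<Longrightarrow> ideal_set B I \<Longrightarrow> 1 \<in> I \<Longrightarrow> I = B"
  unfolding ideal_set_def submod_def by (metis mult.right_neutral subsetI subset_antisym)

lemma cosets_self: "subring_set B \<Longrightarrow> cosets B B = {B}"
  unfolding cosets_def using subring_set_0 subring_set_diff by fastforce

lemma card_cosets_ge_2:
  assumes A: "subring_set A" and p: "submod A p" "1 \<notin> p" and fin: "finite (cosets A p)"
  shows "2 \<le> card (cosets A p)"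
proof -
  have "{w \<in> A. w - 1 \<in> p} \<noteq> {w \<in> A. w - 0 \<in> p}"
    using coset_eq_iff[OF A p(1) subring_set_1[OF A] subring_set_0[OF A]] p(2) by simp
  moreover have "{{w \<in> A. w - 1 \<in> p}, {w \<in> A. w - 0 \<in> p}} \<subseteq> cosets A p"
    unfolding cosets_def using subring_set_0[OF A] subring_set_1[OF A] by blast
  ultimately show ?thesis
    using card_mono[OF fin, of "{{w \<in> A. w - 1 \<in> p}, {w \<in> A. w - 0 \<in> p}}"] by simp
qed

text \<open>Identifies the description by \<open>t\<close> with the extended ideal:
  \<open>x = x * u + (t * x) * v\<close> with \<open>u\<close> and \<open>v\<close> in
  \<open>p\<close>.\<close>

lemma (in ext_at_prime) gen_ideal_p: "gen_ideal B p = pB"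
proof
  show "gen_ideal B p \<subseteq> pB"
    using gen_ideal_minimal[of B pB p] pB_ideal pB_B p_pB unfolding ideal_set_def by blast
  have G: "submod B (gen_ideal B p)"
    using gen_ideal_ideal[OF B_ring, of p] p_subset A_B unfolding ideal_set_def by blast
  show "pB \<subseteq> gen_ideal B p"
  proof
    fix x assume x: "x \<in> pB"
    have "x * u \<in> gen_ideal B p" "t * x * v \<in> gen_ideal B p"
      using x u v gen_ideal_superset[of p B] submod_smult[OF G] pB_iff by blast+
    then have "x * u + t * x * v \<in> gen_ideal B p" by (rule submod_add[OF G])
    also have "x * u + t * x * v = x * (u + t * v)" by (simp add: algebra_simps)
    finally show "x \<in> gen_ideal B p" using uv by simp
  qed
qed

lemma (in dedekind_ext) ext_at_primeI: "dedekind_prime A K p t u v \<Longrightarrow> ext_at_prime A K L p d t u v"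
  using dedekind_ext_axioms unfolding ext_at_prime_def by blast

text \<open>\<open>J\<close> is the ideal quotient of \<open>n\<close> by \<open>p\<close>, and it
  contains the product of \<open>n\<close> with the inverse \<open>A + t A\<close> of
  \<open>p\<close>.\<close>

lemma (in dedekind_prime) colon_props:
  assumes n: "ideal_set A n" "n \<subseteq> p"
  defines "J \<equiv> {x \<in> A. \<forall>a\<in>p. x * a \<in> n}"
  shows "ideal_set A J" "n \<subseteq> J" "\<And>x. x \<in> n \<Longrightarrow> t * x \<in> J"
proof -
  have nI: "submod A n" "n \<subseteq> A" using n unfolding ideal_set_def by blast+
  show "ideal_set A J"
    unfolding ideal_set_def submod_def J_def
    using subring_set_0[OF A] subring_set_add[OF A] subring_set_mult[OF A] submod_0[OF nI(1)] submod_add[OF nI(1)] submod_smult[OF nI(1)]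
    by (auto simp: distrib_right mult.assoc)
  show "n \<subseteq> J" unfolding J_def using nI submod_smult_right[OF nI(1)] p_subset by blast
  show "t * x \<in> J" if "x \<in> n" for x
  proof -
    have "t * x * a \<in> n" if "a \<in> p" for a
      using submod_smult[OF nI(1) tp[OF that] \<open>x \<in> n\<close>] by (simp add: ac_simps)
    moreover have "t * x \<in> A" using tp that n(2) by blast
    ultimately show ?thesis unfolding J_def by blast
  qed
qed

context dedekind_ext
begin

text \<open>Write \<open>x = g * x + h * x\<close>: an element of \<open>p\<close> times one of the
  extension of \<open>J\<close> lies in the extension of \<open>p \<inter> J\<close>, and likewise
  with the roles exchanged.\<close>

lemma extension_of_coprime_intersection:
  assumes p: "ideal_set A p" and J: "ideal_set A J" and gh: "g \<in> p" "h \<in> J" "g + h = 1"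
  shows "gen_ideal B (p \<inter> J) = gen_ideal B p \<inter> gen_ideal B J"
proof
  have sub: "p \<subseteq> A" "J \<subseteq> A" "submod A p" "submod A J" using p J unfolding ideal_set_def by blast+
  have idl: "submod B (gen_ideal B I)" "gen_ideal B I \<subseteq> B" if "I \<subseteq> A" for I
    using gen_ideal_ideal[OF B_ring, of I] that A_B unfolding ideal_set_def by blast+
  note n = idl[of "p \<inter> J"]
  \<comment> \<open>\<open>gen_ideal\<close> is an intersection and offers no explicit elements.
    Instead the set \<open>?S\<close> of all \<open>x\<close> that \<open>I\<close> multiplies into
    the extension of \<open>p \<inter> J\<close> is shown to be an ideal containing
    \<open>I'\<close>.\<close>
  have mult: "c * x \<in> gen_ideal B (p \<inter> J)"
    if "c \<in> I" "x \<in> gen_ideal B I'" "I \<subseteq> A" "I' \<subseteq> A" "\<And>a b. a \<in> I \<Longrightarrow> b \<in> I' \<Longrightarrow> a * b \<in> p \<inter> J" for c x I I'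
  proof -
    let ?S = "{x \<in> B. \<forall>c\<in>I. c * x \<in> gen_ideal B (p \<inter> J)}"
    have smult: "a * x \<in> ?S" if a: "a \<in> B" and x: "x \<in> ?S" for a x
    proof -
      have "c * (a * x) \<in> gen_ideal B (p \<inter> J)" if "c \<in> I" for c
      proof -
        have "a * (c * x) \<in> gen_ideal B (p \<inter> J)" using a x that submod_smult[OF n(1)] sub by blast
        then show ?thesis by (simp add: mult.left_commute)
      qed
      then show ?thesis using a x subring_set_mult[OF B_ring] by blast
    qed
    have nS: "submod B (gen_ideal B (p \<inter> J))" using n(1) sub by blast
    have "ideal_set B ?S"
      unfolding ideal_set_def submod_def
      using smult subring_set_0[OF B_ring] subring_set_add[OF B_ring] submod_0[OF nS] submod_add[OF nS]
      by (auto simp: distrib_left)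
    moreover have "I' \<subseteq> ?S" using that A_B gen_ideal_superset[of "p \<inter> J" B] by blast
    ultimately have "gen_ideal B I' \<subseteq> ?S" by (rule gen_ideal_minimal)
    then show ?thesis using that by blast
  qed
  show "gen_ideal B (p \<inter> J) \<subseteq> gen_ideal B p \<inter> gen_ideal B J"
    unfolding gen_ideal_def by blast
  show "gen_ideal B p \<inter> gen_ideal B J \<subseteq> gen_ideal B (p \<inter> J)"
  proof
    fix x assume x: "x \<in> gen_ideal B p \<inter> gen_ideal B J"
    have "g * x \<in> gen_ideal B (p \<inter> J)"
      by (rule mult[of g p x J]) (use gh x sub submod_smult submod_smult_right in blast)+
    moreover have "h * x \<in> gen_ideal B (p \<inter> J)"
      by (rule mult[of h J x p]) (use gh x sub submod_smult submod_smult_right in blast)+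
    ultimately have "g * x + h * x \<in> gen_ideal B (p \<inter> J)" using submod_add[OF n(1)] sub by blast
    then show "x \<in> gen_ideal B (p \<inter> J)" using gh(3) by (simp flip: distrib_right)
  qed
qed

text \<open>For a squarefree \<open>n\<close> contained in the prime \<open>p\<close>, the ideal \<open>J = (n : p)\<close> is not contained in \<open>p\<close>, so that
  \<open>n = p \<inter> J\<close> with \<open>p\<close> and \<open>J\<close> comaximal; this allows induction on the norm.\<close>

lemma squarefree_extension:
  assumes "ideal_set A n" "n \<noteq> {0}" "finite (cosets A n)"
    and "\<And>p t u v. dedekind_prime A K p t u v \<Longrightarrow> \<exists>x\<in>n. x \<notin> p \<or> t * x \<notin> p"
  shows "finite (cosets B (gen_ideal B n)) \<and>
    card (cosets B (gen_ideal B n)) = card (cosets A n) ^ d \<and>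
    (\<forall>x\<in>B. (\<forall>p t u v. dedekind_prime A K p t u v \<longrightarrow> n \<subseteq> p \<longrightarrow> t * x \<in> B) \<longrightarrow> x \<in> gen_ideal B n)"
  using assms
proof (induction "card (cosets A n)" arbitrary: n rule: less_induct)
  case less
  have nI: "submod A n" "n \<subseteq> A" using less.prems(1) unfolding ideal_set_def by blast+
  show ?case
  proof (cases "1 \<in> n")
    case True
    then have "n = A" using ideal_set_one[OF A less.prems(1)] by blast
    moreover have "gen_ideal B n = B"
      using ideal_set_one[OF B_ring gen_ideal_ideal[OF B_ring]] nI A_B gen_ideal_superset[of n B] True by blast
    ultimately show ?thesis using cosets_self[OF A] cosets_self[OF B_ring] by simp
  next
    case False
    obtain p where p: "prime_set A p" "n \<subseteq> p" using prime_above[OF less.prems(1) False] by blast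
    have "p \<noteq> {0}" using p(2) less.prems(2) submod_0[OF nI(1)] by blast
    then obtain t u v where dp: "dedekind_prime A K p t u v" using dedekind_prime_exists[OF p(1)] by blast
    interpret E: ext_at_prime A K L p d t u v by (rule ext_at_primeI[OF dp])
    define J where "J = {x \<in> A. \<forall>a\<in>p. x * a \<in> n}"
    note J = E.colon_props[OF less.prems(1) p(2), folded J_def]
    have Jsub: "submod A J" "J \<subseteq> A" using J(1) unfolding ideal_set_def by blast+
    \<comment> \<open>Squarefreeness in its working form: not all of \<open>n\<close> and
      \<open>t n\<close> lie in \<open>p\<close>. As \<open>n \<subseteq> p\<close>, the element
      \<open>t x\<close> of \<open>J\<close> is outside \<open>p\<close>, which makes
      \<open>p\<close> and \<open>J\<close> comaximal. The condition passes to \<open>J\<close>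
      because \<open>J\<close> contains \<open>n\<close>.\<close>
    obtain x where x: "x \<in> n" "x \<notin> p \<or> t * x \<notin> p" using less.prems(4)[OF dp] by blast
    then have tx: "t * x \<in> J" "t * x \<notin> p" using J(3) p(2) by blast+
    then obtain s where s: "s \<in> A" "t * x * s - 1 \<in> p" using E.R.inv_mod[of "t * x"] Jsub by blast
    define g where "g = - (t * x * s - 1)"
    define h where "h = t * x * s"
    have gh: "g \<in> p" "h \<in> J" "g + h = 1"
      using submod_uminus[OF A E.p_submod s(2)] submod_smult_right[OF Jsub(1) s(1) tx(1)] by (auto simp: g_def h_def)
    have nJ: "n = p \<inter> J"
    proof
      show "n \<subseteq> p \<inter> J" using p(2) J(2) by blast
      show "p \<inter> J \<subseteq> n"
      proof
        fix y assume y: "y \<in> p \<inter> J"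
        then have "y * g \<in> n" "h * y \<in> n" using gh unfolding J_def by blast+
        then have "y * g + h * y \<in> n" by (rule submod_add[OF nI(1)])
        also have "y * g + h * y = y * (g + h)" by (simp add: algebra_simps)
        finally show "y \<in> n" using gh(3) by simp
      qed
    qed
    have pI: "ideal_set A p" using p(1) unfolding prime_set_def by blast
    note crtA = card_cosets_crt[OF A pI J(1) gh, folded nJ]
    have ne: "cosets A I \<noteq> {}" for I unfolding cosets_def using subring_set_1[OF A] by blast
    have fin2: "finite (cosets A p \<times> cosets A J)" using crtA(2) less.prems(3) by simp
    have finp: "finite (cosets A p)" by (rule finite_cartesian_productD1[OF fin2 ne])
    have finJ: "finite (cosets A J)" by (rule finite_cartesian_productD2[OF fin2 ne])
    have "2 \<le> card (cosets A p)" by (rule card_cosets_ge_2[OF A E.p_submod E.one_notin_p finp])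
    moreover have "0 < card (cosets A J)" using finJ ne by (simp add: card_gt_0_iff)
    ultimately have "card (cosets A J) < card (cosets A n)"
      unfolding crtA(1) using n_less_m_mult_n[of "card (cosets A J)" "card (cosets A p)"] by simp
    moreover have "J \<noteq> {0}" using J(2) less.prems(2) submod_0[OF nI(1)] by blast
    ultimately have IH: "finite (cosets B (gen_ideal B J)) \<and>
        card (cosets B (gen_ideal B J)) = card (cosets A J) ^ d \<and>
        (\<forall>x\<in>B. (\<forall>p t u v. dedekind_prime A K p t u v \<longrightarrow> J \<subseteq> p \<longrightarrow> t * x \<in> B) \<longrightarrow> x \<in> gen_ideal B J)"
      by (rule less.hyps[OF _ J(1) _ finJ]) (use less.prems(4) J(2) in blast)
    have gen: "gen_ideal B n = E.pB \<inter> gen_ideal B J"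
      using extension_of_coprime_intersection[OF pI J(1) gh] unfolding nJ[symmetric] E.gen_ideal_p .
    have pBI: "ideal_set B E.pB" using E.pB_ideal E.pB_B unfolding ideal_set_def by blast
    have JBI: "ideal_set B (gen_ideal B J)" using gen_ideal_ideal[OF B_ring] Jsub A_B by blast
    have gh': "g \<in> E.pB" "h \<in> gen_ideal B J" using gh E.p_pB gen_ideal_superset[of J B] by blast+
    note crtB = card_cosets_crt[OF B_ring pBI JBI gh' gh(3), folded gen]
    obtain w where "residue_basis A B p E.pB w d" using E.residue_basis_exists by blast
    then have cp: "finite (cosets B E.pB)" "card (cosets B E.pB) = card (cosets A p) ^ d"
      using E.R.card_cosets_basis finp by blast+
    show ?thesis
    proof (intro conjI ballI impI)
      show "finite (cosets B (gen_ideal B n))" using crtB(2) cp(1) IH by blast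
      show "card (cosets B (gen_ideal B n)) = card (cosets A n) ^ d"
        unfolding crtB(1) crtA(1) using cp(2) IH by (simp add: power_mult_distrib)
      fix y assume y: "y \<in> B" and all: "\<forall>p t u v. dedekind_prime A K p t u v \<longrightarrow> n \<subseteq> p \<longrightarrow> t * y \<in> B"
      have "y \<in> E.pB" using all dp p(2) y E.pB_iff by blast
      moreover have "y \<in> gen_ideal B J" using IH y all J(2) by blast
      ultimately show "y \<in> gen_ideal B n" unfolding gen by blast
    qed
  qed
qed

text \<open>Independence modulo \<open>P\<close> implies independence modulo \<open>pB\<close>, so
  \<open>d\<close> bounds the dimension of \<open>B / P\<close> and a residue basis exists.
  Uniqueness of its size evaluates the \<open>THE\<close> in \<open>residue_degree\<close>.\<close>

lemma residue_degree_props: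
  assumes P: "prime_set B P" "P \<inter> A = p" and p: "prime_set A p" "p \<noteq> {0}" and fin: "finite (cosets A p)"
  shows "finite (cosets B P) \<and> card (cosets B P) = card (cosets A p) ^ residue_degree A B p P"
proof -
  obtain t u v where dp: "dedekind_prime A K p t u v" using dedekind_prime_exists[OF p] by blast
  interpret E: ext_at_prime A K L p d t u v by (rule ext_at_primeI[OF dp])
  have PI: "ideal_set B P" "submod B P" "P \<subseteq> B" using P(1) unfolding prime_set_def ideal_set_def by blast+
  have pBP: "E.pB \<subseteq> P" using gen_ideal_minimal[OF PI(1), of p] P(2) E.gen_ideal_p by blast
  interpret Q: linmod A p B P
    using A E.p_field B_submod E.submod_A_of_B[OF PI(2)] PI(3) E.p_times_M pBP by unfold_locales auto
  have "\<exists>z m. 0 \<le> m \<and> (\<forall>i<0. z i = (0::'a)) \<and> residue_basis A B p P z m"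
  proof (rule Q.extend_to_basis[where D = d])
    show "m \<le> d" if "\<forall>i<m. z i \<in> B" "Q.indep m z" for m z
    proof (rule E.indep_le_degree)
      show "E.R.indep m z" unfolding E.R.indep_def using that(2)[unfolded Q.indep_def] pBP by blast
    qed (use that in auto)
  qed (auto simp: Q.indep_def)
  then obtain z f where b: "residue_basis A B p P z f" by blast
  have "residue_degree A B p P = f"
    unfolding residue_degree_def
    by (rule the_equality) (use b Q.basis_size_unique[OF _ b] in blast)+
  then show ?thesis using Q.card_cosets_basis[OF b fin] by simp
qed

end

section \<open>Quotient rings\<close>

lemma ring_of_simps [simp]:
  "carrier (ring_of S) = S" "x \<otimes>\<^bsub>ring_of S\<^esub> y = x * y" "\<one>\<^bsub>ring_of S\<^esub> = 1"
  "\<zero>\<^bsub>ring_of S\<^esub> = 0" "x \<oplus>\<^bsub>ring_of S\<^esub> y = x + y"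
  unfolding ring_of_def by simp_all

lemma cring_ring_of:
  assumes S: "subring_set S"
  shows "cring (ring_of S)"
proof (rule cringI)
  show "abelian_group (ring_of S)"
    by (rule abelian_groupI)
      (use S in \<open>auto simp: subring_set_intros algebra_simps intro!: bexI[of _ "- _"]\<close>)
  show "comm_monoid (ring_of S)"
    by (rule comm_monoidI) (use S in \<open>auto simp: subring_set_intros algebra_simps\<close>)
qed (simp add: algebra_simps)

lemma subring_set_of_ring:
  assumes "ring (ring_of S)"
  shows "subring_set S"
proof -
  interpret ring "ring_of S" by fact
  have neg: "- x \<in> S" if "x \<in> S" for x
  proof -
    have "\<ominus>\<^bsub>ring_of S\<^esub> x \<in> S" using a_inv_closed[of x] that by simp
    moreover have "\<ominus>\<^bsub>ring_of S\<^esub> x + x = 0" using l_neg[of x] that by simp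
    ultimately show ?thesis by (metis add_eq_0_iff2)
  qed
  show ?thesis
    unfolding subring_set_def
    using one_closed m_closed a_closed neg by (auto simp: diff_conv_add_uminus simp del: add_uminus_conv_diff)
qed

lemma ideal_ring_of_iff:
  assumes S: "subring_set S"
  shows "ideal I (ring_of S) \<longleftrightarrow> ideal_set S I"
proof
  assume "ideal I (ring_of S)"
  then interpret ideal I "ring_of S" .
  show "ideal_set S I"
    unfolding ideal_set_def submod_def
    using additive_subgroup.zero_closed[OF is_additive_subgroup]
      additive_subgroup.a_closed[OF is_additive_subgroup] I_l_closed a_subset by auto
next
  assume I: "ideal_set S I"
  then have I': "submod S I" "I \<subseteq> S" unfolding ideal_set_def by blast+
  interpret cring "ring_of S" by (rule cring_ring_of[OF S])
  show "ideal I (ring_of S)"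
  proof (rule idealI)
    show "subgroup I (add_monoid (ring_of S))"
    proof (rule group.subgroupI)
      show "group (add_monoid (ring_of S))" by (rule add.is_group)
      show "inv\<^bsub>add_monoid (ring_of S)\<^esub> a \<in> I" if "a \<in> I" for a
      proof -
        have "\<ominus>\<^bsub>ring_of S\<^esub> a = - a"
          by (rule minus_equality) (use that I' subring_set_uminus[OF S] in auto)
        then have "inv\<^bsub>add_monoid (ring_of S)\<^esub> a = - a" by (simp add: a_inv_def)
        then show ?thesis using submod_uminus[OF S I'(1) that] by simp
      qed
    qed (use I' submod_0 submod_add in auto)
  qed (use I' submod_smult submod_smult_right ring_axioms in auto)
qed

lemma primeideal_ring_of_iff:
  assumes S: "subring_set S"
  shows "primeideal P (ring_of S) \<longleftrightarrow> prime_set S P"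
proof
  assume "primeideal P (ring_of S)"
  then interpret primeideal P "ring_of S" .
  have "ideal_set S P" using is_ideal ideal_ring_of_iff[OF S] by blast
  moreover have "1 \<notin> P" using ideal_set_one[OF S calculation] I_notcarr by auto
  ultimately show "prime_set S P" unfolding prime_set_def using I_prime by auto
next
  assume P: "prime_set S P"
  then have "ideal P (ring_of S)" using ideal_ring_of_iff[OF S] unfolding prime_set_def by blast
  then show "primeideal P (ring_of S)"
    by (rule primeidealI[OF _ cring_ring_of[OF S]])
      (use P subring_set_1[OF S] in \<open>auto simp: prime_set_def\<close>)
qed

lemma genideal_ring_of:
  assumes S: "subring_set S"
  shows "genideal (ring_of S) X = gen_ideal S X"
  unfolding genideal_def gen_ideal_def ideal_ring_of_iff[OF S] ..

lemma a_r_coset_ring_of: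
  assumes S: "subring_set S" and I: "ideal_set S I" and x: "x \<in> S"
  shows "I +>\<^bsub>ring_of S\<^esub> x = {y \<in> S. y - x \<in> I}"
proof -
  have "I \<subseteq> S" using I unfolding ideal_set_def by blast
  have "y \<in> (\<Union>h\<in>I. {h + x})" if "y - x \<in> I" for y
    using that by (intro UN_I[of "y - x"]) auto
  then show ?thesis
    unfolding a_r_coset_def' using \<open>I \<subseteq> S\<close> x subring_set_add[OF S] by auto
qed

lemma carrier_Quot_ring_of:
  assumes "subring_set S" "ideal_set S I"
  shows "carrier (ring_of S Quot I) = cosets S I"
  unfolding FactRing_def A_RCOSETS_def' cosets_def using a_r_coset_ring_of[OF assms] by auto

context
  fixes S I :: "'a::field set"
  assumes S: "subring_set S" and I: "ideal_set S I"
begin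

interpretation Q: ideal I "ring_of S" using I ideal_ring_of_iff[OF S] by blast

lemma Quot_mult:
  "x \<in> S \<Longrightarrow> y \<in> S \<Longrightarrow> (I +>\<^bsub>ring_of S\<^esub> x) \<otimes>\<^bsub>ring_of S Quot I\<^esub> (I +>\<^bsub>ring_of S\<^esub> y) = I +>\<^bsub>ring_of S\<^esub> (x * y)"
  using Q.rcoset_mult_add[of x y] by (simp add: FactRing_def)

lemma Quot_one: "\<one>\<^bsub>ring_of S Quot I\<^esub> = I +>\<^bsub>ring_of S\<^esub> 1"
  by (simp add: FactRing_def)

lemma Quot_zero: "\<zero>\<^bsub>ring_of S Quot I\<^esub> = I"
  by (simp add: FactRing_def)

lemma Quot_carrier: "carrier (ring_of S Quot I) = (\<lambda>x. I +>\<^bsub>ring_of S\<^esub> x) ` S"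
  unfolding FactRing_def A_RCOSETS_def' by auto

lemma Quot_eq_iff: "x \<in> S \<Longrightarrow> y \<in> S \<Longrightarrow> I +>\<^bsub>ring_of S\<^esub> x = I +>\<^bsub>ring_of S\<^esub> y \<longleftrightarrow> x - y \<in> I"
  using coset_eq_iff[OF S, of I x S y] I unfolding ideal_set_def by (simp add: a_r_coset_ring_of[OF S I])

lemma Quot_eq_zero_iff: "x \<in> S \<Longrightarrow> I +>\<^bsub>ring_of S\<^esub> x = I \<longleftrightarrow> x \<in> I"
proof -
  assume x: "x \<in> S"
  have "I +>\<^bsub>ring_of S\<^esub> 0 = I"
    unfolding a_r_coset_ring_of[OF S I subring_set_0[OF S]] using I unfolding ideal_set_def by auto
  then show ?thesis using Quot_eq_iff[OF x subring_set_0[OF S]] by simp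
qed

lemma Quot_cring: "cring (ring_of S Quot I)"
  by (rule Q.quotient_is_cring[OF cring_ring_of[OF S]])

lemma Quot_pow: "x \<in> S \<Longrightarrow> (I +>\<^bsub>ring_of S\<^esub> x) [^]\<^bsub>ring_of S Quot I\<^esub> (n::nat) = I +>\<^bsub>ring_of S\<^esub> (x ^ n)"
proof (induction n)
  case 0
  then show ?case by (simp add: nat_pow_def FactRing_def)
next
  case (Suc n)
  then show ?case using Quot_mult[OF subring_set_power[OF S Suc.prems, of n] Suc.prems]
    by (simp add: nat_pow_def mult.commute)
qed

lemma prime_if_Quot_field:
  assumes "field (ring_of S Quot I)"
  shows "prime_set S I"
proof -
  interpret F: field "ring_of S Quot I" by fact
  have "1 \<notin> I" using F.one_not_zero Quot_eq_zero_iff[OF subring_set_1[OF S]] unfolding Quot_one Quot_zero by simp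
  moreover have "a \<in> I \<or> b \<in> I" if "a \<in> S" "b \<in> S" "a * b \<in> I" for a b
    using F.integral[of "I +>\<^bsub>ring_of S\<^esub> a" "I +>\<^bsub>ring_of S\<^esub> b"] that Quot_mult[of a b]
      Quot_eq_zero_iff subring_set_mult[OF S] unfolding Quot_zero Quot_carrier by auto
  ultimately show ?thesis using I unfolding prime_set_def by blast
qed

text \<open>A finite domain is a field: two powers \<open>a ^ i\<close> and \<open>a ^ j\<close>
  agree, and cancelling \<open>a ^ i\<close> makes a power of \<open>a\<close> the inverse.\<close>

lemma Quot_field_if_prime:
  assumes P: "prime_set S I" and fin: "finite (cosets S I)"
  shows "field (ring_of S Quot I)"
proof (rule cring.cring_fieldI2[OF Quot_cring])
  have sub: "submod S I" using I unfolding ideal_set_def by blast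
  show "\<zero>\<^bsub>ring_of S Quot I\<^esub> \<noteq> \<one>\<^bsub>ring_of S Quot I\<^esub>"
    using P Quot_eq_zero_iff[OF subring_set_1[OF S]] unfolding Quot_one Quot_zero prime_set_def by auto
  fix X assume "X \<in> carrier (ring_of S Quot I)" "X \<noteq> \<zero>\<^bsub>ring_of S Quot I\<^esub>"
  then obtain a where a: "a \<in> S" "a \<notin> I" "X = I +>\<^bsub>ring_of S\<^esub> a"
    using Quot_eq_zero_iff unfolding Quot_carrier Quot_zero by auto
  have notin: "a ^ n \<notin> I" for n
    by (induction n) (use P a subring_set_power[OF S a(1)] in \<open>auto simp: prime_set_def\<close>)
  obtain i j :: nat where ij: "i < j" "a ^ j - a ^ i \<in> I"
    using pigeonhole_cosets[OF S sub fin, of "\<lambda>i. a ^ i"] subring_set_power[OF S a(1)] by blast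
  define k where "k = j - i - 1"
  have "j = i + Suc k" using ij(1) by (simp add: k_def)
  then have "a ^ i * (a * a ^ k - 1) \<in> I" using ij(2) by (simp add: power_add algebra_simps)
  moreover have "a * a ^ k - 1 \<in> S"
    using a(1) subring_set_power[OF S a(1), of "Suc k"] subring_set_diff[OF S] subring_set_1[OF S] by simp
  ultimately have "a * a ^ k - 1 \<in> I"
    using P notin[of i] subring_set_power[OF S a(1), of i] unfolding prime_set_def by blast
  then have "X \<otimes>\<^bsub>ring_of S Quot I\<^esub> (I +>\<^bsub>ring_of S\<^esub> (a ^ k)) = \<one>\<^bsub>ring_of S Quot I\<^esub>"
    unfolding a(3) Quot_one Quot_mult[OF a(1) subring_set_power[OF S a(1)]]
    using Quot_eq_iff[of "a * a ^ k" 1] subring_set_power[OF S a(1), of "Suc k"] subring_set_1[OF S] by simp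
  then show "\<exists>Y\<in>carrier (ring_of S Quot I). X \<otimes>\<^bsub>ring_of S Quot I\<^esub> Y = \<one>\<^bsub>ring_of S Quot I\<^esub>"
    using subring_set_power[OF S a(1)] unfolding Quot_carrier by blast
qed

text \<open>Both directions use \<open>a ^ N - a = a * (a ^ (N - 1) - 1)\<close>. Forwards, a
  generator of the unit group has order \<open>card (cosets S I) - 1\<close>; backwards, Lagrange's
  theorem handles the nonzero classes.\<close>

lemma power_fixed_iff:
  assumes P: "prime_set S I" and fin: "finite (cosets S I)" and N: "0 < N"
  shows "(\<forall>a\<in>S. a ^ N - a \<in> I) \<longleftrightarrow> card (cosets S I) - 1 dvd N - 1"
proof -
  let ?F = "ring_of S Quot I"
  have sub: "submod S I" using I unfolding ideal_set_def by blast
  interpret F: field ?F by (rule Quot_field_if_prime[OF P fin])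
  let ?G = "Multiplicative_Group.mult_of ?F"
  interpret G: group ?G by (rule F.field_mult_group)
  have finF: "finite (carrier ?F)" using fin carrier_Quot_ring_of[OF S I] by simp
  have ord: "Coset.order ?G = card (cosets S I) - 1"
    using F.order_mult_of[OF finF] carrier_Quot_ring_of[OF S I] by (simp add: Coset.order_def)
  have pow: "X [^]\<^bsub>?G\<^esub> n = X [^]\<^bsub>?F\<^esub> n" for X and n :: nat by (simp add: Multiplicative_Group.nat_pow_mult_of)
  show ?thesis
  proof
    assume all: "\<forall>a\<in>S. a ^ N - a \<in> I"
    obtain X where X: "X \<in> carrier ?G" "carrier ?G = {X [^]\<^bsub>?F\<^esub> i | i::nat. i \<in> UNIV}"
      using F.finite_field_mult_group_has_gen[OF finF] by blast
    then obtain a where a: "a \<in> S" "X = I +>\<^bsub>ring_of S\<^esub> a" using Quot_carrier by auto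
    then have aI: "a \<notin> I" using X(1) Quot_eq_zero_iff Quot_zero by auto
    have "a * (a ^ (N - 1) - 1) \<in> I"
    proof -
      have "a ^ N = a * a ^ (N - 1)" using N by (simp add: power_eq_if)
      then show ?thesis using bspec[OF all a(1)] by (simp add: algebra_simps)
    qed
    then have "a ^ (N - 1) - 1 \<in> I"
      using P a(1) aI subring_set_power[OF S a(1), of "N - 1"] subring_set_diff[OF S] subring_set_1[OF S]
      unfolding prime_set_def by blast
    then have "X [^]\<^bsub>?G\<^esub> (N - 1) = \<one>\<^bsub>?G\<^esub>"
      unfolding pow a(2) Quot_pow[OF a(1)] using Quot_eq_iff[of "a ^ (N - 1)" 1] subring_set_power[OF S a(1)] subring_set_1[OF S]
      by (simp add: Quot_one)
    then have "G.ord X dvd N - 1" using G.pow_eq_id[OF X(1)] by blast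
    moreover have "G.ord X = Coset.order ?G"
    proof -
      have finG: "finite (carrier ?G)" using finF by simp
      have "carrier ?G = {X [^]\<^bsub>?G\<^esub> i | i::nat. i \<in> UNIV}" using X(2) pow by simp
      also have "\<dots> = {X [^]\<^bsub>?G\<^esub> i | i. i \<in> {0 .. G.ord X - 1}}" using G.ord_elems[OF finG X(1)] .
      finally have "carrier ?G = (\<lambda>i. X [^]\<^bsub>?G\<^esub> i) ` {0 .. G.ord X - 1}" by blast
      moreover have "inj_on (\<lambda>i. X [^]\<^bsub>?G\<^esub> i) {0 .. G.ord X - 1}" using G.ord_inj[OF X(1)] .
      ultimately have "Coset.order ?G = card {0 .. G.ord X - 1}" unfolding Coset.order_def by (metis card_image)
      then show ?thesis using G.ord_ge_1[OF finG X(1)] by simp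
    qed
    ultimately show "card (cosets S I) - 1 dvd N - 1" using ord by simp
  next
    assume dvd: "card (cosets S I) - 1 dvd N - 1"
    show "\<forall>a\<in>S. a ^ N - a \<in> I"
    proof
      fix a assume a: "a \<in> S"
      have eq: "a ^ N - a = a * (a ^ (N - 1) - 1)" using N by (simp add: power_eq_if algebra_simps)
      show "a ^ N - a \<in> I"
      proof (cases "a \<in> I")
        case True
        then show ?thesis unfolding eq
          using subring_set_power[OF S a, of "N - 1"] subring_set_diff[OF S] subring_set_1[OF S] submod_smult_right[OF sub] by blast
      next
        case False
        let ?X = "I +>\<^bsub>ring_of S\<^esub> a"
        have X: "?X \<in> carrier ?G" using a False Quot_eq_zero_iff Quot_zero Quot_carrier by auto
        have "?X [^]\<^bsub>?G\<^esub> Coset.order ?G = \<one>\<^bsub>?G\<^esub>" by (rule G.pow_order_eq_1[OF X])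
        then have "?X [^]\<^bsub>?G\<^esub> (N - 1) = \<one>\<^bsub>?G\<^esub>"
          using dvd ord G.pow_eq_id[OF X] dvd_trans by metis
        then have "a ^ (N - 1) - 1 \<in> I"
          unfolding pow Quot_pow[OF a] using Quot_eq_iff[of "a ^ (N - 1)" 1] subring_set_power[OF S a] subring_set_1[OF S]
          by (simp add: Quot_one)
        then show ?thesis unfolding eq using submod_smult[OF sub a] by blast
      qed
    qed
  qed
qed

lemma carmichael_ideal_iff:
  "carmichael_ideal (ring_of S) I \<longleftrightarrow> finite (cosets S I) \<and> 1 \<notin> I \<and> \<not> prime_set S I \<and>
     (\<forall>a\<in>S. a ^ card (cosets S I) - a \<in> I)"
proof -
  have "(\<forall>X\<in>carrier (ring_of S Quot I). X [^]\<^bsub>ring_of S Quot I\<^esub> card (cosets S I) = X) \<longleftrightarrow>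
      (\<forall>a\<in>S. a ^ card (cosets S I) - a \<in> I)"
    unfolding Quot_carrier using Quot_pow Quot_eq_iff subring_set_power[OF S] by auto
  moreover have "\<one>\<^bsub>ring_of S Quot I\<^esub> \<noteq> \<zero>\<^bsub>ring_of S Quot I\<^esub> \<longleftrightarrow> 1 \<notin> I"
    unfolding Quot_one Quot_zero using Quot_eq_zero_iff[OF subring_set_1[OF S]] by simp
  ultimately show ?thesis
    unfolding carmichael_ideal_def carmichael_ring_def
    using carrier_Quot_ring_of[OF S I] prime_if_Quot_field Quot_field_if_prime by auto
qed

end

lemma composite_ideal_iff:
  assumes S: "subring_set S" and I: "ideal_set S I"
  shows "composite_ideal (ring_of S) I \<longleftrightarrow> I \<noteq> {0} \<and> 1 \<notin> I \<and> \<not> prime_set S I"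
  unfolding composite_ideal_def ideal_ring_of_iff[OF S] primeideal_ring_of_iff[OF S]
  using I ideal_set_one[OF S I] subring_set_1[OF S] by auto

lemma ideal_norm_ring_of: "subring_set S \<Longrightarrow> ideal_set S I \<Longrightarrow> ideal_norm (ring_of S) I = card (cosets S I)"
  unfolding ideal_norm_def by (simp add: carrier_Quot_ring_of)

section \<open>From the given notions to the internal ones\<close>

lemma field_mod_maximal:
  assumes A: "subring_set A" and p: "maximalideal p (ring_of A)"
  shows "field_mod A p"
proof -
  interpret maximalideal p "ring_of A" by fact
  have pI: "ideal_set A p" using is_ideal ideal_ring_of_iff[OF A] by blast
  then have sub: "submod A p" "p \<subseteq> A" unfolding ideal_set_def by blast+
  have "1 \<notin> p" using ideal_set_one[OF A pI] I_notcarr by auto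
  moreover have "\<exists>a'\<in>A. a * a' - 1 \<in> p" if a: "a \<in> A" "a \<notin> p" for a
  proof -
    let ?S = "{j + a * x | j x. j \<in> p \<and> x \<in> A}"
    have S: "ideal_set A ?S" by (rule ideal_plus_principal[OF A pI a(1)])
    moreover have "p \<subseteq> ?S" "a \<in> ?S" by (rule ideal_plus_principal_mem[OF A pI])+
    moreover have "?S \<subseteq> A" using S unfolding ideal_set_def by blast
    ultimately have "?S = p \<or> ?S = A" "a \<in> ?S" using I_maximal[of ?S] ideal_ring_of_iff[OF A] by simp_all
    then have "?S = A" using a(2) by blast
    then have "1 \<in> ?S" using subring_set_1[OF A] by simp
    then obtain j x where jx: "1 = j + a * x" "j \<in> p" "x \<in> A" by blast
    then have "a * x - 1 = - j" by (simp add: algebra_simps)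
    then show ?thesis using jx submod_uminus[OF A sub(1) jx(2)] by (intro bexI[of _ x]) auto
  qed
  ultimately show ?thesis unfolding field_mod_def using sub by blast
qed

lemma dedekind_set_of_dedekind_domain:
  assumes "dedekind_domain A K"
  shows "dedekind_set A K"
proof -
  have noeth: "noetherian_domain (ring_of A)" and frac: "fraction_field_of A K"
    and int: "integral_closure_in A K = A"
    and max: "\<And>P. primeideal P (ring_of A) \<Longrightarrow> P \<noteq> {0} \<Longrightarrow> maximalideal P (ring_of A)"
    using assms unfolding dedekind_domain_def by blast+
  interpret N: noetherian_domain "ring_of A" by (rule noeth)
  have A: "subring_set A" by (rule subring_set_of_ring[OF N.ring_axioms])
  show ?thesis
  proof
    show "subring_set A" by (rule A)
    show "K = {a / b | a b. a \<in> A \<and> b \<in> A \<and> b \<noteq> 0}" using frac unfolding fraction_field_of_def by blast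
    show "x \<in> A" if "x \<in> K" "integral_over A x" for x using int that unfolding integral_closure_in_def by blast
    show "field_mod A p" if "prime_set A p" "p \<noteq> {0}" for p
      by (rule field_mod_maximal[OF A max]) (use primeideal_ring_of_iff[OF A] that in auto)
    fix F :: "'a set set" assume F: "F \<noteq> {}" "\<And>I. I \<in> F \<Longrightarrow> ideal_set A I"
    show "\<exists>I\<in>F. \<forall>J\<in>F. I \<subseteq> J \<longrightarrow> J = I"
    \<comment> \<open>The ring is Noetherian in the sense that a nonempty chain of ideals contains
      its union; Zorn's lemma turns this into the maximal condition.\<close>
    proof (rule subset_Zorn_nonempty[OF F(1)])
      fix C assume C: "C \<noteq> {}" "subset.chain F C"
      have FI: "F \<subseteq> {I. ideal I (ring_of A)}" using F(2) ideal_ring_of_iff[OF A] by simp blast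
      have "subset.chain {I. ideal I (ring_of A)} C"
        unfolding subset.chain_def using C(2)[unfolded subset.chain_def] FI by (meson subset_trans)
      then have "\<Union>C \<in> C" by (rule N.ideal_chain_is_trivial[OF C(1)])
      then show "\<Union>C \<in> F" using C(2)[unfolded subset.chain_def] by (meson subsetD)
    qed
  qed
qed

lemma subfield_set_of_subfield:
  assumes "subfield_of (K :: 'a::field set)"
  shows "subfield_set K"
proof -
  interpret subfield K "ring_of (UNIV :: 'a set)" using assms unfolding subfield_of_def .
  have "ring (ring_of (UNIV :: 'a set))"
    using cring_ring_of[of "UNIV :: 'a set"] unfolding subring_set_def cring_def by simp
  then interpret U: ring "ring_of (UNIV :: 'a set)" .
  have sub: "subring K (ring_of (UNIV :: 'a set))" by (rule subring_axioms)
  have "ring ((ring_of (UNIV :: 'a set))\<lparr>carrier := K\<rparr>)" by (rule U.subring_is_ring[OF sub])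
  moreover have "(ring_of (UNIV :: 'a set))\<lparr>carrier := K\<rparr> = ring_of K" by (simp add: ring_of_def)
  ultimately have K: "subring_set K" using subring_set_of_ring by simp
  have "inverse x \<in> K" if x: "x \<in> K" for x
  proof (cases "x = 0")
    case False
    then have "x \<in> Units ((ring_of (UNIV :: 'a set))\<lparr>carrier := K\<rparr>)" using subfield_Units x by simp
    then obtain y where "y \<in> K" "x * y = 1" unfolding Units_def by (auto simp: mult.commute)
    then show ?thesis using False by (metis inverse_unique)
  qed (use x in simp)
  then show ?thesis using K unfolding subfield_set_def by blast
qed

section \<open>Carmichael ideals\<close>

lemma finite_cosets_mono:
  assumes A: "subring_set A" and Z: "submod A n" "submod A p" "n \<subseteq> p" and fin: "finite (cosets A n)"
  shows "finite (cosets A p)"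
proof -
  have "cosets A p \<subseteq> (\<lambda>X. {y \<in> A. \<exists>x\<in>X. y - x \<in> p}) ` cosets A n"
  proof
    fix Y assume "Y \<in> cosets A p"
    then obtain x where x: "x \<in> A" "Y = {y \<in> A. y - x \<in> p}" unfolding cosets_def by blast
    have "\<exists>w\<in>{y \<in> A. y - x \<in> n}. y - w \<in> p" if "y - x \<in> p" for y
      using that x submod_0[OF Z(1)] by (intro bexI[of _ x]) auto
    moreover have "y - x \<in> p" if "w - x \<in> n" "y - w \<in> p" for y w
      using submod_trans[OF Z(2) that(2)] that(1) Z(3) by blast
    ultimately have "Y = {y \<in> A. \<exists>w\<in>{y \<in> A. y - x \<in> n}. y - w \<in> p}" unfolding x(2) by blast
    then show "Y \<in> (\<lambda>X. {y \<in> A. \<exists>x\<in>X. y - x \<in> p}) ` cosets A n"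
      using x(1) unfolding cosets_def by blast
  qed
  then show ?thesis using fin finite_surj by blast
qed

lemma ideal_dvd_subset:
  assumes A: "subring_set A" and p: "ideal_set A p" and dvd: "ideal_dvd (ring_of A) p n"
  shows "n \<subseteq> p"
proof -
  interpret cring "ring_of A" by (rule cring_ring_of[OF A])
  show ?thesis
    using dvd ideal_prod_inter[of p] p ideal_ring_of_iff[OF A] unfolding ideal_dvd_def by blast
qed

context dedekind_prime
begin

text \<open>To contain is to divide: \<open>x = u * x + v * (t * x)\<close>, with \<open>x\<close>
  and \<open>t * x\<close> in the ideal quotient \<open>J\<close>.\<close>

lemma ideal_dvd_of_subset:
  assumes n: "ideal_set A n" "n \<subseteq> p"
  shows "ideal_dvd (ring_of A) p n"
proof -
  have nI: "submod A n" using n unfolding ideal_set_def by blast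
  define J where "J = {x \<in> A. \<forall>a\<in>p. x * a \<in> n}"
  note J = colon_props[OF n, folded J_def]
  have "n = ideal_prod (ring_of A) p J"
  proof
    show "n \<subseteq> ideal_prod (ring_of A) p J"
    proof
      fix x assume x: "x \<in> n"
      have "u * x + v * (t * x) \<in> ideal_prod (ring_of A) p J"
        using ideal_prod.sum[OF ideal_prod.prod[of u p x J "ring_of A"] ideal_prod.prod[of v p "t * x" J "ring_of A"]]
          u v J x by auto
      also have "u * x + v * (t * x) = (u + t * v) * x" by (simp add: algebra_simps)
      finally show "x \<in> ideal_prod (ring_of A) p J" using uv by simp
    qed
    show "ideal_prod (ring_of A) p J \<subseteq> n"
    proof
      fix x assume "x \<in> ideal_prod (ring_of A) p J"
      then show "x \<in> n"
        by induction (auto simp: J_def mult.commute intro: submod_add[OF nI])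
    qed
  qed
  then show ?thesis unfolding ideal_dvd_def using J(1) ideal_ring_of_iff[OF A] by blast
qed

text \<open>The premise says that \<open>n\<close> lies in the square of \<open>p\<close>. The
  cofactor is the quotient of \<open>n\<close> by that square, and expanding
  \<open>(u + t * v) * (u + t * v) * x = x\<close> writes \<open>x\<close> as a sum of products.
  Used contrapositively, this turns squarefreeness into the condition on \<open>n\<close> and
  \<open>t n\<close>.\<close>

lemma square_dvd:
  assumes n: "ideal_set A n" and sq: "\<And>x. x \<in> n \<Longrightarrow> x \<in> p \<and> t * x \<in> p"
  shows "ideal_dvd (ring_of A) (ideal_prod (ring_of A) p p) n"
proof -
  have nI: "submod A n" "n \<subseteq> A" using n unfolding ideal_set_def by blast+
  let ?pp = "ideal_prod (ring_of A) p p"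
  define J where "J = {x \<in> A. \<forall>a\<in>p. \<forall>b\<in>p. x * (a * b) \<in> n}"
  have J: "ideal_set A J"
    unfolding ideal_set_def submod_def J_def
    using subring_set_0[OF A] subring_set_add[OF A] subring_set_mult[OF A] submod_0[OF nI(1)] submod_add[OF nI(1)] submod_smult[OF nI(1)]
    by (auto simp: distrib_right mult.assoc)
  have in_J: "x \<in> J" "t * x \<in> J" "t * (t * x) \<in> J" if x: "x \<in> n" for x
  proof -
    have "t * x \<in> p" "x \<in> p" using sq[OF x] by blast+
    then have tx: "x \<in> A" "t * x \<in> A" "t * (t * x) \<in> A" using p_subset tp by blast+
    have 1: "x * (a * b) \<in> n" "t * x * (a * b) \<in> n" "t * (t * x) * (a * b) \<in> n" if ab: "a \<in> p" "b \<in> p" for a b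
    proof -
      have m: "a * b \<in> A" "t * a * b \<in> A" "t * a * (t * b) \<in> A"
        using ab p_subset tp subring_set_mult[OF A] by blast+
      show "x * (a * b) \<in> n" using submod_smult_right[OF nI(1) m(1) x] .
      show "t * x * (a * b) \<in> n" using submod_smult_right[OF nI(1) m(2) x] by (simp add: ac_simps)
      show "t * (t * x) * (a * b) \<in> n" using submod_smult_right[OF nI(1) m(3) x] by (simp add: ac_simps)
    qed
    show "x \<in> J" "t * x \<in> J" "t * (t * x) \<in> J" unfolding J_def using tx 1 by blast+
  qed
  have pp: "a * b \<in> ?pp" if "a \<in> p" "b \<in> p" for a b using ideal_prod.prod[of a p b p "ring_of A"] that by simp
  have prodI: "i * j \<in> ideal_prod (ring_of A) ?pp J" if "i \<in> ?pp" "j \<in> J" for i j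
    using ideal_prod.prod[of i ?pp j J "ring_of A"] that by simp
  have sumI: "x + y \<in> ideal_prod (ring_of A) ?pp J"
    if "x \<in> ideal_prod (ring_of A) ?pp J" "y \<in> ideal_prod (ring_of A) ?pp J" for x y
    using ideal_prod.sum[OF that] by simp
  have "n = ideal_prod (ring_of A) ?pp J"
  proof
    show "n \<subseteq> ideal_prod (ring_of A) ?pp J"
    proof
      fix x assume x: "x \<in> n"
      have "u * u * x + (u * v * (t * x) + (u * v * (t * x) + v * v * (t * (t * x)))) \<in> ideal_prod (ring_of A) ?pp J"
        using u v in_J[OF x] by (intro sumI prodI pp)
      also have "u * u * x + (u * v * (t * x) + (u * v * (t * x) + v * v * (t * (t * x)))) = (u + t * v) * (u + t * v) * x"
        by (simp add: algebra_simps)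
      finally show "x \<in> ideal_prod (ring_of A) ?pp J" using uv by simp
    qed
    have in_n: "i * j \<in> n" if "i \<in> ?pp" and j: "j \<in> J" for i j
      using that(1)
    proof induction
      case (prod a b)
      then show ?case using j unfolding J_def by (simp add: mult.commute)
    next
      case (sum a b)
      then show ?case using submod_add[OF nI(1)] by (simp add: distrib_right)
    qed
    show "ideal_prod (ring_of A) ?pp J \<subseteq> n"
    proof
      fix x assume "x \<in> ideal_prod (ring_of A) ?pp J"
      then show "x \<in> n" by induction (auto intro: in_n submod_add[OF nI(1)])
    qed
  qed
  then show ?thesis unfolding ideal_dvd_def using J ideal_ring_of_iff[OF A] by blast
qed

end

lemma sum_of_ideals:
  assumes A: "subring_set A" and I: "ideal_set A I" "ideal_set A J"
  shows "ideal_set A (set_add (ring_of A) I J)" "I \<subseteq> set_add (ring_of A) I J" "J \<subseteq> set_add (ring_of A) I J"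
proof -
  interpret cring "ring_of A" by (rule cring_ring_of[OF A])
  show "ideal_set A (set_add (ring_of A) I J)"
    using add_ideals[of I J] I ideal_ring_of_iff[OF A] by blast
  have "0 \<in> I" "0 \<in> J" using I unfolding ideal_set_def submod_def by blast+
  have "x = x + 0" "x = 0 + x" for x :: 'a by simp_all
  then show "I \<subseteq> set_add (ring_of A) I J" "J \<subseteq> set_add (ring_of A) I J"
    unfolding set_add_def' ring_of_simps using \<open>0 \<in> I\<close> \<open>0 \<in> J\<close> by blast+
qed

context dedekind_ext
begin

context
  fixes n :: "'a set"
  assumes n: "ideal_set A n" "n \<noteq> {0}" "finite (cosets A n)"
begin

lemma prime_above_n:
  assumes p: "prime_set A p" "n \<subseteq> p"
  shows "p \<noteq> {0}" "finite (cosets A p)" "\<exists>t u v. dedekind_prime A K p t u v"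
proof -
  have sub: "submod A n" "submod A p" using n p unfolding prime_set_def ideal_set_def by blast+
  show p0: "p \<noteq> {0}" using n(2) p(2) submod_0[OF sub(1)] by blast
  show "finite (cosets A p)" by (rule finite_cosets_mono[OF A sub p(2) n(3)])
  show "\<exists>t u v. dedekind_prime A K p t u v" by (rule dedekind_prime_exists[OF p(1) p0])
qed

text \<open>A proper sum of the two ideals would lie in a prime, and a prime contains the
  discriminant as soon as it contains all its generators. Comaximality is thus split into one
  condition per prime, the form required by the criterion for reducedness.\<close>

lemma coprime_disc_iff:
  "set_add (ring_of A) n (disc_ideal A B K L d) = A \<longleftrightarrow>
     (\<forall>p. prime_set A p \<longrightarrow> n \<subseteq> p \<longrightarrow> (\<exists>x. (\<forall>i<d. x i \<in> B) \<and> disc_tuple K L d x \<notin> p))"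
proof -
  define X where "X = {disc_tuple K L d x | x. \<forall>i<d. x i \<in> B}"
  have X: "X \<subseteq> A" unfolding X_def using disc_in_A by blast
  have D: "disc_ideal A B K L d = gen_ideal A X" unfolding disc_ideal_def X_def genideal_ring_of[OF A] ..
  have DI: "ideal_set A (gen_ideal A X)" by (rule gen_ideal_ideal[OF A X])
  note S = sum_of_ideals[OF A n(1) DI]
  show ?thesis
    unfolding D
  proof (intro iffI allI impI)
    fix p assume eq: "set_add (ring_of A) n (gen_ideal A X) = A" and p: "prime_set A p" "n \<subseteq> p"
    have pI: "ideal_set A p" "submod A p" "1 \<notin> p" using p(1) unfolding prime_set_def ideal_set_def by blast+
    show "\<exists>x. (\<forall>i<d. x i \<in> B) \<and> disc_tuple K L d x \<notin> p"
    proof (rule ccontr)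
      assume "\<not> ?thesis"
      then have "X \<subseteq> p" unfolding X_def by blast
      then have "gen_ideal A X \<subseteq> p" by (rule gen_ideal_minimal[OF pI(1)])
      then have "set_add (ring_of A) n (gen_ideal A X) \<subseteq> p"
        using p(2) submod_add[OF pI(2)] unfolding set_add_def' by auto
      then show False using eq pI(3) subring_set_1[OF A] by blast
    qed
  next
    assume all: "\<forall>p. prime_set A p \<longrightarrow> n \<subseteq> p \<longrightarrow> (\<exists>x. (\<forall>i<d. x i \<in> B) \<and> disc_tuple K L d x \<notin> p)"
    have "1 \<in> set_add (ring_of A) n (gen_ideal A X)"
    proof (rule ccontr)
      assume "1 \<notin> set_add (ring_of A) n (gen_ideal A X)"
      then obtain p where p: "prime_set A p" "set_add (ring_of A) n (gen_ideal A X) \<subseteq> p" using prime_above[OF S(1)] by blast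
      then have "n \<subseteq> p" "X \<subseteq> p" using S gen_ideal_superset[of X A] by blast+
      then show False using all p(1) unfolding X_def by blast
    qed
    then show "set_add (ring_of A) n (gen_ideal A X) = A" by (rule ideal_set_one[OF A S(1)])
  qed
qed

text \<open>\<open>inter\<close> allows membership in \<open>n B\<close> to be tested on
  \<open>pB\<close>, prime by prime. If the identity holds, \<open>z ^ N = z\<close> with
  \<open>N \<ge> 2\<close> makes \<open>B / pB\<close> reduced, and the identity passes to the
  residue fields. Conversely, with \<open>B / pB\<close> reduced, an element
  \<open>a ^ N - a\<close> outside \<open>pB\<close> would be nonzero in some residue field.\<close>

lemma carmichael_condition:
  assumes inter: "\<And>x. x \<in> B \<Longrightarrow> (\<And>p t u v. dedekind_prime A K p t u v \<Longrightarrow> n \<subseteq> p \<Longrightarrow> t * x \<in> B) \<Longrightarrow> x \<in> gen_ideal B n"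
    and N: "2 \<le> N"
  shows "(\<forall>a\<in>B. a ^ N - a \<in> gen_ideal B n) \<longleftrightarrow>
    (\<forall>p. prime_set A p \<longrightarrow> n \<subseteq> p \<longrightarrow> (\<exists>x. (\<forall>i<d. x i \<in> B) \<and> disc_tuple K L d x \<notin> p)) \<and>
    (\<forall>p P. prime_set A p \<longrightarrow> n \<subseteq> p \<longrightarrow> prime_set B P \<longrightarrow> P \<inter> A = p \<longrightarrow>
       card (cosets A p) ^ residue_degree A B p P - 1 dvd N - 1)"
proof -
  have nB: "gen_ideal B n \<subseteq> I" if "ideal_set B I" "p \<subseteq> I" "n \<subseteq> p" for I p
    using gen_ideal_minimal[OF that(1), of n] that by blast
  have fixed: "(\<forall>a\<in>B. a ^ N - a \<in> P) \<longleftrightarrow> card (cosets A p) ^ residue_degree A B p P - 1 dvd N - 1"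
    if p: "prime_set A p" "n \<subseteq> p" and P: "prime_set B P" "P \<inter> A = p" for p P
  proof -
    have PI: "ideal_set B P" using P(1) unfolding prime_set_def by blast
    have rd: "finite (cosets B P)" "card (cosets B P) = card (cosets A p) ^ residue_degree A B p P"
      using residue_degree_props[OF P p(1) prime_above_n(1,2)[OF p]] by blast+
    show ?thesis using power_fixed_iff[OF B_ring PI P(1) rd(1), of N] N rd(2) by simp
  qed
  show ?thesis
  proof (intro iffI conjI allI impI)
    fix p assume all: "\<forall>a\<in>B. a ^ N - a \<in> gen_ideal B n" and p: "prime_set A p" "n \<subseteq> p"
    obtain t u v where dp: "dedekind_prime A K p t u v" using prime_above_n(3)[OF p] by blast
    interpret E: ext_at_prime A K L p d t u v by (rule ext_at_primeI[OF dp])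
    have pBI: "ideal_set B E.pB" using E.pB_ideal E.pB_B unfolding ideal_set_def by blast
    have E.reduced
      unfolding E.reduced_def
    proof (intro ballI impI)
      fix z assume z: "z \<in> B" "z * z \<in> E.pB"
      obtain k where k: "N = Suc (Suc k)" using N by (metis One_nat_def Suc_1 add_Suc le_Suc_ex)
      have "z ^ k * (z * z) \<in> E.pB" by (rule submod_smult[OF E.pB_ideal subring_set_power[OF B_ring z(1)] z(2)])
      then have "z ^ N \<in> E.pB" unfolding k by (simp add: ac_simps)
      moreover have "z ^ N - z \<in> E.pB" using all z(1) nB[OF pBI E.p_pB p(2)] by blast
      ultimately show "z \<in> E.pB" using submod_mem_cong[OF B_ring E.pB_ideal] by blast
    qed
    then show "\<exists>x. (\<forall>i<d. x i \<in> B) \<and> disc_tuple K L d x \<notin> p"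
      by (rule E.disc_not_in_p[OF _ prime_above_n(2)[OF p]])
  next
    fix p P assume all: "\<forall>a\<in>B. a ^ N - a \<in> gen_ideal B n" and p: "prime_set A p" "n \<subseteq> p"
      and P: "prime_set B P" "P \<inter> A = p"
    have PI: "ideal_set B P" "p \<subseteq> P" using P unfolding prime_set_def by blast+
    have "\<forall>a\<in>B. a ^ N - a \<in> P" using all nB[OF PI p(2)] by blast
    then show "card (cosets A p) ^ residue_degree A B p P - 1 dvd N - 1" using fixed[OF p P] by blast
  next
    assume cond: "(\<forall>p. prime_set A p \<longrightarrow> n \<subseteq> p \<longrightarrow> (\<exists>x. (\<forall>i<d. x i \<in> B) \<and> disc_tuple K L d x \<notin> p)) \<and>
      (\<forall>p P. prime_set A p \<longrightarrow> n \<subseteq> p \<longrightarrow> prime_set B P \<longrightarrow> P \<inter> A = p \<longrightarrow>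
         card (cosets A p) ^ residue_degree A B p P - 1 dvd N - 1)"
    show "\<forall>a\<in>B. a ^ N - a \<in> gen_ideal B n"
    proof
      fix a assume a: "a \<in> B"
      have aB: "a ^ N - a \<in> B" using a subring_set_diff[OF B_ring] subring_set_power[OF B_ring] by blast
      show "a ^ N - a \<in> gen_ideal B n"
      proof (rule inter[OF aB])
        fix p t u v assume dp: "dedekind_prime A K p t u v" and np: "n \<subseteq> p"
        interpret E: ext_at_prime A K L p d t u v by (rule ext_at_primeI[OF dp])
        obtain x where x: "\<And>i. i < d \<Longrightarrow> x i \<in> B" "disc_tuple K L d x \<notin> p"
          using cond E.p_prime_set np by blast
        have red: E.reduced unfolding E.reduced_def using E.reduced_if_disc[OF x] by blast
        have "a ^ N - a \<in> E.pB"
        proof (rule ccontr)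
          assume "a ^ N - a \<notin> E.pB"
          then obtain P where P: "prime_set B P" "P \<inter> A = p" "a ^ N - a \<notin> P"
            using E.prime_avoiding[OF red aB] by blast
          then show False using fixed[OF E.p_prime_set np P(1,2)] cond E.p_prime_set np a by blast
        qed
        then show "t * (a ^ N - a) \<in> B" using E.pB_iff by blast
      qed
    qed
  qed
qed

end

end

theorem theorem3p2:
  fixes OK K L :: "'a::field set" and d :: nat and n :: "'a set"
  assumes K_field: "subfield_of K" and L_field: "subfield_of L" and KL: "K \<subseteq> L"
    and ded: "dedekind_domain OK K"
    and deg: "ext_degree K L d"
    and sep: "separable_ext K L"
    and n_ideal: "ideal n (ring_of OK)" and n_nz: "n \<noteq> {0}"
    and n_sqf: "squarefree_ideal (ring_of OK) n"
    and n_fin: "finite (carrier (ring_of OK Quot n))"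
  shows "carmichael_ideal (ring_of (integral_closure_in OK L))
            (genideal (ring_of (integral_closure_in OK L)) n)
    \<longleftrightarrow>
     composite_ideal (ring_of (integral_closure_in OK L))
            (genideal (ring_of (integral_closure_in OK L)) n)
     \<and> set_add (ring_of OK) n (disc_ideal OK (integral_closure_in OK L) K L d) = OK
     \<and> (\<forall>p P. primeideal p (ring_of OK) \<and> ideal_dvd (ring_of OK) p n \<and>
              primeideal P (ring_of (integral_closure_in OK L)) \<and> P \<inter> OK = p \<longrightarrow>
              (ideal_norm (ring_of OK) p ^ residue_degree OK (integral_closure_in OK L) p P - 1)
                dvd (ideal_norm (ring_of OK) n ^ d - 1))"
proof -
  interpret D: dedekind_set OK K by (rule dedekind_set_of_dedekind_domain[OF ded])
  interpret D: dedekind_ext OK K L d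
    using subfield_set_of_subfield[OF K_field] subfield_set_of_subfield[OF L_field] KL deg sep by unfold_locales
  let ?B = "integral_closure_in OK L"
  have nI: "ideal_set OK n" using n_ideal ideal_ring_of_iff[OF D.A] by blast
  then have n_sub: "submod OK n" "n \<subseteq> OK" unfolding ideal_set_def by blast+
  have fin: "finite (cosets OK n)" using n_fin carrier_Quot_ring_of[OF D.A nI] by simp
  have sqf: "\<exists>x\<in>n. x \<notin> p \<or> t * x \<notin> p" if dp: "dedekind_prime OK K p t u v" for p t u v
  proof (rule ccontr)
    assume no: "\<not> ?thesis"
    interpret E: dedekind_prime OK K p t u v by (rule dp)
    have "ideal_dvd (ring_of OK) (ideal_prod (ring_of OK) p p) n"
      by (rule E.square_dvd[OF nI]) (use no in blast)
    moreover have "primeideal p (ring_of OK)" using E.p_prime_set primeideal_ring_of_iff[OF D.A] by blast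
    moreover have "p \<noteq> {0}"
    proof
      assume "p = {0}"
      then have "u + t * v = 0" using E.u E.v by simp
      then show False using E.uv by simp
    qed
    ultimately show False using n_sqf unfolding squarefree_ideal_def by simp
  qed
  define nB where "nB = gen_ideal ?B n"
  define N where "N = card (cosets OK n) ^ d"
  have nBI: "ideal_set ?B nB" unfolding nB_def using gen_ideal_ideal[OF D.B_ring] n_sub D.A_B by blast
  have SQ: "finite (cosets ?B nB) \<and> card (cosets ?B nB) = N \<and>
      (\<forall>x\<in>?B. (\<forall>p t u v. dedekind_prime OK K p t u v \<longrightarrow> n \<subseteq> p \<longrightarrow> t * x \<in> ?B) \<longrightarrow> x \<in> nB)"
    unfolding nB_def N_def by (rule D.squarefree_extension[OF nI n_nz fin]) (rule sqf)
  have finB: "finite (cosets ?B nB)" and cardB: "card (cosets ?B nB) = N"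
    using SQ by blast+
  have inter: "x \<in> nB" if "x \<in> ?B" "\<And>p t u v. dedekind_prime OK K p t u v \<Longrightarrow> n \<subseteq> p \<Longrightarrow> t * x \<in> ?B" for x
    using SQ that by blast
  have nB0: "nB \<noteq> {0}"
    using gen_ideal_superset[of n ?B] n_nz submod_0[OF n_sub(1)] unfolding nB_def by blast
  have norm_n: "ideal_norm (ring_of OK) n ^ d = N" unfolding N_def ideal_norm_ring_of[OF D.A nI] ..
  show ?thesis
    unfolding genideal_ring_of[OF D.B_ring] nB_def[symmetric] carmichael_ideal_iff[OF D.B_ring nBI]
      composite_ideal_iff[OF D.B_ring nBI] norm_n cardB primeideal_ring_of_iff[OF D.A] primeideal_ring_of_iff[OF D.B_ring]
  proof (cases "1 \<in> nB")
    \<comment> \<open>If \<open>1 \<in> nB\<close>, neither side holds, as both demand a proper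
      ideal. Here \<open>n\<close> is proper too, which gives \<open>N \<ge> 2\<close> because
      \<open>d\<close> is positive.\<close>
    case False
    have n1: "1 \<notin> n" using False gen_ideal_superset[of n ?B] unfolding nB_def by blast
    have "2 \<le> card (cosets OK n)" by (rule card_cosets_ge_2[OF D.A n_sub(1) n1 fin])
    then have N: "2 \<le> N" unfolding N_def
      using self_le_power[of "card (cosets OK n)" d] D.degree_pos by simp
    have cond3: "(\<forall>p P. prime_set OK p \<and> ideal_dvd (ring_of OK) p n \<and> prime_set ?B P \<and> P \<inter> OK = p \<longrightarrow>
          ideal_norm (ring_of OK) p ^ residue_degree OK ?B p P - 1 dvd N - 1) \<longleftrightarrow>
        (\<forall>p P. prime_set OK p \<longrightarrow> n \<subseteq> p \<longrightarrow> prime_set ?B P \<longrightarrow> P \<inter> OK = p \<longrightarrow>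
          card (cosets OK p) ^ residue_degree OK ?B p P - 1 dvd N - 1)"
    proof -
      have "ideal_dvd (ring_of OK) p n \<longleftrightarrow> n \<subseteq> p" if p: "prime_set OK p" for p
      proof
        show "n \<subseteq> p" if "ideal_dvd (ring_of OK) p n"
          using ideal_dvd_subset[OF D.A _ that] p unfolding prime_set_def by blast
        assume np: "n \<subseteq> p"
        obtain t u v where "dedekind_prime OK K p t u v" using D.prime_above_n(3)[OF nI n_nz fin p np] by blast
        then show "ideal_dvd (ring_of OK) p n" using dedekind_prime.ideal_dvd_of_subset[OF _ nI np] by blast
      qed
      moreover have "ideal_norm (ring_of OK) p = card (cosets OK p)" if "prime_set OK p" for p
        using ideal_norm_ring_of[OF D.A] that unfolding prime_set_def by blast
      ultimately show ?thesis by auto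
    qed
    show "(finite (cosets ?B nB) \<and> 1 \<notin> nB \<and> \<not> prime_set ?B nB \<and> (\<forall>a\<in>?B. a ^ N - a \<in> nB)) \<longleftrightarrow>
      (nB \<noteq> {0} \<and> 1 \<notin> nB \<and> \<not> prime_set ?B nB) \<and>
      set_add (ring_of OK) n (disc_ideal OK ?B K L d) = OK \<and>
      (\<forall>p P. prime_set OK p \<and> ideal_dvd (ring_of OK) p n \<and> prime_set ?B P \<and> P \<inter> OK = p \<longrightarrow>
          ideal_norm (ring_of OK) p ^ residue_degree OK ?B p P - 1 dvd N - 1)"
      unfolding cond3 D.coprime_disc_iff[OF nI n_nz fin]
      using D.carmichael_condition[OF nI n_nz fin inter[unfolded nB_def] N, folded nB_def] False finB nB0
      by blast
  qed simp
qed

end
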